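(* Let $M$ be an $F$-structure manifold of degree $K$. The $F$-structure is partially integrable if and only if one of the following equivalent conditions is satisfied: $$N_F(lX,lY)=0\quad\text{for all vector fields }X,Y\text{ on }M,$$ or $$N_F(FX,FY)=0\quad\text{for all vector fields }X,Y\text{ on }M.$$
   Context: An $F$-structure manifold of degree $K$ is a smooth $n$-dimensional manifold $M$ with a nonzero smooth $(1,1)$-tensor field $F$ of constant rank $r$ satisfying $\alpha F^{K+1}+\beta F^{K}+F=0$, where $K\ge 3$ is an integer and $\alpha,\beta$ are real or complex numbers (polynomials in $F$ with complex coefficients are regarded as endomorphisms of the complexified tangent bundle). Put $l=-(\alpha F^{K}+\beta F^{K-1})$ and $m=I+\alpha F^{K}+\beta F^{K-1}$; $D_l=\mathrm{Im}\,l$ and $D_m=\mathrm{Im}\,m$ are complementary distributions of dimensions $r$ and $n-r$. For a $(1,1)$-tensor field $T$, the Nijenhuis tensor is $N_T(X,Y)=[TX,TY]-T[TX,Y]-T[X,TY]+T^2[X,Y]$; $T$ is called integrable when $N_T=0$. A distribution $D$ is integrable if through each point of $M$ there is an integral manifold of $D$ (equivalently, by Frobenius, $D$ is involutive). If $D_l$ is integrable, $F$ leaves invariant the tangent spaces of each integral manifold of $D_l$, and $\widetilde{F}$ denotes the induced $(1,1)$-tensor field on each integral manifold, $\widetilde{F}U=FU$. The $F$-structure is partially integrable if $D_l$ is integrable and the structure $\widetilde{F}$ induced from $F$ on each integral manifold of $D_l$ is integrable. *)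

theory Defs
  imports "HOL-Analysis.Analysis" "HOL-Library.Function_Algebras"
begin

text \<open>Tangent vectors will be families of coordinate vectors indexed by charts; the pointwise
  operations on functions make them real vector spaces.\<close>

instantiation "fun" :: (type, real_vector) real_vector
begin

definition scaleR_fun :: "real \<Rightarrow> ('a \<Rightarrow> 'b) \<Rightarrow> 'a \<Rightarrow> 'b"
  where "scaleR_fun a f = (\<lambda>x. a *\<^sub>R f x)"

instance
  by standard (simp_all add: scaleR_fun_def fun_eq_iff plus_fun_def algebra_simps)

end


section \<open>Smooth manifolds\<close>

text \<open>Both notions below are meant for open sets \<open>S\<close> only. Asking for continuity of all
  directional derivatives of all orders is the usual notion, since the domain is
  finite-dimensional.\<close>

primrec Ck_on :: "nat \<Rightarrow> 'a::euclidean_space set \<Rightarrow> ('a \<Rightarrow> 'b::real_normed_vector) \<Rightarrow> bool" where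
  "Ck_on 0 S f \<longleftrightarrow> continuous_on S f"
| "Ck_on (Suc k) S f \<longleftrightarrow>
     (\<forall>x\<in>S. f differentiable (at x)) \<and> (\<forall>v. Ck_on k S (\<lambda>x. frechet_derivative f (at x) v))"

definition smooth_on :: "'a::euclidean_space set \<Rightarrow> ('a \<Rightarrow> 'b::real_normed_vector) \<Rightarrow> bool" where
  "smooth_on S f \<longleftrightarrow> (\<forall>k. Ck_on k S f)"

text \<open>A chart is a domain together with a coordinate map, whose values off the domain are
  irrelevant.\<close>

type_synonym ('m, 'e) chart = "'m set \<times> ('m \<Rightarrow> 'e)"

abbreviation cdom :: "('m, 'e) chart \<Rightarrow> 'm set" where "cdom \<equiv> fst"
abbreviation cmap :: "('m, 'e) chart \<Rightarrow> 'm \<Rightarrow> 'e" where "cmap \<equiv> snd"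

definition cinv :: "('m, 'e) chart \<Rightarrow> 'e \<Rightarrow> 'm" where
  "cinv c = inv_into (cdom c) (cmap c)"

definition cimage :: "('m, 'e) chart \<Rightarrow> 'e set" where
  "cimage c = cmap c ` cdom c"

definition is_chart :: "'m topology \<Rightarrow> ('m, 'e::euclidean_space) chart \<Rightarrow> bool" where
  "is_chart M c \<longleftrightarrow> openin M (cdom c) \<and> open (cimage c) \<and>
     homeomorphic_map (subtopology M (cdom c)) (top_of_set (cimage c)) (cmap c)"

text \<open>A smooth manifold of dimension \<open>DIM('e)\<close>. The atlas need not be maximal; everything defined
  below depends only on the smooth structure it generates.\<close>

definition smooth_manifold :: "'m topology \<Rightarrow> ('m, 'e::euclidean_space) chart set \<Rightarrow> bool" where
  "smooth_manifold M A \<longleftrightarrow>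
     Hausdorff_space M \<and> second_countable M \<and>
     (\<forall>c\<in>A. is_chart M c) \<and> (\<Union>c\<in>A. cdom c) = topspace M \<and>
     (\<forall>c\<in>A. \<forall>d\<in>A. smooth_on (cmap c ` (cdom c \<inter> cdom d)) (cmap d \<circ> cinv c))"


section \<open>Tangent vectors, vector fields and (1,1)-tensor fields\<close>

text \<open>A tangent vector at \<open>p\<close> is the family of its coordinate vectors in the charts at \<open>p\<close>, related by
  the derivatives of the transition maps (and zero in the charts whose domain does not
  contain \<open>p\<close>).\<close>

type_synonym ('m, 'e) tvec = "('m, 'e) chart \<Rightarrow> 'e"

definition tangent_space ::
    "('m, 'e::euclidean_space) chart set \<Rightarrow> 'm \<Rightarrow> ('m, 'e) tvec set" where
  "tangent_space A p = {v.
     (\<forall>c. \<not> (c \<in> A \<and> p \<in> cdom c) \<longrightarrow> v c = 0) \<and>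
     (\<forall>c\<in>A. \<forall>d\<in>A. p \<in> cdom c \<and> p \<in> cdom d \<longrightarrow>
        v d = frechet_derivative (cmap d \<circ> cinv c) (at (cmap c p)) (v c))}"

definition vec_in_chart :: "('m, 'e) chart \<Rightarrow> ('m \<Rightarrow> ('m, 'e) tvec) \<Rightarrow> 'e \<Rightarrow> 'e" where
  "vec_in_chart c X = (\<lambda>x. X (cinv c x) c)"

definition smooth_vector_field ::
    "'m topology \<Rightarrow> ('m, 'e::euclidean_space) chart set \<Rightarrow> ('m \<Rightarrow> ('m, 'e) tvec) \<Rightarrow> bool" where
  "smooth_vector_field M A X \<longleftrightarrow>
     (\<forall>p\<in>topspace M. X p \<in> tangent_space A p) \<and>
     (\<forall>c\<in>A. smooth_on (cimage c) (vec_in_chart c X))"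

text \<open>In coordinates, \<open>[X,Y]\<^sup>i = X\<^sup>j \<partial>\<^sub>j Y\<^sup>i - Y\<^sup>j \<partial>\<^sub>j X\<^sup>i\<close>.\<close>

definition lie_bracket ::
    "('m, 'e::euclidean_space) chart set \<Rightarrow> ('m \<Rightarrow> ('m, 'e) tvec) \<Rightarrow> ('m \<Rightarrow> ('m, 'e) tvec) \<Rightarrow>
     'm \<Rightarrow> ('m, 'e) tvec" where
  "lie_bracket A X Y p = (\<lambda>c. if c \<in> A \<and> p \<in> cdom c then
       frechet_derivative (vec_in_chart c Y) (at (cmap c p)) (X p c) -
       frechet_derivative (vec_in_chart c X) (at (cmap c p)) (Y p c)
     else 0)"

definition coord_vec ::
    "('m, 'e::euclidean_space) chart set \<Rightarrow> ('m, 'e) chart \<Rightarrow> 'e \<Rightarrow> 'm \<Rightarrow> ('m, 'e) tvec" where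
  "coord_vec A c e p = (\<lambda>d. if d \<in> A \<and> p \<in> cdom d
     then frechet_derivative (cmap d \<circ> cinv c) (at (cmap c p)) e else 0)"

text \<open>\<open>coord_vec A c e\<close> is the local coordinate field with constant component \<open>e\<close> in the chart \<open>c\<close>,
  so the last condition says that the components of \<open>F\<close> in each chart are smooth. The values of
  \<open>F p\<close> outside the tangent space at \<open>p\<close> are irrelevant.\<close>

type_synonym ('m, 'e) endo_field = "'m \<Rightarrow> ('m, 'e) tvec \<Rightarrow> ('m, 'e) tvec"

definition tensor_field_11 ::
    "'m topology \<Rightarrow> ('m, 'e::euclidean_space) chart set \<Rightarrow> ('m, 'e) endo_field \<Rightarrow> bool" where
  "tensor_field_11 M A F \<longleftrightarrow>
     (\<forall>p\<in>topspace M. \<forall>u\<in>tangent_space A p.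
        F p u \<in> tangent_space A p \<and>
        (\<forall>v\<in>tangent_space A p. F p (u + v) = F p u + F p v) \<and>
        (\<forall>a. F p (a *\<^sub>R u) = a *\<^sub>R F p u)) \<and>
     (\<forall>c\<in>A. \<forall>e. smooth_on (cimage c) (vec_in_chart c (\<lambda>p. F p (coord_vec A c e p))))"

definition nijenhuis ::
    "('m, 'e::euclidean_space) chart set \<Rightarrow> ('m, 'e) endo_field \<Rightarrow>
     ('m \<Rightarrow> ('m, 'e) tvec) \<Rightarrow> ('m \<Rightarrow> ('m, 'e) tvec) \<Rightarrow> 'm \<Rightarrow> ('m, 'e) tvec" where
  "nijenhuis A T X Y p =
     lie_bracket A (\<lambda>q. T q (X q)) (\<lambda>q. T q (Y q)) p
     - T p (lie_bracket A (\<lambda>q. T q (X q)) Y p)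
     - T p (lie_bracket A X (\<lambda>q. T q (Y q)) p)
     + T p (T p (lie_bracket A X Y p))"

definition integrable_tensor ::
    "'m topology \<Rightarrow> ('m, 'e::euclidean_space) chart set \<Rightarrow> ('m, 'e) endo_field \<Rightarrow> bool" where
  "integrable_tensor M A T \<longleftrightarrow>
     (\<forall>X Y. smooth_vector_field M A X \<and> smooth_vector_field M A Y \<longrightarrow>
        (\<forall>p\<in>topspace M. nijenhuis A T X Y p = 0))"


section \<open>Integral manifolds\<close>

definition smooth_map ::
    "'m topology \<Rightarrow> ('m, 'd::euclidean_space) chart set \<Rightarrow>
     'n topology \<Rightarrow> ('n, 'e::euclidean_space) chart set \<Rightarrow> ('m \<Rightarrow> 'n) \<Rightarrow> bool" where
  "smooth_map S B M A f \<longleftrightarrow> continuous_map S M f \<and>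
     (\<forall>b\<in>B. \<forall>c\<in>A. smooth_on (cmap b ` (cdom b \<inter> f -` cdom c)) (cmap c \<circ> f \<circ> cinv b))"

text \<open>The value of the differential does not depend on the chart of the source that is chosen.\<close>

definition differential ::
    "('m, 'd::euclidean_space) chart set \<Rightarrow> ('n, 'e::euclidean_space) chart set \<Rightarrow>
     ('m \<Rightarrow> 'n) \<Rightarrow> 'm \<Rightarrow> ('m, 'd) tvec \<Rightarrow> ('n, 'e) tvec" where
  "differential B A f p u =
     (let b = (SOME b. b \<in> B \<and> p \<in> cdom b) in
      (\<lambda>c. if c \<in> A \<and> f p \<in> cdom c
           then frechet_derivative (cmap c \<circ> f \<circ> cinv b) (at (cmap b p)) (u b) else 0))"

text \<open>An integral manifold of \<open>D\<close> is an immersed submanifold (with its own topology \<open>S\<close>, possibly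
  finer than the subspace topology, and its own atlas \<open>B\<close>) whose tangent spaces are the spaces of
  \<open>D\<close>. It need not be connected.\<close>

definition integral_manifold ::
    "'m topology \<Rightarrow> ('m, 'e::euclidean_space) chart set \<Rightarrow> ('m \<Rightarrow> ('m, 'e) tvec set) \<Rightarrow>
     'm topology \<Rightarrow> ('m, 'd::euclidean_space) chart set \<Rightarrow> bool" where
  "integral_manifold M A D S B \<longleftrightarrow>
     smooth_manifold S B \<and> topspace S \<subseteq> topspace M \<and> smooth_map S B M A (\<lambda>p. p) \<and>
     (\<forall>p\<in>topspace S.
        inj_on (differential B A (\<lambda>p. p) p) (tangent_space B p) \<and>
        differential B A (\<lambda>p. p) p ` tangent_space B p = D p)"

text \<open>The type argument is a model space for the integral manifolds: for a distribution of
  dimension \<open>r\<close> it must have dimension \<open>r\<close>.\<close>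

definition integrable_distribution ::
    "'d::euclidean_space itself \<Rightarrow> 'm topology \<Rightarrow> ('m, 'e::euclidean_space) chart set \<Rightarrow>
     ('m \<Rightarrow> ('m, 'e) tvec set) \<Rightarrow> bool" where
  "integrable_distribution _ M A D \<longleftrightarrow>
     (\<forall>p\<in>topspace M. \<exists>S (B :: ('m, 'd) chart set). p \<in> topspace S \<and> integral_manifold M A D S B)"

text \<open>The tensor field induced on an integral manifold whose tangent spaces are invariant
  under \<open>F\<close>.\<close>

definition induced_tensor ::
    "('m, 'e::euclidean_space) chart set \<Rightarrow> ('m, 'd::euclidean_space) chart set \<Rightarrow>
     ('m, 'e) endo_field \<Rightarrow> ('m, 'd) endo_field" where
  "induced_tensor A B F p u =
     inv_into (tangent_space B p) (differential B A (\<lambda>p. p) p)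
       (F p (differential B A (\<lambda>p. p) p u))"


section \<open>Complexification\<close>

text \<open>A complex tangent vector \<open>u + \<i> v\<close> is the pair \<open>(u, v)\<close>. Endomorphisms and the Nijenhuis tensor
  are extended complex (bi)linearly.\<close>

type_synonym ('m, 'e) ctvec = "('m, 'e) tvec \<times> ('m, 'e) tvec"

definition ctangent_space ::
    "('m, 'e::euclidean_space) chart set \<Rightarrow> 'm \<Rightarrow> ('m, 'e) ctvec set" where
  "ctangent_space A p = tangent_space A p \<times> tangent_space A p"

definition cscale :: "complex \<Rightarrow> 'v \<times> 'v \<Rightarrow> 'v::real_vector \<times> 'v" where
  "cscale z w = (Re z *\<^sub>R fst w - Im z *\<^sub>R snd w, Re z *\<^sub>R snd w + Im z *\<^sub>R fst w)"

definition complexify :: "('m, 'e) endo_field \<Rightarrow> 'm \<Rightarrow> ('m, 'e) ctvec \<Rightarrow> ('m, 'e) ctvec" where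
  "complexify F p w = (F p (fst w), F p (snd w))"

definition cnijenhuis ::
    "('m, 'e::euclidean_space) chart set \<Rightarrow> ('m, 'e) endo_field \<Rightarrow>
     ('m \<Rightarrow> ('m, 'e) ctvec) \<Rightarrow> ('m \<Rightarrow> ('m, 'e) ctvec) \<Rightarrow> 'm \<Rightarrow> ('m, 'e) ctvec" where
  "cnijenhuis A T Z W p =
     (nijenhuis A T (\<lambda>q. fst (Z q)) (\<lambda>q. fst (W q)) p - nijenhuis A T (\<lambda>q. snd (Z q)) (\<lambda>q. snd (W q)) p,
      nijenhuis A T (\<lambda>q. fst (Z q)) (\<lambda>q. snd (W q)) p + nijenhuis A T (\<lambda>q. snd (Z q)) (\<lambda>q. fst (W q)) p)"


section \<open>F-structures\<close>

text \<open>\<open>\<alpha> F\<^sup>K\<^sup>+\<^sup>1 + \<beta> F\<^sup>K + F = 0\<close>, with \<open>F\<close> nonzero and of constant rank \<open>r\<close>. Real \<open>\<alpha>\<close>, \<open>\<beta>\<close> are the case of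
  vanishing imaginary parts.\<close>

definition F_structure ::
    "'m topology \<Rightarrow> ('m, 'e::euclidean_space) chart set \<Rightarrow> ('m, 'e) endo_field \<Rightarrow>
     complex \<Rightarrow> complex \<Rightarrow> nat \<Rightarrow> nat \<Rightarrow> bool" where
  "F_structure M A F \<alpha> \<beta> K r \<longleftrightarrow>
     tensor_field_11 M A F \<and>
     (\<exists>p\<in>topspace M. \<exists>v\<in>tangent_space A p. F p v \<noteq> 0) \<and>
     (\<forall>p\<in>topspace M. dim (F p ` tangent_space A p) = r) \<and>
     (\<forall>p\<in>topspace M. \<forall>w\<in>ctangent_space A p.
        cscale \<alpha> ((complexify F p ^^ (K + 1)) w) + cscale \<beta> ((complexify F p ^^ K) w)
          + complexify F p w = 0)"

definition l_op :: "('m, 'e::euclidean_space) endo_field \<Rightarrow> complex \<Rightarrow> complex \<Rightarrow> nat \<Rightarrow>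
     'm \<Rightarrow> ('m, 'e) ctvec \<Rightarrow> ('m, 'e) ctvec" where
  "l_op F \<alpha> \<beta> K p w =
     - (cscale \<alpha> ((complexify F p ^^ K) w) + cscale \<beta> ((complexify F p ^^ (K - 1)) w))"

text \<open>The real vectors in the image of \<open>l\<close>. (The image is in fact invariant under conjugation,
  hence the complexification of the real distribution so defined.)\<close>

definition D_l :: "('m, 'e::euclidean_space) chart set \<Rightarrow> ('m, 'e) endo_field \<Rightarrow>
     complex \<Rightarrow> complex \<Rightarrow> nat \<Rightarrow> 'm \<Rightarrow> ('m, 'e) tvec set" where
  "D_l A F \<alpha> \<beta> K p = {v \<in> tangent_space A p. (v, 0) \<in> l_op F \<alpha> \<beta> K p ` ctangent_space A p}"

definition partially_integrable ::
    "'d::euclidean_space itself \<Rightarrow> 'm topology \<Rightarrow> ('m, 'e::euclidean_space) chart set \<Rightarrow>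
     ('m, 'e) endo_field \<Rightarrow> complex \<Rightarrow> complex \<Rightarrow> nat \<Rightarrow> bool" where
  "partially_integrable d M A F \<alpha> \<beta> K \<longleftrightarrow>
     integrable_distribution d M A (D_l A F \<alpha> \<beta> K) \<and>
     (\<forall>S (B :: ('m, 'd) chart set). integral_manifold M A (D_l A F \<alpha> \<beta> K) S B \<longrightarrow>
        integrable_tensor S B (induced_tensor A B F))"

end

theory Submission
  imports Defs
begin

text \<open>Since \<open>K \<ge> 3\<close>, the equation gives \<open>F = F G F\<close> with a real polynomial \<open>G\<close> in \<open>F\<close>, so \<open>F\<close> is
  injective on \<open>Im F\<close>, \<open>l = F G\<close> is the real projector onto \<open>Im F\<close>, and \<open>D\<^sub>l = Im F\<close>. The Nijenhuis
  tensor is tensorial, so both conditions say that \<open>N\<^sub>F\<close> vanishes on \<open>Im F\<close> at every point (bump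
  functions extend tangent vectors to global fields). The inclusion of an integral manifold maps
  the Nijenhuis tensor of the induced structure to the restriction of \<open>N\<^sub>F\<close>; this settles
  everything except the integrability of \<open>D\<^sub>l\<close>. Since \<open>N\<^sub>F\<close> vanishes on \<open>Im F\<close>,
  \<open>[F\<^sup>2 X, F\<^sup>2 Y] \<in> Im F\<close>, and \<open>Im F = Im F\<^sup>2\<close> is involutive. Then it has a local frame \<open>B\<close> that projects
  to a constant frame, hence commutes, and the Picard iteration \<open>\<phi>\<^sub>n\<^sub>+\<^sub>1(y) = x\<^sub>0 + \<integral>\<^sub>0\<^sup>1 B(\<phi>\<^sub>n(t y)) y dt\<close>
  converges to a solution of \<open>D\<phi> = B \<circ> \<phi>\<close>, whose image is an integral manifold.\<close>

text \<open>The conditions quantify over global smooth fields, while they are needed at points and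
  on integral manifolds, whose own fields need not extend. This is bridged by a coordinate
  expression \<open>nij\<close> of the Nijenhuis tensor that involves only the values of the two
  fields and the first derivative of the tensor. Although \<open>\<alpha>\<close> and
  \<open>\<beta>\<close> may be complex, \<open>F\<close> is real, so the equation splits into two
  real ones: the real part defines \<open>G\<close>, the imaginary part makes \<open>l\<close> real.
  The frame is normalised by a linear map \<open>Q\<close> that is injective on the nearby images of
  \<open>F\<close>: \<open>Q\<close> composed with \<open>B\<close> is the identity, so
  \<open>Q\<close> annihilates the bracket of two frame fields, which lies in the image of
  \<open>F\<close> and hence is zero. The iteration runs along rays and treats all parameters at
  once. Its limit solves an ordinary differential equation on each ray; commutation is what makes
  its full derivative equal to \<open>B\<close>. The induced tensor is defined pointwise by
  inverting an injective differential, so its differentiability must be established before its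
  Nijenhuis tensor can be computed.\<close>

section \<open>Calculus of C^k and smooth maps on open sets\<close>

lemma frechet_derivative_cong_open:
  assumes "open S" "x \<in> S" "\<And>y. y \<in> S \<Longrightarrow> f y = g y"
  shows "frechet_derivative f (at x) = frechet_derivative g (at x)"
proof -
  have "(f has_derivative D) (at x) \<longleftrightarrow> (g has_derivative D) (at x)" for D
    using has_derivative_transform_within_open[OF _ assms(1,2), of f D UNIV g]
      has_derivative_transform_within_open[OF _ assms(1,2), of g D UNIV f] assms(3) by auto
  then show ?thesis by (simp add: frechet_derivative_def)
qed

lemma differentiable_cong_open:
  assumes "open S" "x \<in> S" "\<And>y. y \<in> S \<Longrightarrow> f y = g y" "f differentiable (at x)"
  shows "g differentiable (at x)"
  using has_derivative_transform_within_open[OF _ assms(1,2), of f _ UNIV g] assms(3,4)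
  unfolding differentiable_def by blast

lemma Ck_on_cong:
  assumes "open S" "\<And>x. x \<in> S \<Longrightarrow> f x = g x" "Ck_on k S f"
  shows "Ck_on k S g"
  using assms(2,3)
proof (induction k arbitrary: f g)
  case 0
  then show ?case using continuous_on_cong[of S S f g] by simp
next
  case (Suc k)
  have "g differentiable (at x)" if "x \<in> S" for x
    using differentiable_cong_open[OF assms(1) that, of f g] Suc.prems that by auto
  moreover have "Ck_on k S (\<lambda>x. frechet_derivative g (at x) v)" for v
    by (rule Suc.IH[of "\<lambda>x. frechet_derivative f (at x) v"])
      (use frechet_derivative_cong_open[OF assms(1), of _ f g] Suc.prems in auto)
  ultimately show ?case by simp
qed

lemma Ck_on_subset: "Ck_on k S f \<Longrightarrow> T \<subseteq> S \<Longrightarrow> Ck_on k T f"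
  by (induction k arbitrary: f) (auto intro: continuous_on_subset)

lemma Ck_on_SucD: "Ck_on (Suc k) S f \<Longrightarrow> Ck_on k S f"
proof (induction k arbitrary: f)
  case 0
  then show ?case
    by (auto intro!: continuous_at_imp_continuous_on differentiable_imp_continuous_within)
qed simp

text \<open>Uniqueness of derivatives lets any explicit formula \<open>f'\<close> stand in for
  \<open>frechet_derivative\<close>, so inductions over the order can work with the product and
  chain rules.\<close>

lemma Ck_on_SucI:
  assumes "open S" "\<And>x. x \<in> S \<Longrightarrow> (f has_derivative f' x) (at x)"
    and "\<And>v. Ck_on k S (\<lambda>x. f' x v)"
  shows "Ck_on (Suc k) S f"
proof -
  have "f' x = frechet_derivative f (at x)" if "x \<in> S" for x
    using frechet_derivative_at assms(2) that by blast
  then have "Ck_on k S (\<lambda>x. frechet_derivative f (at x) v)" for v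
    using Ck_on_cong[OF assms(1) _ assms(3)[of v]] by simp
  then show ?thesis using assms(2) by (auto simp: differentiable_def)
qed

lemma Ck_on_SucE:
  assumes "Ck_on (Suc k) S f"
  shows "x \<in> S \<Longrightarrow> (f has_derivative frechet_derivative f (at x)) (at x)"
    and "Ck_on k S (\<lambda>x. frechet_derivative f (at x) v)"
  using assms by (auto simp: frechet_derivative_works)

lemma Ck_on_const: "open S \<Longrightarrow> Ck_on k S (\<lambda>x. c)"
proof (induction k arbitrary: c)
  case (Suc k)
  show ?case by (rule Ck_on_SucI[OF Suc.prems, where f'="\<lambda>_ _. 0"]) (use Suc in auto)
qed simp

lemma Ck_on_add: "open S \<Longrightarrow> Ck_on k S f \<Longrightarrow> Ck_on k S g \<Longrightarrow> Ck_on k S (\<lambda>x. f x + g x)"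
proof (induction k arbitrary: f g)
  case 0
  then show ?case by (auto intro: continuous_intros)
next
  case (Suc k)
  show ?case
    by (rule Ck_on_SucI[OF Suc.prems(1)
            has_derivative_add[OF Ck_on_SucE(1)[OF Suc.prems(2)] Ck_on_SucE(1)[OF Suc.prems(3)]]])
      (assumption | rule Suc.IH Suc.prems(1) Ck_on_SucE(2)[OF Suc.prems(2)] Ck_on_SucE(2)[OF Suc.prems(3)])+
qed

lemma Ck_on_sum:
  "open S \<Longrightarrow> (\<And>i. i \<in> I \<Longrightarrow> Ck_on k S (f i)) \<Longrightarrow> Ck_on k S (\<lambda>x. \<Sum>i\<in>I. f i x)"
  by (induction I rule: infinite_finite_induct) (auto intro: Ck_on_add Ck_on_const)

lemma (in bounded_linear) Ck_on_linear:
  "open S \<Longrightarrow> Ck_on k S g \<Longrightarrow> Ck_on k S (\<lambda>x. f (g x))"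
proof (induction k arbitrary: g)
  case 0
  then show ?case by (auto intro: continuous_on)
next
  case (Suc k)
  show ?case
    by (rule Ck_on_SucI[OF Suc.prems(1) has_derivative])
      (use Suc.IH[OF Suc.prems(1)] Ck_on_SucE[OF Suc.prems(2)] in auto)
qed

lemma (in bounded_bilinear) Ck_on_bilinear:
  "open S \<Longrightarrow> Ck_on k S f \<Longrightarrow> Ck_on k S g \<Longrightarrow> Ck_on k S (\<lambda>x. prod (f x) (g x))"
proof (induction k arbitrary: f g)
  case 0
  then show ?case by (auto intro: continuous_on)
next
  case (Suc k)
  show ?case
    by (rule Ck_on_SucI[OF Suc.prems(1)
            FDERIV[OF Ck_on_SucE(1)[OF Suc.prems(2)] Ck_on_SucE(1)[OF Suc.prems(3)]]])
      (assumption | rule Ck_on_add Suc.IH Suc.prems(1) Ck_on_SucE(2)[OF Suc.prems(2)]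
        Ck_on_SucE(2)[OF Suc.prems(3)] Ck_on_SucD[OF Suc.prems(2)] Ck_on_SucD[OF Suc.prems(3)])+
qed

lemma linear_sum_Basis:
  fixes L :: "'a::euclidean_space \<Rightarrow> 'b::real_vector"
  assumes "linear L"
  shows "(\<Sum>i\<in>Basis. (v \<bullet> i) *\<^sub>R L i) = L v"
  by (metis (no_types, lifting) assms euclidean_representation linear_scale linear_sum sum.cong)

text \<open>The chain rule applies the derivative of \<open>f\<close> to a vector that moves with
  \<open>x\<close>, whereas the induction hypothesis covers fixed directions. Expanding that vector
  in \<open>Basis\<close> leaves finitely many fixed directions with C^k coefficients.\<close>

lemma Ck_on_compose:
  fixes f :: "'b::euclidean_space \<Rightarrow> 'c::real_normed_vector" and g :: "'a::euclidean_space \<Rightarrow> 'b"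
  assumes "open S"
  shows "Ck_on k T f \<Longrightarrow> Ck_on k S g \<Longrightarrow> g ` S \<subseteq> T \<Longrightarrow> Ck_on k S (\<lambda>x. f (g x))"
proof (induction k arbitrary: f g)
  case 0
  then show ?case by (auto intro: continuous_on_compose2)
next
  case (Suc k)
  let ?f = "\<lambda>x. frechet_derivative f (at (g x))" and ?g = "\<lambda>x. frechet_derivative g (at x)"
  note [simp del] = Ck_on.simps
  have d: "(f has_derivative ?f x) (at (g x))" "(g has_derivative ?g x) (at x)" if "x \<in> S" for x
    using Ck_on_SucE(1)[OF Suc.prems(1), of "g x"] Ck_on_SucE(1)[OF Suc.prems(2) that] that Suc.prems(3)
    by auto
  show ?case
  proof (rule Ck_on_SucI[OF assms(1)])
    show "((\<lambda>x. f (g x)) has_derivative (\<lambda>v. ?f x (?g x v))) (at x)" if "x \<in> S" for x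
      using has_derivative_compose[OF d(2)[OF that] d(1)[OF that]] .
    fix v
    have "Ck_on k S (\<lambda>x. \<Sum>i\<in>Basis. (?g x v \<bullet> i) *\<^sub>R ?f x i)"
    proof (rule Ck_on_sum[OF assms(1)], rule bounded_bilinear.Ck_on_bilinear[OF bounded_bilinear_scaleR assms(1)])
      fix i
      show "Ck_on k S (\<lambda>x. ?g x v \<bullet> i)"
        by (rule bounded_linear.Ck_on_linear[OF bounded_linear_inner_left assms(1) Ck_on_SucE(2)[OF Suc.prems(2)]])
      show "Ck_on k S (\<lambda>x. ?f x i)"
        by (rule Suc.IH[OF Ck_on_SucE(2)[OF Suc.prems(1)] Ck_on_SucD[OF Suc.prems(2)] Suc.prems(3)])
    qed
    then show "Ck_on k S (\<lambda>x. ?f x (?g x v))"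
      by (rule Ck_on_cong[OF assms(1), rotated])
        (use linear_sum_Basis[OF has_derivative_linear[OF d(1)]] in auto)
  qed
qed

text \<open>Differentiability of each order is local on open sets, so different formulas may be used
  on different pieces; a field extended by zero requires this.\<close>

lemma Ck_on_open_cover:
  assumes "\<And>x. x \<in> S \<Longrightarrow> \<exists>U. open U \<and> x \<in> U \<and> Ck_on k U f"
  shows "Ck_on k S f"
  using assms
proof (induction k arbitrary: f)
  case 0
  then show ?case
    by (auto intro!: continuous_at_imp_continuous_on) (metis continuous_on_eq_continuous_at)
next
  case (Suc k)
  have "f differentiable (at x)" if "x \<in> S" for x
    using Suc.prems[OF that] by auto
  moreover have "Ck_on k S (\<lambda>x. frechet_derivative f (at x) v)" for v
    by (rule Suc.IH) (use Suc.prems in fastforce)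
  ultimately show ?case by simp
qed

lemma Ck_on_id: "open S \<Longrightarrow> Ck_on k S (\<lambda>x. x)"
proof (cases k)
  case (Suc n)
  assume "open S"
  then show ?thesis unfolding Suc
    by (intro Ck_on_SucI[where f'="\<lambda>_ v. v"]) (auto intro: Ck_on_const)
qed auto

lemma smooth_on_Ck: "smooth_on S f \<Longrightarrow> Ck_on k S f"
  by (simp add: smooth_on_def)

lemma smooth_on_eq: "open S \<Longrightarrow> (\<And>x. x \<in> S \<Longrightarrow> f x = g x) \<Longrightarrow> smooth_on S f \<Longrightarrow> smooth_on S g"
  unfolding smooth_on_def using Ck_on_cong by blast

lemma smooth_on_compose:
  fixes f :: "'b::euclidean_space \<Rightarrow> 'c::real_normed_vector" and g :: "'a::euclidean_space \<Rightarrow> 'b"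
  assumes "open S" "smooth_on T f" "smooth_on S g" "g ` S \<subseteq> T"
  shows "smooth_on S (\<lambda>x. f (g x))"
  using assms Ck_on_compose unfolding smooth_on_def by blast

lemma smooth_on_bilinear:
  "bounded_bilinear b \<Longrightarrow> open S \<Longrightarrow> smooth_on S f \<Longrightarrow> smooth_on S g \<Longrightarrow> smooth_on S (\<lambda>x. b (f x) (g x))"
  unfolding smooth_on_def using bounded_bilinear.Ck_on_bilinear by blast

lemma smooth_on_linear:
  "bounded_linear L \<Longrightarrow> open S \<Longrightarrow> smooth_on S f \<Longrightarrow> smooth_on S (\<lambda>x. L (f x))"
  unfolding smooth_on_def using bounded_linear.Ck_on_linear by blast

lemma smooth_on_const: "open S \<Longrightarrow> smooth_on S (\<lambda>x. c)"
  unfolding smooth_on_def using Ck_on_const by blast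

lemma smooth_on_id: "open S \<Longrightarrow> smooth_on S (\<lambda>x. x)"
  unfolding smooth_on_def using Ck_on_id by blast

lemma smooth_on_add: "open S \<Longrightarrow> smooth_on S f \<Longrightarrow> smooth_on S g \<Longrightarrow> smooth_on S (\<lambda>x. f x + g x)"
  unfolding smooth_on_def using Ck_on_add by blast

lemma smooth_on_subset: "smooth_on S f \<Longrightarrow> T \<subseteq> S \<Longrightarrow> smooth_on T f"
  unfolding smooth_on_def using Ck_on_subset by blast

lemma smooth_on_open_cover:
  "(\<And>x. x \<in> S \<Longrightarrow> \<exists>U. open U \<and> x \<in> U \<and> smooth_on U f) \<Longrightarrow> smooth_on S f"
  unfolding smooth_on_def by (metis Ck_on_open_cover)

lemma smooth_on_has_derivative:
  "smooth_on S f \<Longrightarrow> x \<in> S \<Longrightarrow> (f has_derivative frechet_derivative f (at x)) (at x)"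
  using Ck_on_SucE(1) smooth_on_Ck by blast

lemma smooth_on_frechet_derivative:
  "smooth_on S f \<Longrightarrow> smooth_on S (\<lambda>x. frechet_derivative f (at x) v)"
  unfolding smooth_on_def using Ck_on_SucE(2) by blast

lemma smooth_on_continuous_on: "smooth_on S f \<Longrightarrow> continuous_on S f"
  using smooth_on_Ck[of S f 0] by simp

subsection \<open>Operator-valued maps\<close>

text \<open>An operator is a finite sum of rank-one operators that depend linearly on its values at
  the basis vectors. Hence smoothness of each value \<open>T x e\<close> becomes smoothness for the
  operator norm.\<close>

lemma Blinfun_eq_sum:
  fixes f :: "'a::euclidean_space \<Rightarrow> 'b::real_normed_vector"
  assumes "linear f"
  shows "Blinfun f = (\<Sum>i\<in>Basis. blinfun_scaleR_left (f i) o\<^sub>L blinfun_inner_left i)"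
proof (rule blinfun_eqI)
  fix v
  have "bounded_linear f" using assms by (simp add: linear_conv_bounded_linear)
  then show "Blinfun f v = (\<Sum>i\<in>Basis. blinfun_scaleR_left (f i) o\<^sub>L blinfun_inner_left i) v"
    using linear_sum_Basis[OF assms, of v]
    by (simp add: bounded_linear_Blinfun_apply blinfun.sum_left blinfun_inner_left.rep_eq inner_commute)
qed

lemma smooth_on_Blinfun:
  fixes T :: "'x::euclidean_space \<Rightarrow> 'a::euclidean_space \<Rightarrow> 'b::real_normed_vector"
  assumes "open S" "\<And>x. x \<in> S \<Longrightarrow> linear (T x)" "\<And>e. smooth_on S (\<lambda>x. T x e)"
  shows "smooth_on S (\<lambda>x. Blinfun (T x))"
proof -
  have bl: "bounded_linear (\<lambda>y::'b. blinfun_scaleR_left y o\<^sub>L blinfun_inner_left (i::'a))" for i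
    by (rule bounded_linear_compose[OF bounded_bilinear.bounded_linear_left[OF bounded_bilinear_blinfun_compose]
          bounded_linear_blinfun_scaleR_left])
  have "Ck_on k S (\<lambda>x. \<Sum>i\<in>Basis. blinfun_scaleR_left (T x i) o\<^sub>L blinfun_inner_left i)" for k
    by (intro Ck_on_sum assms(1) bounded_linear.Ck_on_linear[OF bl] smooth_on_Ck assms(3))
  then show ?thesis
    unfolding smooth_on_def by (intro allI Ck_on_cong[OF assms(1) Blinfun_eq_sum[OF assms(2), symmetric]])
qed

lemma Blinfun_linear_apply:
  fixes f :: "'a::euclidean_space \<Rightarrow> 'b::real_normed_vector"
  shows "linear f \<Longrightarrow> Blinfun f v = f v"
  by (simp add: bounded_linear_Blinfun_apply linear_conv_bounded_linear)

text \<open>Split \<open>\<Phi> y\<close> into \<open>\<Phi> x\<close> and a remainder: the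
  remainder tends to 0 while \<open>g y\<close> is at most linear in \<open>norm (y - x)\<close>, so
  their product is of higher order. Continuity of \<open>\<Phi>\<close> thus suffices, which suits
  an inverse whose differentiability is still unknown.\<close>

lemma has_derivative_bilinear_zero:
  assumes "bounded_bilinear b" "isCont \<Phi> x" and g: "(g has_derivative g') (at x)" and g0: "g x = 0"
  shows "((\<lambda>y. b (\<Phi> y) (g y)) has_derivative (\<lambda>h. b (\<Phi> x) (g' h))) (at x)"
proof -
  interpret bounded_bilinear b by fact
  obtain K where K: "K > 0" "\<And>u v. norm (b u v) \<le> norm u * norm v * K" using pos_bounded by blast
  obtain C where C: "C > 0" "\<And>h. norm (g' h) \<le> norm h * C"
    using bounded_linear.pos_bounded[OF has_derivative_bounded_linear[OF g]] by blast
  have "((\<lambda>y. b (\<Phi> y - \<Phi> x) (g y)) has_derivative (\<lambda>h. 0)) (at x)"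
    unfolding has_derivative_at_alt
  proof (intro conjI allI impI)
    fix e :: real assume e: "e > 0"
    \<comment> \<open>Chosen so that the factor \<open>K\<close> of the bilinear bound and the
      growth constant \<open>C + 1\<close> of \<open>g\<close> multiply back to \<open>e\<close>;
      the summand 1 is the tolerance used for \<open>d1\<close>.\<close>
    define e' where "e' = e / (K * (C + 1))"
    have e': "e' > 0" using e K C by (simp add: e'_def)
    obtain d1 where d1: "d1 > 0" "\<And>y. norm (y - x) < d1 \<Longrightarrow> norm (g y - g x - g' (y - x)) \<le> 1 * norm (y - x)"
      using g unfolding has_derivative_at_alt by (meson zero_less_one)
    obtain d2 where d2: "d2 > 0" "\<And>y. norm (y - x) < d2 \<Longrightarrow> norm (\<Phi> y - \<Phi> x) < e'"
      using assms(2) e' unfolding continuous_at_eps_delta dist_norm by metis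
    have "norm (b (\<Phi> y - \<Phi> x) (g y) - b (\<Phi> x - \<Phi> x) (g x) - 0) \<le> e * norm (y - x)"
      if y: "norm (y - x) < min d1 d2" for y
    proof -
      have "norm (g y) \<le> norm (g y - g x - g' (y - x)) + norm (g' (y - x))"
        using norm_triangle_ineq[of "g y - g x - g' (y - x)" "g' (y - x)"] g0 by simp
      also have "\<dots> \<le> (C + 1) * norm (y - x)"
        using d1(2)[of y] C(2)[of "y - x"] y by (simp add: algebra_simps)
      finally have gy: "norm (g y) \<le> (C + 1) * norm (y - x)" .
      have "norm (b (\<Phi> y - \<Phi> x) (g y)) \<le> norm (\<Phi> y - \<Phi> x) * norm (g y) * K" by (rule K)
      also have "\<dots> \<le> e' * ((C + 1) * norm (y - x)) * K"
        using d2(2)[of y] y gy e' K C by (intro mult_mono mult_nonneg_nonneg) auto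
      also have "\<dots> = e' * (K * (C + 1)) * norm (y - x)" by (simp only: mult_ac)
      also have "\<dots> = e * norm (y - x)" using K C by (simp add: e'_def)
      finally show ?thesis by (simp add: g0 zero_right)
    qed
    then show "\<exists>d>0. \<forall>y. norm (y - x) < d \<longrightarrow>
        norm (b (\<Phi> y - \<Phi> x) (g y) - b (\<Phi> x - \<Phi> x) (g x) - 0) \<le> e * norm (y - x)"
      using d1 d2 by (intro exI[of _ "min d1 d2"]) auto
  qed simp
  from has_derivative_add[OF this bounded_linear.has_derivative[OF bounded_linear_right g, of "\<Phi> x"]]
  show ?thesis by (simp add: diff_left)
qed

text \<open>The resolvent identity \<open>RV\<close> expresses \<open>R y - R x\<close> through
  \<open>V y - V x\<close>. The uniform bound \<open>C\<close> first gives continuity of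
  \<open>R\<close>; the product rule with a vanishing factor then turns the identity into a
  derivative.\<close>

lemma blinfun_inverse_derivative:
  fixes R :: "'x::real_normed_vector \<Rightarrow> 'b::real_normed_vector \<Rightarrow>\<^sub>L 'a::real_normed_vector"
  assumes S: "open S" and inv: "\<And>y. y \<in> S \<Longrightarrow> R y o\<^sub>L V y = id_blinfun"
      "\<And>y. y \<in> S \<Longrightarrow> V y o\<^sub>L R y = id_blinfun"
    and bd: "\<And>y. y \<in> S \<Longrightarrow> norm (R y) \<le> C"
    and x: "x \<in> S" and V: "(V has_derivative V') (at x)"
  shows "(R has_derivative (\<lambda>h. - (R x o\<^sub>L V' h o\<^sub>L R x))) (at x)"
proof -
  have RV: "R y = R x - (R y o\<^sub>L ((V y - V x) o\<^sub>L R x))" if "y \<in> S" for y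
  proof (rule blinfun_eqI)
    fix v
    have "R y (V y (R x v)) = R x v" "V x (R x v) = v"
      using inv[OF that] inv[OF x] by (metis blinfun_apply_blinfun_compose blinfun_apply_id_blinfun)+
    then show "R y v = (R x - (R y o\<^sub>L ((V y - V x) o\<^sub>L R x))) v"
      by (simp add: blinfun.diff_left blinfun.diff_right)
  qed
  have gder: "((\<lambda>y. (V y - V x) o\<^sub>L R x) has_derivative (\<lambda>h. V' h o\<^sub>L R x)) (at x)"
    using bounded_linear.has_derivative[OF bounded_bilinear.bounded_linear_left[OF bounded_bilinear_blinfun_compose]
        has_derivative_diff[OF V has_derivative_const]] by simp
  have cont: "isCont R x"
    unfolding isCont_def
  proof (rule LIM_zero_cancel, rule Lim_null_comparison)
    have C: "C \<ge> 0" using bd[OF x] norm_ge_zero order_trans by blast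
    have "norm (R y - R x) \<le> C * norm ((V y - V x) o\<^sub>L R x)" if "y \<in> S" for y
    proof -
      have "norm (R y - R x) = norm (R y o\<^sub>L ((V y - V x) o\<^sub>L R x))"
        using RV[OF that] by (metis add_diff_cancel_left' diff_add_cancel norm_minus_commute)
      also have "\<dots> \<le> norm (R y) * norm ((V y - V x) o\<^sub>L R x)" by (rule norm_blinfun_compose)
      also have "\<dots> \<le> C * norm ((V y - V x) o\<^sub>L R x)" using bd[OF that] by (intro mult_right_mono) auto
      finally show ?thesis .
    qed
    then show "\<forall>\<^sub>F y in at x. norm (R y - R x) \<le> C * norm ((V y - V x) o\<^sub>L R x)"
      using eventually_at_topological S x by blast
    have "((\<lambda>y. (V y - V x) o\<^sub>L R x) \<longlongrightarrow> 0) (at x)"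
      using has_derivative_continuous[OF gder] by (simp add: continuous_within)
    then show "((\<lambda>y. C * norm ((V y - V x) o\<^sub>L R x)) \<longlongrightarrow> 0) (at x)"
      by (intro tendsto_mult_right_zero tendsto_norm_zero)
  qed
  have "((\<lambda>y. R x - (R y o\<^sub>L ((V y - V x) o\<^sub>L R x))) has_derivative (\<lambda>h. 0 - (R x o\<^sub>L (V' h o\<^sub>L R x)))) (at x)"
    by (intro has_derivative_diff has_derivative_const
        has_derivative_bilinear_zero[OF bounded_bilinear_blinfun_compose cont gder]) simp
  from has_derivative_transform_within_open[OF this S x RV[symmetric]]
  show ?thesis
    by (rule has_derivative_eq_rhs) (auto intro!: blinfun_eqI simp: blinfun.diff_left blinfun.minus_left)
qed

text \<open>Bootstrapping: the derivative \<open>- R V' R\<close> contains no derivative of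
  \<open>R\<close>, so each order of differentiability of \<open>R\<close> yields the next.\<close>

lemma smooth_on_blinfun_inverse:
  fixes R :: "'x::euclidean_space \<Rightarrow> 'b::real_normed_vector \<Rightarrow>\<^sub>L 'a::real_normed_vector"
  assumes S: "open S" and inv: "\<And>y. y \<in> S \<Longrightarrow> R y o\<^sub>L V y = id_blinfun"
      "\<And>y. y \<in> S \<Longrightarrow> V y o\<^sub>L R y = id_blinfun"
    and bd: "\<And>y. y \<in> S \<Longrightarrow> norm (R y) \<le> C"
    and V: "smooth_on S V"
  shows "smooth_on S R"
proof -
  have "Ck_on k S R" for k
  proof (induction k)
    case 0
    show ?case
      using blinfun_inverse_derivative[OF S inv bd _ smooth_on_has_derivative[OF V]]
      by (auto intro!: continuous_at_imp_continuous_on has_derivative_continuous simp: has_derivative_continuous)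
  next
    case (Suc k)
    show ?case
    proof (rule Ck_on_SucI[OF S blinfun_inverse_derivative[OF S inv bd _ smooth_on_has_derivative[OF V]]])
      show "Ck_on k S (\<lambda>x. - (R x o\<^sub>L frechet_derivative V (at x) v o\<^sub>L R x))" for v
        by (intro bounded_linear.Ck_on_linear[OF bounded_linear_minus[OF bounded_linear_ident]] S Suc
          bounded_bilinear.Ck_on_bilinear[OF bounded_bilinear_blinfun_compose]
          smooth_on_Ck[OF smooth_on_frechet_derivative[OF V]])
    qed
  qed
  then show ?thesis by (simp add: smooth_on_def)
qed

subsection \<open>Symmetry of second derivatives\<close>

text \<open>The mean value inequality along \<open>u\<close> is applied to the difference of
  \<open>f\<close> on two parallel segments, with the expected linear term removed. The derivative
  of this function is small by differentiability of \<open>\<lambda>y. f' y u\<close> at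
  \<open>x\<close>.\<close>

lemma second_difference_bound:
  fixes f :: "'a::real_normed_vector \<Rightarrow> 'b::real_normed_vector"
  assumes S: "open S" "x \<in> S" and f: "\<And>y. y \<in> S \<Longrightarrow> (f has_derivative f' y) (at y)"
    and D: "((\<lambda>y. f' y u) has_derivative D) (at x)" and e: "e > 0"
  shows "\<exists>d>0. \<forall>t. 0 < t \<and> t < d \<longrightarrow>
    norm (f (x + t *\<^sub>R u + t *\<^sub>R v) - f (x + t *\<^sub>R u) - f (x + t *\<^sub>R v) + f x - t\<^sup>2 *\<^sub>R D v) \<le> e * t\<^sup>2"
proof -
  \<comment> \<open>\<open>t * N\<close> bounds the displacements from \<open>x\<close> that occur,
    with coefficients of \<open>u\<close> and \<open>v\<close> in \<open>{0..t}\<close>; the summand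
    1 keeps \<open>N\<close> positive. The 2 in \<open>e'\<close> accounts for two linear
    approximations, at \<open>?a\<close> and at \<open>?b\<close>.\<close>
  define N where "N = norm u + norm v + 1"
  have N: "N > 0" by (simp add: N_def add_nonneg_pos)
  define e' where "e' = e / (2 * N)"
  have e': "e' > 0" using e N by (simp add: e'_def)
  obtain r where r: "r > 0" "ball x r \<subseteq> S" using S by (meson openE)
  obtain d1 where d1: "d1 > 0"
      "\<And>y. norm (y - x) < d1 \<Longrightarrow> norm (f' y u - f' x u - D (y - x)) \<le> e' * norm (y - x)"
    using D e' unfolding has_derivative_at_alt by blast
  interpret D: bounded_linear D using D by (rule has_derivative_bounded_linear)
  define d where "d = min r d1 / N"
  have "d > 0" using r d1 N by (simp add: d_def)
  moreover have "norm (f (x + t *\<^sub>R u + t *\<^sub>R v) - f (x + t *\<^sub>R u) - f (x + t *\<^sub>R v) + f x - t\<^sup>2 *\<^sub>R D v) \<le> e * t\<^sup>2"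
    if t: "0 < t" "t < d" for t
  proof -
    have tN: "t * N < min r d1" using t N by (simp add: d_def field_simps)
    have nb: "norm (s *\<^sub>R u + a *\<^sub>R v) \<le> t * N" if "0 \<le> s" "s \<le> t" "0 \<le> a" "a \<le> t" for s a
    proof -
      have "norm (s *\<^sub>R u + a *\<^sub>R v) \<le> s * norm u + a * norm v"
        using norm_triangle_ineq[of "s *\<^sub>R u" "a *\<^sub>R v"] that by simp
      also have "\<dots> \<le> t * norm u + t * norm v" using that by (intro add_mono mult_right_mono) auto
      also have "\<dots> \<le> t * N" using t by (simp add: N_def algebra_simps)
      finally show ?thesis .
    qed
    have inS: "x + s *\<^sub>R u + a *\<^sub>R v \<in> S" if "0 \<le> s" "s \<le> t" "0 \<le> a" "a \<le> t" for s a
    proof -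
      have "norm (s *\<^sub>R u + a *\<^sub>R v) < r" using nb[OF that] tN by simp
      then have "x + (s *\<^sub>R u + a *\<^sub>R v) \<in> ball x r" by (metis add_diff_cancel_left' dist_norm dist_commute mem_ball)
      then show ?thesis using r by (auto simp: add.assoc)
    qed
    define h where "h = (\<lambda>s. f (x + s *\<^sub>R u + t *\<^sub>R v) - f (x + s *\<^sub>R u) - s *\<^sub>R D (t *\<^sub>R v))"
    have "norm (h t - h 0) \<le> (e' * (2 * t * N)) * norm (t - 0)"
    proof (rule differentiable_bound[where S="{0..t}"])
      fix s assume s: "s \<in> {0..t}"
      let ?a = "x + s *\<^sub>R u + t *\<^sub>R v" and ?b = "x + s *\<^sub>R u"
      have ab: "?a \<in> S" "?b \<in> S" using inS[of s t] inS[of s 0] s t by auto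
      let ?h' = "\<lambda>k::real. f' ?a (k *\<^sub>R u) - f' ?b (k *\<^sub>R u) - k *\<^sub>R D (t *\<^sub>R v)"
      have "(h has_derivative ?h') (at s)"
        unfolding h_def
        by (auto intro!: derivative_eq_intros has_derivative_compose[OF _ f, where f="\<lambda>s. x + s *\<^sub>R u + t *\<^sub>R v" for t]
            has_derivative_compose[OF _ f, where f="\<lambda>s. x + s *\<^sub>R u"] ab)
      then show "(h has_derivative ?h') (at s within {0..t})" by (rule has_derivative_at_withinI)
      show "onorm ?h' \<le> e' * (2 * t * N)"
      proof (rule onorm_bound)
        fix k :: real
        have lin: "linear (f' ?a)" "linear (f' ?b)" using f ab has_derivative_linear by blast+
        have "norm (f' ?a u - f' x u - D (?a - x)) \<le> e' * norm (?a - x)"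
          using nb[of s t] s t tN by (intro d1) (auto simp: add.assoc)
        also have "\<dots> \<le> e' * (t * N)"
          using nb[of s t] s t e' by (intro mult_left_mono) (auto simp: add.assoc)
        finally have 1: "norm (f' ?a u - f' x u - D (?a - x)) \<le> e' * (t * N)" .
        have "norm (f' ?b u - f' x u - D (?b - x)) \<le> e' * norm (?b - x)"
          using nb[of s 0] s t tN by (intro d1) auto
        also have "\<dots> \<le> e' * (t * N)"
          using nb[of s 0] s t e' by (intro mult_left_mono) auto
        finally have 2: "norm (f' ?b u - f' x u - D (?b - x)) \<le> e' * (t * N)" .
        have "?h' k = k *\<^sub>R ((f' ?a u - f' x u - D (?a - x)) - (f' ?b u - f' x u - D (?b - x)))"
          unfolding linear_scale[OF lin(1)] linear_scale[OF lin(2)] by (simp add: algebra_simps D.add D.diff)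
        then have "norm (?h' k) = \<bar>k\<bar> * norm ((f' ?a u - f' x u - D (?a - x)) - (f' ?b u - f' x u - D (?b - x)))"
          by simp
        also have "\<dots> \<le> \<bar>k\<bar> * (e' * (t * N) + e' * (t * N))"
          using 1 2 norm_triangle_ineq4[of "f' ?a u - f' x u - D (?a - x)" "f' ?b u - f' x u - D (?b - x)"]
          by (intro mult_left_mono) linarith+
        finally show "norm (?h' k) \<le> e' * (2 * t * N) * norm k" by (simp add: algebra_simps)
      qed (use e' t N in simp)
    qed (use t in auto)
    also have "\<dots> = (e' * (2 * N)) * t\<^sup>2" using t by (simp add: power2_eq_square)
    also have "\<dots> = e * t\<^sup>2" using N by (simp add: e'_def)
    finally have "norm (h t - h 0) \<le> e * t\<^sup>2" .
    moreover have "h t - h 0 = f (x + t *\<^sub>R u + t *\<^sub>R v) - f (x + t *\<^sub>R u) - f (x + t *\<^sub>R v) + f x - t\<^sup>2 *\<^sub>R D v"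
      by (simp add: h_def D.scaleR power2_eq_square)
    ultimately show ?thesis by simp
  qed
  ultimately show ?thesis by blast
qed

text \<open>The second difference is symmetric in \<open>u\<close> and \<open>v\<close>, and it
  agrees with both \<open>t\<^sup>2 *\<^sub>R Du v\<close> and
  \<open>t\<^sup>2 *\<^sub>R Dv u\<close> up to \<open>e/2 * t\<^sup>2\<close> for small
  \<open>t\<close>.\<close>

lemma second_derivative_symmetric:
  fixes f :: "'a::real_normed_vector \<Rightarrow> 'b::real_normed_vector"
  assumes S: "open S" "x \<in> S" and f: "\<And>y. y \<in> S \<Longrightarrow> (f has_derivative f' y) (at y)"
    and Du: "((\<lambda>y. f' y u) has_derivative Du) (at x)"
    and Dv: "((\<lambda>y. f' y v) has_derivative Dv) (at x)"
  shows "Du v = Dv u"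
proof -
  have "norm (Du v - Dv u) \<le> 0 + e" if e: "e > 0" for e
  proof -
    obtain d1 where d1: "d1 > 0" "\<And>t. 0 < t \<and> t < d1 \<Longrightarrow>
        norm (f (x + t *\<^sub>R u + t *\<^sub>R v) - f (x + t *\<^sub>R u) - f (x + t *\<^sub>R v) + f x - t\<^sup>2 *\<^sub>R Du v) \<le> (e/2) * t\<^sup>2"
      using second_difference_bound[OF S f Du, of "e/2" v] e by auto
    obtain d2 where d2: "d2 > 0" "\<And>t. 0 < t \<and> t < d2 \<Longrightarrow>
        norm (f (x + t *\<^sub>R v + t *\<^sub>R u) - f (x + t *\<^sub>R v) - f (x + t *\<^sub>R u) + f x - t\<^sup>2 *\<^sub>R Dv u) \<le> (e/2) * t\<^sup>2"
      using second_difference_bound[OF S f Dv, of "e/2" u] e by auto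
    define t where "t = min d1 d2 / 2"
    have t: "0 < t" "t < d1" "t < d2" using d1 d2 by (auto simp: t_def)
    let ?A = "f (x + t *\<^sub>R u + t *\<^sub>R v) - f (x + t *\<^sub>R u) - f (x + t *\<^sub>R v) + f x"
    have eq: "f (x + t *\<^sub>R v + t *\<^sub>R u) - f (x + t *\<^sub>R v) - f (x + t *\<^sub>R u) + f x = ?A"
      by (simp add: algebra_simps)
    have "norm (?A - t\<^sup>2 *\<^sub>R Dv u) \<le> (e/2) * t\<^sup>2" using d2(2)[of t] t unfolding eq by blast
    moreover have "norm (?A - t\<^sup>2 *\<^sub>R Du v) \<le> (e/2) * t\<^sup>2" using d1(2)[of t] t by simp
    ultimately have "norm ((?A - t\<^sup>2 *\<^sub>R Dv u) - (?A - t\<^sup>2 *\<^sub>R Du v)) \<le> (e/2) * t\<^sup>2 + (e/2) * t\<^sup>2"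
      using norm_triangle_ineq4[of "?A - t\<^sup>2 *\<^sub>R Dv u" "?A - t\<^sup>2 *\<^sub>R Du v"] by linarith
    moreover have "(?A - t\<^sup>2 *\<^sub>R Dv u) - (?A - t\<^sup>2 *\<^sub>R Du v) = t\<^sup>2 *\<^sub>R (Du v - Dv u)"
      by (simp add: algebra_simps)
    ultimately have "norm (t\<^sup>2 *\<^sub>R (Du v - Dv u)) \<le> (e/2) * t\<^sup>2 + (e/2) * t\<^sup>2" by simp
    then have "t\<^sup>2 * norm (Du v - Dv u) \<le> t\<^sup>2 * e" unfolding norm_scaleR by (simp add: mult.commute[of e])
    then show ?thesis using t by simp
  qed
  then have "norm (Du v - Dv u) \<le> 0" by (rule field_le_epsilon)
  then show ?thesis by simp
qed

subsection \<open>Bump functions\<close>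

text \<open>The factor \<open>inverse t ^ n\<close> makes the linear span of the family closed under
  differentiation, so that a single induction gives smoothness of all members.\<close>

definition flat_fun :: "nat \<Rightarrow> real \<Rightarrow> real" where
  "flat_fun n t = (if t > 0 then inverse t ^ n * exp (- inverse t) else 0)"

lemma isCont_flat_fun: "isCont (flat_fun n) t"
proof -
  consider "t < 0" | "t = 0" | "t > 0" by linarith
  then show ?thesis
  proof cases
    case 1
    then have "\<forall>\<^sub>F s in nhds t. flat_fun n s = 0"
      by (intro eventually_mono[OF eventually_nhds_in_open[of "{..<0}"]]) (auto simp: flat_fun_def)
    then show ?thesis by (subst isCont_cong) auto
  next
    case 3
    then have "\<forall>\<^sub>F s in nhds t. flat_fun n s = inverse s ^ n * exp (- inverse s)"
      by (intro eventually_mono[OF eventually_nhds_in_open[of "{0<..}"]]) (auto simp: flat_fun_def)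
    then show ?thesis using 3 by (subst isCont_cong) (auto intro!: continuous_intros)
  next
    case 2
    have "((\<lambda>t. inverse t ^ n * exp (- inverse t)) \<longlongrightarrow> 0) (at_right (0::real))"
    proof -
      have "((\<lambda>s::real. s ^ n / exp s) \<longlongrightarrow> 0) at_top" by (rule tendsto_power_div_exp_0)
      from filterlim_compose[OF this filterlim_inverse_at_top_right]
      show ?thesis by (simp add: exp_minus field_simps)
    qed
    then have "(flat_fun n \<longlongrightarrow> 0) (at_right 0)"
      by (rule Lim_transform_eventually) (auto simp: eventually_at_right_less flat_fun_def intro: eventually_at_rightI[of 0 1])
    moreover have "(flat_fun n \<longlongrightarrow> 0) (at_left 0)"
      by (rule Lim_transform_eventually[OF tendsto_const]) (auto simp: flat_fun_def intro!: eventually_at_leftI[of "-1" 0])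
    ultimately show ?thesis using 2 by (simp add: isCont_def filterlim_at_split flat_fun_def)
  qed
qed

lemma flat_fun_derivative:
  "(flat_fun n has_real_derivative flat_fun (n + 2) t - real n * flat_fun (n + 1) t) (at t)"
proof -
  consider "t < 0" | "t = 0" | "t > 0" by linarith
  then show ?thesis
  proof cases
    case 1
    have "((\<lambda>_. 0) has_real_derivative 0) (at t)" by simp
    then have "(flat_fun n has_real_derivative 0) (at t)"
      by (rule has_field_derivative_transform_within_open[of _ _ _ "{..<0}"]) (use 1 in \<open>auto simp: flat_fun_def\<close>)
    then show ?thesis using 1 by (simp add: flat_fun_def)
  next
    case 3
    have "((\<lambda>t. inverse t ^ n * exp (- inverse t)) has_real_derivative
        flat_fun (n + 2) t - real n * flat_fun (n + 1) t) (at t)"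
    proof -
      have i: "(inverse has_real_derivative - (inverse t)\<^sup>2) (at t)"
        using DERIV_inverse[of t UNIV] 3 by (simp add: numeral_2_eq_2)
      show ?thesis
        by (rule DERIV_cong[OF DERIV_mult[OF DERIV_power[OF i] DERIV_chain2[OF DERIV_exp DERIV_minus[OF i]]]])
          (use 3 in \<open>cases n; simp add: flat_fun_def power2_eq_square algebra_simps\<close>)
    qed
    then show ?thesis
      by (rule has_field_derivative_transform_within_open[of _ _ _ "{0<..}"]) (use 3 in \<open>auto simp: flat_fun_def\<close>)
  next
    case 2
    \<comment> \<open>The difference quotient of \<open>flat_fun n\<close> at 0 is
      \<open>flat_fun (n + 1)\<close>, which is continuous: Caratheodory's criterion.\<close>
    have "(flat_fun n has_real_derivative flat_fun (n + 1) 0) (at 0)"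
    proof (rule CARAT_DERIV[THEN iffD2], intro exI conjI allI)
      show "flat_fun n z - flat_fun n 0 = flat_fun (n + 1) z * (z - 0)" for z
        by (auto simp: flat_fun_def)
    qed (auto intro: isCont_flat_fun)
    then show ?thesis using 2 by (simp add: flat_fun_def)
  qed
qed

lemma smooth_on_flat_fun: "smooth_on UNIV (flat_fun n)"
proof -
  have "Ck_on k UNIV (flat_fun n)" for k
  proof (induction k arbitrary: n)
    case 0
    then show ?case by (auto intro!: continuous_at_imp_continuous_on isCont_flat_fun)
  next
    case (Suc k)
    let ?d = "\<lambda>t. flat_fun (n + 2) t - real n * flat_fun (n + 1) t"
    show ?case
    proof (rule Ck_on_SucI)
      show "(flat_fun n has_derivative (\<lambda>h. h * ?d t)) (at t)" for t
        by (rule has_derivative_eq_rhs[OF flat_fun_derivative[of n t, unfolded has_field_derivative_def]])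
          (simp add: fun_eq_iff mult.commute)
      have "Ck_on k UNIV (\<lambda>t. v * flat_fun (n + 2) t + (- v * real n) * flat_fun (n + 1) t)" for v
        by (intro Ck_on_add bounded_linear.Ck_on_linear[OF bounded_linear_mult_right] Suc open_UNIV)
      then show "Ck_on k UNIV (\<lambda>t. v * ?d t)" for v by (simp add: algebra_simps)
    qed simp
  qed
  then show ?thesis by (simp add: smooth_on_def)
qed

lemma smooth_bump:
  fixes x0 :: "'a::euclidean_space"
  assumes "r > 0"
  obtains \<psi> :: "'a \<Rightarrow> real" where "smooth_on UNIV \<psi>" "\<psi> x0 = 1" "\<And>x. x \<notin> ball x0 r \<Longrightarrow> \<psi> x = 0"
proof
  \<comment> \<open>This is nonpositive outside the ball, where \<open>flat_fun 0\<close> vanishes.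
    It is written with sums and negations to fit the smoothness rules; the factor in
    \<open>?\<psi>\<close> normalises the value at \<open>x0\<close>.\<close>
  let ?g = "\<lambda>x::'a. r\<^sup>2 + - ((x + - x0) \<bullet> (x + - x0))"
  let ?\<psi> = "\<lambda>x. inverse (flat_fun 0 (r\<^sup>2)) * flat_fun 0 (?g x)"
  show "smooth_on UNIV ?\<psi>"
    by (intro smooth_on_linear[OF bounded_linear_mult_right] open_UNIV
        smooth_on_compose[OF _ smooth_on_flat_fun] smooth_on_add smooth_on_const
        smooth_on_linear[OF bounded_linear_minus[OF bounded_linear_ident]]
        smooth_on_bilinear[OF bounded_bilinear_inner] smooth_on_id) simp
  show "?\<psi> x0 = 1" using assms by (simp add: flat_fun_def)
  fix x assume "x \<notin> ball x0 r"
  then have "r \<le> norm (x - x0)" by (simp add: dist_norm norm_minus_commute)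
  then have "r\<^sup>2 \<le> (norm (x - x0))\<^sup>2" using assms by (intro power_mono) auto
  then show "?\<psi> x = 0" by (simp add: flat_fun_def power2_norm_eq_inner)
qed

subsection \<open>The Frobenius theorem for commuting frames\<close>

text \<open>Each \<open>v\<close> selects a field \<open>\<lambda>x. B x v\<close>, and
  \<open>comm\<close> says that any two of these fields have zero bracket. The bound
  \<open>\<delta> * b \<le> R\<close> keeps the iterates in the ball. The value 1/4 is such that the
  two error terms in \<open>picard_error\<close>, each at most \<open>C * \<delta>\<close> times the
  previous error, together halve it.\<close>

locale commuting_frame =
  fixes B :: "'e::euclidean_space \<Rightarrow> 'd::euclidean_space \<Rightarrow>\<^sub>L 'e" and B' :: "'e \<Rightarrow> 'e \<Rightarrow>\<^sub>L 'd \<Rightarrow>\<^sub>L 'e"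
    and x0 :: 'e and R b C \<delta> :: real
  assumes R: "R > 0" and b: "b \<ge> 0" and C: "C \<ge> 0" and \<delta>: "\<delta> > 0" "\<delta> * b \<le> R" "\<delta> * C \<le> 1/4"
    and B_bound: "\<And>x. x \<in> cball x0 R \<Longrightarrow> norm (B x) \<le> b"
    and B'_bound: "\<And>x. x \<in> cball x0 R \<Longrightarrow> norm (B' x) \<le> C"
    and B_deriv: "\<And>x. x \<in> cball x0 R \<Longrightarrow> (B has_derivative B' x) (at x)"
    and B'_cont: "continuous_on (cball x0 R) B'"
    and comm: "\<And>x v w. x \<in> cball x0 R \<Longrightarrow> B' x (B x v) w = B' x (B x w) v"
begin

text \<open>For fixed \<open>y\<close> the limit is the integral curve of
  \<open>\<lambda>x. B x y\<close> starting at \<open>x0\<close>, taken at time 1; at an earlier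
  time \<open>t\<close> that curve is reached from the parameter
  \<open>t *\<^sub>R y\<close>.\<close>

primrec picard :: "nat \<Rightarrow> 'd \<Rightarrow> 'e" where
  "picard 0 y = x0"
| "picard (Suc n) y = x0 + integral {0..1} (\<lambda>t. B (picard n (t *\<^sub>R y)) y)"

text \<open>The derivative of \<open>picard\<close>, obtained under the integral sign.
  \<open>blinfun.prod_left y\<close> is evaluation at \<open>y\<close>; it turns the variation of
  \<open>B\<close> with the base point into an operator, and the factor \<open>t\<close> comes from
  the inner argument \<open>t *\<^sub>R y\<close>.\<close>

primrec picard' :: "nat \<Rightarrow> 'd \<Rightarrow> 'd \<Rightarrow>\<^sub>L 'e" where
  "picard' 0 y = 0"
| "picard' (Suc n) y = integral {0..1} (\<lambda>t. B (picard n (t *\<^sub>R y)) +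
     t *\<^sub>R (blinfun.prod_left y o\<^sub>L B' (picard n (t *\<^sub>R y)) o\<^sub>L picard' n (t *\<^sub>R y)))"

lemma scale_mem: "y \<in> cball 0 \<delta> \<Longrightarrow> t \<in> {0..1} \<Longrightarrow> t *\<^sub>R y \<in> cball 0 \<delta>"
  for y :: "'z::real_normed_vector"
  using mult_left_le_one_le[of "norm y" t] by auto

lemma B_cont: "continuous_on (cball x0 R) B"
  using B_deriv by (meson continuous_at_imp_continuous_on has_derivative_continuous)

lemma B_lipschitz:
  assumes "x \<in> cball x0 R" "z \<in> cball x0 R"
  shows "norm (B x - B z) \<le> C * norm (x - z)"
proof (rule differentiable_bound[OF convex_cball _ _ assms])
  fix y assume y: "y \<in> cball x0 R"
  show "(B has_derivative B' y) (at y within cball x0 R)"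
    by (rule has_derivative_at_withinI[OF B_deriv[OF y]])
  show "onorm (B' y) \<le> C" using B'_bound[OF y] by (simp add: norm_blinfun.rep_eq)
qed

lemma prod_left_apply [simp]: "blinfun.prod_left y A = A y"
  by (simp add: blinfun.prod_left.rep_eq)

text \<open>The claims depend on one another: the values must stay where \<open>B\<close> is
  controlled, and the Leibniz rule for the next iterate needs a derivative jointly continuous in
  \<open>y\<close> and \<open>t\<close>.\<close>

lemma picard_invariant:
  "(\<forall>y\<in>cball 0 \<delta>. picard n y \<in> cball x0 R \<and> (picard n has_derivative picard' n y) (at y within cball 0 \<delta>)) \<and>
    continuous_on (cball 0 \<delta>) (picard' n)"
proof (induction n)
  case 0
  have "picard 0 = (\<lambda>y. x0)" "picard' 0 = (\<lambda>y. 0)" by auto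
  then show ?case using R by auto
next
  case (Suc n)
  let ?W = "cball (0::'d) \<delta>"
  have P: "\<And>y. y \<in> ?W \<Longrightarrow> picard n y \<in> cball x0 R"
    and P': "\<And>y. y \<in> ?W \<Longrightarrow> (picard n has_derivative picard' n y) (at y within ?W)"
    and P'c: "continuous_on ?W (picard' n)"
    using Suc by auto
  have Pc: "continuous_on ?W (picard n)"
    using P' by (meson continuous_on_eq_continuous_within has_derivative_continuous)
  have c1: "continuous_on (?W \<times> {0..1}) (\<lambda>z. picard n (snd z *\<^sub>R fst z))"
    and c2: "continuous_on (?W \<times> {0..1}) (\<lambda>z. picard' n (snd z *\<^sub>R fst z))"
    by (auto intro!: continuous_on_compose2[OF Pc] continuous_on_compose2[OF P'c] continuous_intros
        simp del: mem_cball mem_cball_0 intro!: scale_mem)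
  have c3: "continuous_on (?W \<times> {0..1}) (\<lambda>z. B (picard n (snd z *\<^sub>R fst z)))"
    and c4: "continuous_on (?W \<times> {0..1}) (\<lambda>z. B' (picard n (snd z *\<^sub>R fst z)))"
    by (auto intro!: continuous_on_compose2[OF B_cont c1] continuous_on_compose2[OF B'_cont c1]
        simp del: mem_cball mem_cball_0 intro!: P scale_mem)
  let ?G = "\<lambda>y t. B (picard n (t *\<^sub>R y)) +
     t *\<^sub>R (blinfun.prod_left y o\<^sub>L B' (picard n (t *\<^sub>R y)) o\<^sub>L picard' n (t *\<^sub>R y))"
  have cG: "continuous_on (?W \<times> cbox 0 1) (\<lambda>(y, t). ?G y t)"
    unfolding split_beta cbox_interval by (intro continuous_intros c2 c3 c4)
  have intf: "continuous_on {0..1} (\<lambda>t. B (picard n (t *\<^sub>R y)) y)" if "y \<in> ?W" for y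
  proof -
    have "continuous_on {0..1} (Pair y)" by (intro continuous_on_Pair continuous_on_const continuous_on_id)
    from continuous_on_compose2[OF c3 this] that have "continuous_on {0..1} (\<lambda>t. B (picard n (t *\<^sub>R y)))"
      by (simp add: image_subset_iff)
    then show ?thesis by (intro continuous_intros)
  qed
  have "picard (Suc n) y \<in> cball x0 R" if y: "y \<in> ?W" for y
  proof -
    have "norm (integral {0..1} (\<lambda>t. B (picard n (t *\<^sub>R y)) y)) \<le> (b * \<delta>) * (1 - 0)"
    proof (rule integral_bound[OF _ intf[OF y]])
      fix t :: real assume t: "t \<in> {0..1}"
      have "norm (B (picard n (t *\<^sub>R y)) y) \<le> norm (B (picard n (t *\<^sub>R y))) * norm y" by (rule norm_blinfun)
      also have "\<dots> \<le> b * \<delta>"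
        using B_bound[OF P[OF scale_mem[OF y t]]] y b by (intro mult_mono) auto
      finally show "norm (B (picard n (t *\<^sub>R y)) y) \<le> b * \<delta>" .
    qed simp
    then show ?thesis using \<delta> by (simp add: dist_norm mult.commute)
  qed
  moreover have "(picard (Suc n) has_derivative picard' (Suc n) y) (at y within ?W)" if y: "y \<in> ?W" for y
  proof -
    have "((\<lambda>y. integral (cbox 0 1) (\<lambda>t. B (picard n (t *\<^sub>R y)) y)) has_derivative
        integral (cbox 0 1) (?G y)) (at y within ?W)"
    proof (rule leibniz_rule[OF _ _ cG y])
      fix y :: 'd and t :: real assume y: "y \<in> ?W" and t: "t \<in> cbox 0 1"
      have ty: "t *\<^sub>R y \<in> ?W" using scale_mem y t by simp
      have "((\<lambda>y. t *\<^sub>R y) has_derivative (\<lambda>h. t *\<^sub>R h)) (at y within ?W)"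
        by (auto intro!: derivative_eq_intros)
      moreover have "(picard n has_derivative picard' n (t *\<^sub>R y)) (at (t *\<^sub>R y) within (\<lambda>y. t *\<^sub>R y) ` ?W)"
        by (rule has_derivative_subset[OF P'[OF ty]]) (use scale_mem t in \<open>auto simp del: mem_cball mem_cball_0\<close>)
      ultimately have "((\<lambda>y. picard n (t *\<^sub>R y)) has_derivative (\<lambda>h. picard' n (t *\<^sub>R y) (t *\<^sub>R h))) (at y within ?W)"
        by (rule has_derivative_in_compose)
      from has_derivative_compose[OF this B_deriv[OF P[OF ty]]]
      have "((\<lambda>y. B (picard n (t *\<^sub>R y)) y) has_derivative
          (\<lambda>h. B (picard n (t *\<^sub>R y)) h + B' (picard n (t *\<^sub>R y)) (picard' n (t *\<^sub>R y) (t *\<^sub>R h)) y)) (at y within ?W)"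
        by (rule bounded_bilinear.FDERIV[OF bounded_bilinear_blinfun_apply _ has_derivative_ident])
      then show "((\<lambda>y. B (picard n (t *\<^sub>R y)) y) has_derivative ?G y t) (at y within ?W)"
        by (rule has_derivative_eq_rhs)
          (auto simp: fun_eq_iff blinfun.add_left blinfun.scaleR_left blinfun.scaleR_right)
    next
      fix y assume "y \<in> ?W"
      then show "(\<lambda>t. B (picard n (t *\<^sub>R y)) y) integrable_on cbox 0 1"
        using integrable_continuous_real[OF intf] by (simp add: cbox_interval)
    qed auto
    from has_derivative_add[OF has_derivative_const[of x0] this]
    moreover have "picard (Suc n) = (\<lambda>y. x0 + integral (cbox 0 1) (\<lambda>t. B (picard n (t *\<^sub>R y)) y))"
      by (simp add: fun_eq_iff cbox_interval)
    ultimately show ?thesis by (simp add: cbox_interval)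
  qed
  moreover have "continuous_on ?W (picard' (Suc n))"
    using integral_continuous_on_param[OF cG] by (simp add: cbox_interval)
  ultimately show ?case by blast
qed

lemma picard_mem: "y \<in> cball 0 \<delta> \<Longrightarrow> picard n y \<in> cball x0 R"
  and picard_deriv: "y \<in> cball 0 \<delta> \<Longrightarrow> (picard n has_derivative picard' n y) (at y within cball 0 \<delta>)"
  and picard'_cont: "continuous_on (cball 0 \<delta>) (picard' n)"
  using picard_invariant[of n] by auto

lemma picard_cont: "continuous_on (cball 0 \<delta>) (picard n)"
  using picard_deriv by (meson continuous_on_eq_continuous_within has_derivative_continuous)

lemma picard_ray_cont:
  assumes "y \<in> cball 0 \<delta>"
  shows "continuous_on {0..1} (\<lambda>t. picard n (t *\<^sub>R y))" "continuous_on {0..1} (\<lambda>t. picard' n (t *\<^sub>R y))"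
    "continuous_on {0..1} (\<lambda>t. B (picard n (t *\<^sub>R y)))" "continuous_on {0..1} (\<lambda>t. B' (picard n (t *\<^sub>R y)))"
proof -
  show 1: "continuous_on {0..1} (\<lambda>t. picard n (t *\<^sub>R y))"
    by (rule continuous_on_compose2[OF picard_cont]) (use scale_mem[OF assms] in \<open>auto simp del: mem_cball mem_cball_0 intro!: continuous_intros\<close>)
  show "continuous_on {0..1} (\<lambda>t. picard' n (t *\<^sub>R y))"
    by (rule continuous_on_compose2[OF picard'_cont]) (use scale_mem[OF assms] in \<open>auto simp del: mem_cball mem_cball_0 intro!: continuous_intros\<close>)
  show "continuous_on {0..1} (\<lambda>t. B (picard n (t *\<^sub>R y)))"
    by (rule continuous_on_compose2[OF B_cont 1]) (use scale_mem assms picard_mem in blast)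
  show "continuous_on {0..1} (\<lambda>t. B' (picard n (t *\<^sub>R y)))"
    by (rule continuous_on_compose2[OF B'_cont 1]) (use scale_mem assms picard_mem in blast)
qed

text \<open>Contraction: each step gains the factor \<open>C * \<delta> \<le> 1/4\<close>, weakened
  here to 1/2. The start value \<open>R\<close> holds because the first iterate stays in the ball
  around \<open>x0\<close>.\<close>

lemma picard_step: "y \<in> cball 0 \<delta> \<Longrightarrow> norm (picard (Suc n) y - picard n y) \<le> R * (1/2) ^ n"
proof (induction n arbitrary: y)
  case 0
  then show ?case using picard_mem[of y 1] by (simp add: dist_norm norm_minus_commute)
next
  case (Suc n)
  let ?f = "\<lambda>n t. B (picard n (t *\<^sub>R y)) y"
  have c: "continuous_on {0..1} (?f n)" for n
    by (intro continuous_intros picard_ray_cont Suc.prems)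
  have "picard (Suc (Suc n)) y - picard (Suc n) y = integral {0..1} (?f (Suc n)) - integral {0..1} (?f n)"
    by (simp del: picard.simps(2) add: picard.simps(2)[of "Suc n"] picard.simps(2)[of n])
  also have "\<dots> = integral {0..1} (\<lambda>t. ?f (Suc n) t - ?f n t)"
    using c by (intro integral_diff[symmetric] integrable_continuous_real)
  also have "norm \<dots> \<le> (R * (1/2) ^ Suc n) * (1 - 0)"
  proof (rule integral_bound)
    fix t :: real assume t: "t \<in> {0..1}"
    note ty = scale_mem[OF Suc.prems t]
    have "norm (?f (Suc n) t - ?f n t) \<le> norm (B (picard (Suc n) (t *\<^sub>R y)) - B (picard n (t *\<^sub>R y))) * norm y"
      by (metis blinfun.diff_left norm_blinfun)
    also have "\<dots> \<le> (C * norm (picard (Suc n) (t *\<^sub>R y) - picard n (t *\<^sub>R y))) * norm y"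
      by (intro mult_right_mono B_lipschitz picard_mem ty) auto
    also have "\<dots> \<le> (C * (R * (1/2) ^ n)) * \<delta>"
      using Suc.IH[OF ty] C R Suc.prems by (intro mult_mono mult_left_mono) auto
    also have "\<dots> = (\<delta> * C) * (R * (1/2) ^ n)" by simp
    also have "\<dots> \<le> (1/4) * (R * (1/2) ^ n)" using \<delta> R by (intro mult_right_mono) auto
    also have "\<dots> \<le> R * (1/2) ^ Suc n" using R by simp
    finally show "norm (?f (Suc n) t - ?f n t) \<le> R * (1/2) ^ Suc n" .
  qed (auto intro!: continuous_intros c simp del: picard.simps)
  finally show ?case by simp
qed

text \<open>The fundamental theorem for
  \<open>\<lambda>t. t *\<^sub>R B (picard n (t *\<^sub>R y))\<close>. It writes
  \<open>B (picard n y)\<close> as an integral that can be compared with the one defining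
  \<open>picard' (Suc n) y\<close>.\<close>

lemma picard_frame_integral:
  assumes y: "y \<in> cball 0 \<delta>"
  shows "((\<lambda>t. B (picard n (t *\<^sub>R y)) + t *\<^sub>R B' (picard n (t *\<^sub>R y)) (picard' n (t *\<^sub>R y) y))
    has_integral B (picard n y)) {0..1}"
proof -
  have "((\<lambda>t. t *\<^sub>R B (picard n (t *\<^sub>R y))) has_vector_derivative
      B (picard n (t *\<^sub>R y)) + t *\<^sub>R B' (picard n (t *\<^sub>R y)) (picard' n (t *\<^sub>R y) y)) (at t within {0..1})"
    if t: "t \<in> {0..1}" for t
  proof -
    note ty = scale_mem[OF y t]
    have "((\<lambda>t. t *\<^sub>R y) has_derivative (\<lambda>h. h *\<^sub>R y)) (at t within {0..1})"
      by (auto intro!: derivative_eq_intros)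
    moreover have "(picard n has_derivative picard' n (t *\<^sub>R y)) (at (t *\<^sub>R y) within (\<lambda>t. t *\<^sub>R y) ` {0..1})"
      by (rule has_derivative_subset[OF picard_deriv[OF ty]]) (use scale_mem[OF y] in \<open>auto simp del: mem_cball mem_cball_0\<close>)
    ultimately have "((\<lambda>t. picard n (t *\<^sub>R y)) has_derivative (\<lambda>h. picard' n (t *\<^sub>R y) (h *\<^sub>R y))) (at t within {0..1})"
      by (rule has_derivative_in_compose)
    from has_derivative_compose[OF this B_deriv[OF picard_mem[OF ty]]]
    have "((\<lambda>t. t *\<^sub>R B (picard n (t *\<^sub>R y))) has_derivative
        (\<lambda>h. t *\<^sub>R B' (picard n (t *\<^sub>R y)) (picard' n (t *\<^sub>R y) (h *\<^sub>R y)) + h *\<^sub>R B (picard n (t *\<^sub>R y))))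
        (at t within {0..1})"
      by (rule has_derivative_scaleR[OF has_derivative_ident])
    then show ?thesis
      unfolding has_vector_derivative_def
      by (rule has_derivative_eq_rhs) (auto simp: fun_eq_iff blinfun.scaleR_right algebra_simps)
  qed
  from fundamental_theorem_of_calculus[OF _ this] show ?thesis by simp
qed

text \<open>Commutation of the frame makes the two integrands below agree up to the derivative error of
  the previous step; this is where integrability enters.\<close>

lemma picard_error:
  "y \<in> cball 0 \<delta> \<Longrightarrow> norm (picard' n y - B (picard n y)) \<le> (b + 2 * C * R * real n) * (1/2) ^ n"
proof (induction n arbitrary: y)
  case 0
  then show ?case using B_bound[of x0] R by simp
next
  case (Suc n)
  note y = Suc.prems
  \<comment> \<open>The solution, with start value \<open>b\<close>, of the recursion in which the
    integral halves the error and the move from \<open>picard n y\<close> to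
    \<open>picard (Suc n) y\<close> adds \<open>C * R * (1/2) ^ n\<close>.\<close>
  define \<epsilon> where "\<epsilon> = (b + 2 * C * R * real n) * (1/2) ^ n"
  have \<epsilon>: "\<epsilon> \<ge> 0" using b C R by (simp add: \<epsilon>_def)
  let ?p = "\<lambda>t. picard n (t *\<^sub>R y)" and ?p' = "\<lambda>t. picard' n (t *\<^sub>R y)"
  let ?G = "\<lambda>t. B (?p t) + t *\<^sub>R (blinfun.prod_left y o\<^sub>L B' (?p t) o\<^sub>L ?p' t)"
  let ?H = "\<lambda>t. B (?p t) + t *\<^sub>R B' (?p t) (?p' t y)"
  have cG: "continuous_on {0..1} ?G" by (intro continuous_intros picard_ray_cont y)
  have cH: "continuous_on {0..1} ?H" by (intro continuous_intros picard_ray_cont y)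
  have "picard' (Suc n) y - B (picard n y) = integral {0..1} ?G - integral {0..1} ?H"
    using picard_frame_integral[OF y, of n] by (simp add: integral_unique)
  also have "\<dots> = integral {0..1} (\<lambda>t. ?G t - ?H t)"
    using cG cH by (intro integral_diff[symmetric] integrable_continuous_real)
  also have "norm \<dots> \<le> (\<epsilon> / 2) * (1 - 0)"
  proof (rule integral_bound)
    fix t :: real assume t: "t \<in> {0..1}"
    note ty = scale_mem[OF y t]
    let ?E = "?p' t - B (?p t)"
    have E: "norm ?E \<le> \<epsilon>" using Suc.IH[OF ty] by (simp add: \<epsilon>_def)
    have D: "norm (B' (?p t) (?E u) v) \<le> C * \<epsilon> * (norm u * norm v)" for u v
    proof -
      have "norm (B' (?p t) (?E u) v) \<le> (norm (B' (?p t)) * (norm ?E * norm u)) * norm v"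
        by (intro order_trans[OF norm_blinfun] mult_right_mono mult_left_mono norm_blinfun norm_ge_zero)
      also have "\<dots> \<le> (C * (\<epsilon> * norm u)) * norm v"
        using B'_bound[OF picard_mem[OF ty]] E C \<epsilon> by (intro mult_mono) auto
      finally show ?thesis by (simp add: mult_ac)
    qed
    show "norm (?G t - ?H t) \<le> \<epsilon> / 2"
    proof (rule norm_blinfun_bound)
      fix w
      have "(?G t - ?H t) w = t *\<^sub>R (B' (?p t) (?E w) y - B' (?p t) (?E y) w)"
        using comm[OF picard_mem[OF ty], of n w y]
        by (simp add: blinfun.diff_left blinfun.diff_right blinfun.add_left blinfun.scaleR_left algebra_simps)
      then have "norm ((?G t - ?H t) w) = \<bar>t\<bar> * norm (B' (?p t) (?E w) y - B' (?p t) (?E y) w)" by simp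
      also have "\<dots> \<le> 1 * (C * \<epsilon> * (norm w * norm y) + C * \<epsilon> * (norm y * norm w))"
        using t order_trans[OF norm_triangle_ineq4 add_mono[OF D[of w y] D[of y w]]]
        by (intro mult_mono) auto
      also have "\<dots> = 2 * C * norm y * \<epsilon> * norm w" by simp
      also have "\<dots> \<le> (1/2) * \<epsilon> * norm w"
      proof -
        have "C * norm y \<le> C * \<delta>" using y C by (intro mult_left_mono) auto
        then have "2 * C * norm y \<le> 1/2" using \<delta> by (simp add: mult.commute)
        then show ?thesis using \<epsilon> by (intro mult_right_mono) auto
      qed
      finally show "norm ((?G t - ?H t) w) \<le> \<epsilon> / 2 * norm w" by simp
    qed (use \<epsilon> in simp)
  qed (simp, rule continuous_on_diff[OF cG cH])
  finally have 1: "norm (picard' (Suc n) y - B (picard n y)) \<le> \<epsilon> / 2" by simp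
  have 2: "norm (B (picard (Suc n) y) - B (picard n y)) \<le> C * (R * (1/2) ^ n)"
    by (intro order_trans[OF B_lipschitz] picard_mem y mult_left_mono picard_step C)
  have "norm (picard' (Suc n) y - B (picard (Suc n) y)) \<le> \<epsilon> / 2 + C * (R * (1/2) ^ n)"
    using norm_triangle_ineq4[of "picard' (Suc n) y - B (picard n y)" "B (picard (Suc n) y) - B (picard n y)"] 1 2
    by simp
  also have "\<dots> = (b + 2 * C * R * real (Suc n)) * (1/2) ^ Suc n"
    by (simp add: \<epsilon>_def algebra_simps)
  finally show ?case .
qed

text \<open>Geometric series over \<open>picard_step\<close>; the exact partial sum is kept as the
  bound so that the induction closes.\<close>

lemma picard_tail:
  assumes "y \<in> cball 0 \<delta>"
  shows "norm (picard (n + k) y - picard n y) \<le> 2 * R * (1/2) ^ n * (1 - (1/2) ^ k)"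
proof (induction k)
  case (Suc k)
  have "norm (picard (n + Suc k) y - picard n y) \<le>
      norm (picard (Suc (n + k)) y - picard (n + k) y) + norm (picard (n + k) y - picard n y)"
    using norm_triangle_ineq[of "picard (Suc (n + k)) y - picard (n + k) y" "picard (n + k) y - picard n y"]
    by (simp del: picard.simps)
  also have "\<dots> \<le> R * (1/2) ^ (n + k) + 2 * R * (1/2) ^ n * (1 - (1/2) ^ k)"
    by (intro add_mono picard_step assms Suc)
  also have "\<dots> = 2 * R * (1/2) ^ n * (1 - (1/2) ^ Suc k)" by (simp add: power_add algebra_simps)
  finally show ?case .
qed simp

text \<open>Two uniform estimates combine: \<open>picard_error\<close> compares the derivative of an
  iterate with \<open>B\<close> at that iterate, and the Lipschitz bound with \<open>ptail\<close>
  compares the latter with \<open>B\<close> at the limit. So the derivatives converge uniformly, and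
  limit and derivative may be exchanged.\<close>

lemma picard_limit:
  obtains \<phi> where "\<phi> 0 = x0" "\<And>y. y \<in> cball 0 \<delta> \<Longrightarrow> \<phi> y \<in> cball x0 R"
    "\<And>y. y \<in> cball 0 \<delta> \<Longrightarrow> (\<phi> has_derivative B (\<phi> y)) (at y within cball 0 \<delta>)"
proof -
  let ?W = "cball (0::'d) \<delta>"
  have tail: "norm (picard m y - picard n y) \<le> 2 * R * (1/2) ^ n" if "y \<in> ?W" "n \<le> m" for y m n
  proof -
    have "norm (picard m y - picard n y) \<le> 2 * R * (1/2) ^ n * (1 - (1/2) ^ (m - n))"
      using picard_tail[OF that(1), of n "m - n"] that(2) by simp
    also have "\<dots> \<le> 2 * R * (1/2) ^ n * 1" using R by (intro mult_left_mono) auto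
    finally show ?thesis by simp
  qed
  have pow0: "(\<lambda>n. 2 * R * (1/2) ^ n) \<longlonglongrightarrow> 0"
    by (intro tendsto_mult_right_zero LIMSEQ_power_zero) simp
  have "Cauchy (\<lambda>n. picard n y)" if y: "y \<in> ?W" for y
  proof (rule CauchyI)
    fix e :: real assume "e > 0"
    then have "\<forall>\<^sub>F n in sequentially. 2 * R * (1/2) ^ n < e/2"
      using order_tendstoD(2)[OF pow0, of "e/2"] by simp
    then obtain N where N: "2 * R * (1/2) ^ N < e/2" by (auto simp: eventually_sequentially)
    have "norm (picard m y - picard n y) < e" if "m \<ge> N" "n \<ge> N" for m n
      using norm_triangle_ineq4[of "picard m y - picard N y" "picard n y - picard N y"]
        tail[OF y that(1)] tail[OF y that(2)] N by simp
    then show "\<exists>N. \<forall>m\<ge>N. \<forall>n\<ge>N. norm (picard m y - picard n y) < e" by blast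
  qed
  then have conv: "(\<lambda>n. picard n y) \<longlonglongrightarrow> lim (\<lambda>n. picard n y)" if "y \<in> ?W" for y
    using that Cauchy_convergent_iff convergent_LIMSEQ_iff by blast
  define p where "p y = lim (\<lambda>n. picard n y)" for y
  have ptail: "norm (p y - picard n y) \<le> 2 * R * (1/2) ^ n" if "y \<in> ?W" for y n
  proof (rule Lim_bounded)
    show "(\<lambda>m. norm (picard m y - picard n y)) \<longlonglongrightarrow> norm (p y - picard n y)"
      unfolding p_def by (intro tendsto_intros conv that)
  qed (use tail that in blast)
  have pmem: "p y \<in> cball x0 R" if "y \<in> ?W" for y
    by (rule Lim_in_closed_set[OF closed_cball _ _ conv[OF that, folded p_def]])
      (use picard_mem[OF that] in auto)
  have "\<exists>g. \<forall>y\<in>?W. (\<lambda>n. picard n y) \<longlonglongrightarrow> g y \<and> (g has_derivative B (p y)) (at y within ?W)"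
  proof (rule has_derivative_sequence[OF convex_cball picard_deriv])
    show "0 \<in> ?W" using \<delta> by simp
    then show "(\<lambda>n. picard n 0) \<longlonglongrightarrow> p 0" using conv[folded p_def] by blast
    fix e :: real assume e: "e > 0"
    have "(\<lambda>n. (b + 2 * C * R * real n) * (1/2) ^ n + C * (2 * R * (1/2) ^ n)) \<longlonglongrightarrow> 0"
    proof -
      have "(\<lambda>n. real n * (1/2) ^ n) \<longlonglongrightarrow> 0" using powser_times_n_limit_0[of "1/2::real"] by simp
      then have "(\<lambda>n. b * (1/2) ^ n + (2 * C * R) * (real n * (1/2) ^ n) + C * (2 * R * (1/2) ^ n)) \<longlonglongrightarrow> 0 + 0 + 0"
        by (intro tendsto_add tendsto_mult_right_zero LIMSEQ_power_zero) auto
      then show ?thesis by (simp add: algebra_simps)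
    qed
    then have "\<forall>\<^sub>F n in sequentially. (b + 2 * C * R * real n) * (1/2) ^ n + C * (2 * R * (1/2) ^ n) < e"
      using order_tendstoD(2) e by blast
    then show "\<forall>\<^sub>F n in sequentially. \<forall>y\<in>?W. \<forall>h. norm (picard' n y h - B (p y) h) \<le> e * norm h"
    proof eventually_elim
      case (elim n)
      show ?case
      proof (intro ballI allI)
        fix y h assume y: "y \<in> ?W"
        have "norm (B (picard n y) - B (p y)) \<le> C * (2 * R * (1/2) ^ n)"
          using ptail[OF y, of n] B_lipschitz[OF picard_mem[OF y, of n] pmem[OF y]] C
          by (smt (verit) mult_left_mono norm_minus_commute)
        then have "norm (picard' n y - B (p y)) \<le> e"
          using picard_error[OF y, of n] elim
            norm_triangle_ineq[of "picard' n y - B (picard n y)" "B (picard n y) - B (p y)"] by simp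
        then show "norm (picard' n y h - B (p y) h) \<le> e * norm h"
          unfolding blinfun.diff_left[symmetric]
          by (intro order_trans[OF norm_blinfun] mult_right_mono norm_ge_zero)
      qed
    qed
  qed
  then obtain g where g: "\<And>y. y \<in> ?W \<Longrightarrow> (\<lambda>n. picard n y) \<longlonglongrightarrow> g y"
      "\<And>y. y \<in> ?W \<Longrightarrow> (g has_derivative B (p y)) (at y within ?W)" by blast
  \<comment> \<open>\<open>has_derivative_sequence\<close> supplies some limit function
    \<open>g\<close>, which has to be identified with the function \<open>p\<close> at which
    \<open>B\<close> is evaluated.\<close>
  have gp: "g y = p y" if "y \<in> ?W" for y
    using LIMSEQ_unique[OF g(1)[OF that] conv[OF that]] by (simp add: p_def)
  have "picard n 0 = x0" for n by (cases n) (auto simp: blinfun.zero_right)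
  then have "g 0 = x0" using g(1)[of 0] \<delta> by (simp add: LIMSEQ_const_iff)
  then show thesis using that[of g] g(2) gp pmem by auto
qed

end

text \<open>Compactness of a closed ball inside \<open>U\<close> supplies the bounds for the
  iteration, and \<open>\<delta>\<close> is fitted to them. Smoothness is a bootstrap: if
  \<open>\<phi>\<close> is C^k, then so is its derivative \<open>B \<circ> \<phi>\<close>.\<close>

lemma frobenius_commuting:
  fixes B :: "'e::euclidean_space \<Rightarrow> 'd::euclidean_space \<Rightarrow>\<^sub>L 'e"
  assumes U: "open U" "x0 \<in> U" and B: "smooth_on U B"
    and comm: "\<And>x v w. x \<in> U \<Longrightarrow>
      frechet_derivative B (at x) (B x v) w = frechet_derivative B (at x) (B x w) v"
  obtains r \<phi> where "r > 0" "smooth_on (ball 0 r) \<phi>" "\<phi> 0 = x0" "\<phi> ` ball 0 r \<subseteq> U"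
    "\<And>y. y \<in> ball 0 r \<Longrightarrow> (\<phi> has_derivative B (\<phi> y)) (at y)"
proof -
  define B' where "B' x = Blinfun (frechet_derivative B (at x))" for x
  have lin: "linear (frechet_derivative B (at x))" if "x \<in> U" for x
    using smooth_on_has_derivative[OF B that] has_derivative_linear by blast
  have B'_eq: "B' x v = frechet_derivative B (at x) v" if "x \<in> U" for x v
    unfolding B'_def by (rule Blinfun_linear_apply[OF lin[OF that]])
  have B'_smooth: "smooth_on U B'"
    unfolding B'_def by (rule smooth_on_Blinfun[OF U(1) lin smooth_on_frechet_derivative[OF B]])
  obtain R where Rb: "R > 0" "cball x0 R \<subseteq> U" using U open_contains_cball by blast
  have bdd: "\<exists>c>0. \<forall>x\<in>cball x0 R. norm (f x) \<le> c" if "smooth_on U f" for f :: "'e \<Rightarrow> 'z::real_normed_vector"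
  proof -
    have "compact (f ` cball x0 R)"
      by (intro compact_continuous_image continuous_on_subset[OF smooth_on_continuous_on[OF that] Rb(2)]) simp
    then show ?thesis using compact_imp_bounded bounded_pos by (metis imageI)
  qed
  obtain b where b: "b > 0" "\<And>x. x \<in> cball x0 R \<Longrightarrow> norm (B x) \<le> b" using bdd[OF B] by blast
  obtain C where C: "C > 0" "\<And>x. x \<in> cball x0 R \<Longrightarrow> norm (B' x) \<le> C" using bdd[OF B'_smooth] by blast
  define \<delta> where "\<delta> = min (R / b) (1 / (4 * C))"
  have \<delta>: "\<delta> > 0" "\<delta> * b \<le> R" "\<delta> * C \<le> 1/4"
    using Rb b C by (auto simp: \<delta>_def min_def field_simps)
  interpret commuting_frame B B' x0 R b C \<delta>
  proof
    show "(B has_derivative B' x) (at x)" if "x \<in> cball x0 R" for x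
    proof -
      have "x \<in> U" using that Rb(2) by blast
      then show ?thesis
        using smooth_on_has_derivative[OF B] B'_eq by (metis (no_types, lifting) ext)
    qed
    show "continuous_on (cball x0 R) B'"
      using smooth_on_continuous_on[OF B'_smooth] Rb(2) continuous_on_subset by blast
    show "B' x (B x v) w = B' x (B x w) v" if "x \<in> cball x0 R" for x v w
      using comm[of x v w] that Rb(2) by (auto simp: B'_eq)
  qed (use Rb b C \<delta> in auto)
  obtain \<phi> where \<phi>: "\<phi> 0 = x0" "\<And>y. y \<in> cball 0 \<delta> \<Longrightarrow> \<phi> y \<in> cball x0 R"
      "\<And>y. y \<in> cball 0 \<delta> \<Longrightarrow> (\<phi> has_derivative B (\<phi> y)) (at y within cball 0 \<delta>)"
    using picard_limit by metis
  have der: "(\<phi> has_derivative B (\<phi> y)) (at y)" if "y \<in> ball 0 \<delta>" for y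
    using has_derivative_subset[OF \<phi>(3) ball_subset_cball, of y] that at_within_open[OF that open_ball] by simp
  have img: "\<phi> ` ball 0 \<delta> \<subseteq> U" using \<phi>(2) Rb(2) ball_subset_cball by blast
  have "Ck_on k (ball 0 \<delta>) \<phi>" for k
  proof (induction k)
    case 0
    show ?case
      unfolding Ck_on.simps
      by (intro continuous_at_imp_continuous_on ballI) (rule has_derivative_continuous[OF der])
  next
    case (Suc k)
    show ?case
    proof (rule Ck_on_SucI[OF open_ball der])
      show "Ck_on k (ball 0 \<delta>) (\<lambda>y. B (\<phi> y) v)" for v
        by (intro bounded_linear.Ck_on_linear[OF blinfun.bounded_linear_left] open_ball
            Ck_on_compose[OF _ smooth_on_Ck[OF B] Suc img])
    qed
  qed
  then have "smooth_on (ball 0 \<delta>) \<phi>" by (simp add: smooth_on_def)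
  then show thesis using that[OF \<delta>(1) _ \<phi>(1) img der] by blast
qed

subsection \<open>The Nijenhuis tensor in coordinates\<close>

text \<open>The coordinate expression of the Nijenhuis tensor after all derivatives of the two
  vector fields have cancelled, so that only their values \<open>u\<close> and \<open>v\<close> at
  the point remain.\<close>

definition nij :: "('e::euclidean_space \<Rightarrow> 'e \<Rightarrow>\<^sub>L 'e) \<Rightarrow> 'e \<Rightarrow> 'e \<Rightarrow> 'e \<Rightarrow> 'e" where
  "nij T x u v = (let D = frechet_derivative T (at x) in
     D (T x u) v - D (T x v) u - T x (D u v) + T x (D v u))"

text \<open>By the product rule \<open>TX' h = T x (X' h) + D h (X x)\<close>, and likewise for
  \<open>Y\<close>; all terms with \<open>X'\<close> or \<open>Y'\<close> then cancel. This
  cancellation is the tensoriality of the Nijenhuis tensor.\<close>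

lemma nij_brackets:
  fixes T :: "'e::euclidean_space \<Rightarrow> 'e \<Rightarrow>\<^sub>L 'e"
  assumes T: "(T has_derivative D) (at x)"
    and X: "(X has_derivative X') (at x)" and Y: "(Y has_derivative Y') (at x)"
    and TX: "((\<lambda>y. T y (X y)) has_derivative TX') (at x)"
    and TY: "((\<lambda>y. T y (Y y)) has_derivative TY') (at x)"
  shows "nij T x (X x) (Y x) = (TY' (T x (X x)) - TX' (T x (Y x)))
    - T x (Y' (T x (X x)) - TX' (Y x)) - T x (TY' (X x) - X' (T x (Y x)))
    + T x (T x (Y' (X x) - X' (Y x)))"
proof -
  have "TX' = (\<lambda>h. T x (X' h) + D h (X x))" "TY' = (\<lambda>h. T x (Y' h) + D h (Y x))"
    using has_derivative_unique[OF TX bounded_bilinear.FDERIV[OF bounded_bilinear_blinfun_apply T X]]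
      has_derivative_unique[OF TY bounded_bilinear.FDERIV[OF bounded_bilinear_blinfun_apply T Y]] by auto
  moreover have "frechet_derivative T (at x) = D" using frechet_derivative_at[OF T] by simp
  ultimately show ?thesis
    by (simp add: nij_def Let_def blinfun.add_right blinfun.diff_right)
qed

section \<open>Naturality of brackets and Nijenhuis tensors under smooth maps\<close>

definition jac :: "('a::euclidean_space \<Rightarrow> 'b::euclidean_space) \<Rightarrow> 'a \<Rightarrow> 'a \<Rightarrow>\<^sub>L 'b" where
  "jac f x = Blinfun (frechet_derivative f (at x))"

lemma jac_has_derivative:
  assumes "smooth_on S f" "x \<in> S"
  shows "(f has_derivative jac f x) (at x)" "blinfun_apply (jac f x) = frechet_derivative f (at x)"
proof -
  have f: "(f has_derivative frechet_derivative f (at x)) (at x)"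
    by (rule smooth_on_has_derivative[OF assms])
  then show "blinfun_apply (jac f x) = frechet_derivative f (at x)"
    unfolding jac_def by (intro bounded_linear_Blinfun_apply has_derivative_bounded_linear)
  with f show "(f has_derivative jac f x) (at x)" by simp
qed

lemma smooth_on_jac: "open S \<Longrightarrow> smooth_on S f \<Longrightarrow> smooth_on S (jac f)"
  unfolding jac_def
  by (rule smooth_on_Blinfun)
    (auto intro: smooth_on_frechet_derivative has_derivative_linear smooth_on_has_derivative)

lemma jac_symmetric:
  fixes f :: "'d::euclidean_space \<Rightarrow> 'e::euclidean_space"
  assumes S: "open S" "x \<in> S" and f: "smooth_on S f" and D: "(jac f has_derivative D) (at x)"
  shows "D u v = D v u"
proof -
  have "((\<lambda>y. jac f y w) has_derivative (\<lambda>h. D h w)) (at x)" for w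
    by (rule bounded_linear.has_derivative[OF blinfun.bounded_linear_left D])
  from second_derivative_symmetric[OF S jac_has_derivative(1)[OF f] this this] show ?thesis by blast
qed

lemma related_fields_derivative:
  fixes f :: "'d::euclidean_space \<Rightarrow> 'e::euclidean_space"
  assumes S: "open S" "x \<in> S" and f: "smooth_on S f"
    and D: "(jac f has_derivative D) (at x)"
    and rel: "\<And>y. y \<in> S \<Longrightarrow> jac f y (X y) = Z (f y)"
    and X: "(X has_derivative X') (at x)" and Z: "(Z has_derivative Z') (at (f x))"
  shows "Z' (jac f x h) = jac f x (X' h) + D h (X x)"
proof -
  have "((\<lambda>y. jac f y (X y)) has_derivative (\<lambda>h. jac f x (X' h) + D h (X x))) (at x)"
    by (rule bounded_bilinear.FDERIV[OF bounded_bilinear_blinfun_apply D X])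
  then have "((\<lambda>y. Z (f y)) has_derivative (\<lambda>h. jac f x (X' h) + D h (X x))) (at x)"
    by (rule has_derivative_transform_within_open[OF _ S rel])
  from has_derivative_unique[OF has_derivative_compose[OF jac_has_derivative(1)[OF f S(2)] Z] this]
  show ?thesis by meson
qed

text \<open>Differentiating the two relations introduces second derivatives of \<open>f\<close>,
  which cancel by symmetry. Applied to transition maps, this makes the bracket independent of the
  chart.\<close>

lemma related_bracket:
  fixes f :: "'d::euclidean_space \<Rightarrow> 'e::euclidean_space"
  assumes S: "open S" "x \<in> S" and f: "smooth_on S f"
    and relX: "\<And>y. y \<in> S \<Longrightarrow> jac f y (X y) = Z (f y)"
    and relY: "\<And>y. y \<in> S \<Longrightarrow> jac f y (Y y) = W (f y)"
    and X: "(X has_derivative X') (at x)" and Z: "(Z has_derivative Z') (at (f x))"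
    and Y: "(Y has_derivative Y') (at x)" and W: "(W has_derivative W') (at (f x))"
  shows "jac f x (Y' (X x) - X' (Y x)) = W' (Z (f x)) - Z' (W (f x))"
proof -
  have D: "(jac f has_derivative frechet_derivative (jac f) (at x)) (at x)"
    using smooth_on_has_derivative[OF smooth_on_jac[OF S(1) f] S(2)] .
  have "W' (Z (f x)) = jac f x (Y' (X x)) + frechet_derivative (jac f) (at x) (X x) (Y x)"
    using related_fields_derivative[OF S f D relY Y W, of "X x"] relX[OF S(2)] by simp
  moreover have "Z' (W (f x)) = jac f x (X' (Y x)) + frechet_derivative (jac f) (at x) (Y x) (X x)"
    using related_fields_derivative[OF S f D relX X Z, of "Y x"] relY[OF S(2)] by simp
  ultimately show ?thesis
    using jac_symmetric[OF S f D, of "X x" "Y x"] by (simp add: blinfun.diff_right)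
qed

text \<open>Differentiating the relation \<open>rel\<close> expresses
  \<open>jac f x (Q' h w)\<close> through \<open>T'\<close> and the second derivative of
  \<open>f\<close>; the second-derivative terms cancel by symmetry. Working with the pointwise
  formula avoids extending vector fields from the source to the target.\<close>

lemma nij_related:
  fixes f :: "'d::euclidean_space \<Rightarrow> 'e::euclidean_space" and Q :: "'d \<Rightarrow> 'd \<Rightarrow>\<^sub>L 'd" and T :: "'e \<Rightarrow> 'e \<Rightarrow>\<^sub>L 'e"
  assumes S: "open S" "x \<in> S" and f: "smooth_on S f"
    and rel: "\<And>y. y \<in> S \<Longrightarrow> jac f y o\<^sub>L Q y = T (f y) o\<^sub>L jac f y"
    and Q: "(Q has_derivative Q') (at x)" and T: "(T has_derivative T') (at (f x))"
  shows "jac f x (nij Q x u v) = nij T (f x) (jac f x u) (jac f x v)"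
proof -
  let ?J = "jac f x" and ?D = "frechet_derivative (jac f) (at x)"
  have D: "(jac f has_derivative ?D) (at x)"
    using smooth_on_has_derivative[OF smooth_on_jac[OF S(1) f] S(2)] .
  have JQ: "?J (Q x w) = T (f x) (?J w)" for w
    using rel[OF S(2)] by (metis blinfun_apply_blinfun_compose)
  have "((\<lambda>y. jac f y o\<^sub>L Q y) has_derivative (\<lambda>h. (?J o\<^sub>L Q' h) + (?D h o\<^sub>L Q x))) (at x)"
    by (rule bounded_bilinear.FDERIV[OF bounded_bilinear_blinfun_compose D Q])
  then have "((\<lambda>y. T (f y) o\<^sub>L jac f y) has_derivative (\<lambda>h. (?J o\<^sub>L Q' h) + (?D h o\<^sub>L Q x))) (at x)"
    by (rule has_derivative_transform_within_open[OF _ S rel])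
  from has_derivative_unique[OF this bounded_bilinear.FDERIV[OF bounded_bilinear_blinfun_compose
        has_derivative_compose[OF jac_has_derivative(1)[OF f S(2)] T] D]]
  have "(?J o\<^sub>L Q' h) + (?D h o\<^sub>L Q x) = (T (f x) o\<^sub>L ?D h) + (T' (?J h) o\<^sub>L ?J)" for h
    by meson
  then have key: "?J (Q' h w) = T (f x) (?D h w) + T' (?J h) (?J w) - ?D h (Q x w)" for h w
    by (metis (no_types, lifting) add_diff_cancel_right' blinfun.add_left blinfun_apply_blinfun_compose)
  have sym: "?D u v = ?D v u" for u v by (rule jac_symmetric[OF S f D])
  have "frechet_derivative Q (at x) = Q'" "frechet_derivative T (at (f x)) = T'"
    using frechet_derivative_at[OF Q] frechet_derivative_at[OF T] by auto
  then show ?thesis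
    by (simp add: nij_def Let_def key JQ blinfun.diff_right blinfun.add_right
        sym[of v u] sym[of "Q x v" u] sym[of "Q x u" v] sym[of "Q x v" "Q x u"])
qed

lemma linear_blinfun_apply: "linear (blinfun_apply f)"
  by (rule bounded_linear.linear[OF blinfun.bounded_linear_right])

subsection \<open>Invertibility near a point\<close>

text \<open>Where \<open>V y\<close> is within 1/2 of the identity,
  \<open>norm v \<le> 2 * norm (V y v)\<close>; so \<open>V y\<close> is injective, hence bijective
  in finite dimension, with inverse of norm at most 2.\<close>

lemma blinfun_inverse_near:
  fixes V :: "'x::euclidean_space \<Rightarrow> 'd::euclidean_space \<Rightarrow>\<^sub>L 'd"
  assumes U: "open U" "x0 \<in> U" and V: "continuous_on U V" "V x0 = id_blinfun"
  obtains S R where "open S" "x0 \<in> S" "S \<subseteq> U" "\<And>y. y \<in> S \<Longrightarrow> R y o\<^sub>L V y = id_blinfun"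
    "\<And>y. y \<in> S \<Longrightarrow> V y o\<^sub>L R y = id_blinfun" "\<And>y. y \<in> S \<Longrightarrow> norm (R y) \<le> 2"
proof -
  define S where "S = U \<inter> V -` ball id_blinfun (1/2)"
  have "open S" unfolding S_def by (rule continuous_open_preimage[OF V(1) U(1) open_ball])
  moreover have "x0 \<in> S" using U V by (simp add: S_def)
  moreover have "S \<subseteq> U" by (auto simp: S_def)
  moreover have "\<exists>R. R o\<^sub>L V y = id_blinfun \<and> V y o\<^sub>L R = id_blinfun \<and> norm R \<le> 2" if y: "y \<in> S" for y
  proof -
    have lower: "norm v \<le> 2 * norm (V y v)" for v
    proof -
      have "norm (v - V y v) \<le> norm (id_blinfun - V y) * norm v"
        by (metis blinfun.diff_left blinfun_apply_id_blinfun norm_blinfun)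
      also have "\<dots> \<le> (1/2) * norm v"
        using y by (intro mult_right_mono) (auto simp: S_def dist_norm)
      finally show ?thesis using norm_triangle_ineq2[of v "V y v"] by simp
    qed
    have lin: "linear (V y)" by (simp add: linear_blinfun_apply)
    have "inj (V y)"
      unfolding linear_injective_0[OF lin] using lower by (metis mult_zero_right norm_le_zero_iff norm_zero)
    then obtain g where g: "linear g" "\<And>v. g (V y v) = v" "\<And>v. V y (g v) = v"
      using linear_injective_isomorphism[OF lin] by metis
    then have R: "Blinfun g v = g v" for v by (intro Blinfun_linear_apply)
    have "norm (Blinfun g) \<le> 2"
      by (rule norm_blinfun_bound) (use lower g in \<open>auto simp: R\<close>, metis)
    then show ?thesis
      using g by (intro exI[of _ "Blinfun g"]) (auto intro!: blinfun_eqI simp: R)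
  qed
  ultimately show thesis using that by metis
qed

subsection \<open>Frobenius for the image of a tensor field\<close>

text \<open>The map \<open>Q\<close> serves twice: it normalises the frame, which forces
  commutation, and it recovers the parameter from the point, since \<open>Q \<circ> \<phi>\<close>
  is a translation. The latter becomes the chart of the integral manifold.\<close>

lemma frobenius_image:
  fixes T G :: "'e::euclidean_space \<Rightarrow> 'e \<Rightarrow>\<^sub>L 'e"
  assumes U: "open U" "x0 \<in> U" and T: "smooth_on U T" and G: "smooth_on U G"
    and comm: "\<And>x. x \<in> U \<Longrightarrow> T x o\<^sub>L G x = G x o\<^sub>L T x"
    and proj: "\<And>x. x \<in> U \<Longrightarrow> T x o\<^sub>L (G x o\<^sub>L T x) = T x"
    and N: "\<And>x u v. x \<in> U \<Longrightarrow> nij T x (T x u) (T x v) = 0"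
    and rank: "\<And>x. x \<in> U \<Longrightarrow> dim (range (T x)) = DIM('d::euclidean_space)"
  obtains r and \<phi> :: "'d::euclidean_space \<Rightarrow> 'e" and Q :: "'e \<Rightarrow> 'd"
  where "r > 0" "smooth_on (ball 0 r) \<phi>" "\<phi> 0 = x0" "\<phi> ` ball 0 r \<subseteq> U" "linear Q"
    "\<And>y. y \<in> ball 0 r \<Longrightarrow> Q (\<phi> y) = Q x0 + y"
    "\<And>y. y \<in> ball 0 r \<Longrightarrow> inj (frechet_derivative \<phi> (at y))"
    "\<And>y. y \<in> ball 0 r \<Longrightarrow> range (frechet_derivative \<phi> (at y)) = range (T (\<phi> y))"
proof -
  have sub: "subspace (range (T x))" for x by (simp add: linear_blinfun_apply linear_subspace_image)
  obtain L where L: "linear L" "range L = range (T x0)" "inj (L :: 'd \<Rightarrow> 'e)"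
  proof -
    obtain f where "linear (f :: 'd \<Rightarrow> 'e)" "f ` UNIV = range (T x0)" "inj_on f UNIV"
      using isometries_subspaces[OF subspace_UNIV sub[of x0]] rank[OF U(2)]
      by (metis dim_UNIV inj_on_def)
    then show thesis using that by blast
  qed
  obtain Q where Q: "linear Q" "\<And>v. Q (L v) = v"
    using linear_injective_left_inverse[OF L(1,3)] by (metis comp_apply id_apply)
  define Lb where "Lb = Blinfun L"
  define Qb where "Qb = Blinfun Q"
  have Lb [simp]: "Lb v = L v" for v unfolding Lb_def by (rule Blinfun_linear_apply[OF L(1)])
  have Qb [simp]: "Qb v = Q v" for v unfolding Qb_def by (rule Blinfun_linear_apply[OF Q(1)])
  define P where "P x = T x o\<^sub>L G x" for x
  have T_G: "T x (G x v) = G x (T x v)" if "x \<in> U" for x v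
    using comm[OF that] by (metis blinfun_apply_blinfun_compose)
  have T_proj: "T x (G x (T x v)) = T x v" if "x \<in> U" for x v
    using proj[OF that] by (metis blinfun_apply_blinfun_compose)
  \<comment> \<open>\<open>P x\<close> projects onto the image of \<open>T x\<close>. At
    \<open>x0\<close> it fixes the range of \<open>L\<close>, so \<open>V x0\<close> is the identity
    and \<open>V\<close> is invertible nearby; the frame \<open>B\<close> below is \<open>P\<close>
    after \<open>L\<close>, corrected by this inverse so that \<open>Q\<close> after
    \<open>B x\<close> is the identity.\<close>
  define V where "V x = Qb o\<^sub>L (P x o\<^sub>L Lb)" for x
  have P_smooth: "smooth_on U P"
    unfolding P_def by (rule smooth_on_bilinear[OF bounded_bilinear_blinfun_compose U(1) T G])
  have V_smooth: "smooth_on U V"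
    unfolding V_def
    by (intro smooth_on_bilinear[OF bounded_bilinear_blinfun_compose] U(1) smooth_on_const P_smooth)
  have "V x0 = id_blinfun"
  proof (rule blinfun_eqI)
    fix v
    obtain w where "L v = T x0 w" using L(2) by blast
    then show "V x0 v = id_blinfun v"
      using T_proj[OF U(2), of w] Q(2)[of v] by (simp add: V_def P_def)
  qed
  then obtain S R where S: "open S" "x0 \<in> S" "S \<subseteq> U" and RV: "\<And>y. y \<in> S \<Longrightarrow> R y o\<^sub>L V y = id_blinfun"
    and VR: "\<And>y. y \<in> S \<Longrightarrow> V y o\<^sub>L R y = id_blinfun" and R2: "\<And>y. y \<in> S \<Longrightarrow> norm (R y) \<le> 2"
    using blinfun_inverse_near[OF U smooth_on_continuous_on[OF V_smooth]] by metis
  have R_smooth: "smooth_on S R"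
    by (rule smooth_on_blinfun_inverse[OF S(1) RV VR R2 smooth_on_subset[OF V_smooth S(3)]])
  define B where "B x = P x o\<^sub>L (Lb o\<^sub>L R x)" for x
  have B_smooth: "smooth_on S B"
    unfolding B_def
    by (intro smooth_on_bilinear[OF bounded_bilinear_blinfun_compose] S(1) smooth_on_const R_smooth
        smooth_on_subset[OF P_smooth S(3)])
  have QB: "Q (B x v) = v" if "x \<in> S" for x v
  proof -
    have "V x (R x v) = v" using VR[OF that] by (metis blinfun_apply_blinfun_compose blinfun_apply_id_blinfun)
    then show ?thesis by (simp add: V_def B_def)
  qed
  have B_inj: "inj (B x)" if "x \<in> S" for x using QB[OF that] by (metis injI)
  \<comment> \<open>The factor \<open>P x\<close> gives one inclusion; constant rank and injectivity
    of \<open>B x\<close> give equal dimensions.\<close>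
  have B_range: "range (B x) = range (T x)" if x: "x \<in> S" for x
  proof (rule subspace_dim_equal[OF _ sub])
    show "subspace (range (B x))" by (simp add: linear_blinfun_apply linear_subspace_image)
    show "range (B x) \<subseteq> range (T x)" by (auto simp: B_def P_def)
    have "dim (range (B x)) = DIM('d)"
      using dim_image_eq[of "B x" UNIV] B_inj[OF x] by (simp add: linear_blinfun_apply)
    then show "dim (range (T x)) \<le> dim (range (B x))" using rank x S(3) by force
  qed
  have Q_inj: "w = 0" if "x \<in> S" "w \<in> range (T x)" "Q w = 0" for x w
    using that QB[OF that(1)] B_range[OF that(1)] by (metis blinfun.zero_right imageE)
  \<comment> \<open>A preimage of the frame under \<open>T\<close> that itself lies in the image of
    \<open>T\<close>: there \<open>T G\<close> is the identity, so
    \<open>T A = T G T G B = B\<close>. The hypothesis \<open>N\<close> can therefore be applied to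
    \<open>A x v\<close> and \<open>A x w\<close>.\<close>
  define A where "A x = T x o\<^sub>L (G x o\<^sub>L (G x o\<^sub>L B x))" for x
  have A_smooth: "smooth_on S A"
    unfolding A_def
    by (intro smooth_on_bilinear[OF bounded_bilinear_blinfun_compose] S(1) B_smooth
        smooth_on_subset[OF T S(3)] smooth_on_subset[OF G S(3)])
  have TA: "T x (A x w) = B x w" if xS: "x \<in> S" for x w
  proof -
    have x: "x \<in> U" using xS S by blast
    obtain w' where "B x w = T x w'" using B_range[OF xS] by blast
    then show ?thesis by (simp add: A_def T_G[OF x] T_proj[OF x, unfolded T_G[OF x]])
  qed
  have "frechet_derivative B (at x) (B x v) w = frechet_derivative B (at x) (B x w) v" if x: "x \<in> S" for x v w
  proof -
    let ?B' = "frechet_derivative B (at x)" and ?A' = "frechet_derivative A (at x)"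
    have dB: "((\<lambda>y. B y w) has_derivative (\<lambda>h. ?B' h w)) (at x)" for w
      by (rule bounded_linear.has_derivative[OF blinfun.bounded_linear_left smooth_on_has_derivative[OF B_smooth x]])
    have dA: "((\<lambda>y. A y w) has_derivative (\<lambda>h. ?A' h w)) (at x)" for w
      by (rule bounded_linear.has_derivative[OF blinfun.bounded_linear_left smooth_on_has_derivative[OF A_smooth x]])
    have dTA: "((\<lambda>y. T y (A y w)) has_derivative (\<lambda>h. ?B' h w)) (at x)" for w
      by (rule has_derivative_transform_within_open[OF dB S(1) x]) (simp add: TA)
    have xU: "x \<in> U" using x S by blast
    \<comment> \<open>In the bracket form the image fields are the frame fields, and every term
      except their bracket is a value of \<open>T x\<close>; so that bracket lies in the range of
      \<open>T x\<close>.\<close>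
    have "nij T x (A x v) (A x w) = 0" using N[OF xU] by (simp add: A_def)
    then obtain a b c where
      "(?B' (B x v) w - ?B' (B x w) v) - T x a - T x b + T x (T x c) = 0"
      unfolding nij_brackets[OF smooth_on_has_derivative[OF T xU] dA dA dTA dTA] TA[OF x] by blast
    then have "?B' (B x v) w - ?B' (B x w) v = T x (a + b - T x c)"
      by (simp add: blinfun.add_right blinfun.diff_right algebra_simps)
    then have "\<exists>z. ?B' (B x v) w - ?B' (B x w) v = T x z" by blast
    \<comment> \<open>\<open>Q (B y w)\<close> is constantly \<open>w\<close> near \<open>x\<close>.
      As \<open>Q\<close> is injective on the range of \<open>T x\<close>, the bracket
      vanishes.\<close>
    moreover have "Q (?B' h w) = 0" for h w
    proof -
      have "((\<lambda>y. Q (B y w)) has_derivative (\<lambda>h. Q (?B' h w))) (at x)"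
        using bounded_linear.has_derivative[OF _ dB] Q(1) by (simp add: linear_conv_bounded_linear)
      moreover have "((\<lambda>y. Q (B y w)) has_derivative (\<lambda>h. 0)) (at x)"
        by (rule has_derivative_transform_within_open[OF has_derivative_const S(1) x]) (simp add: QB)
      ultimately have "(\<lambda>h. Q (?B' h w)) = (\<lambda>h. 0)" by (rule has_derivative_unique)
      then show ?thesis by (simp add: fun_eq_iff)
    qed
    ultimately have "?B' (B x v) w - ?B' (B x w) v = 0"
      using Q_inj[OF x] linear_diff[OF Q(1)] by (metis cancel_comm_monoid_add_class.diff_cancel rangeI)
    then show ?thesis by simp
  qed
  then obtain r \<phi> where \<phi>: "r > 0" "smooth_on (ball 0 r) \<phi>" "\<phi> 0 = x0" "\<phi> ` ball 0 r \<subseteq> S"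
    "\<And>y. y \<in> ball 0 r \<Longrightarrow> (\<phi> has_derivative B (\<phi> y)) (at y)"
    using frobenius_commuting[OF S(1,2) B_smooth] by metis
  have fd: "frechet_derivative \<phi> (at y) = B (\<phi> y)" if "y \<in> ball 0 r" for y
    using frechet_derivative_at[OF \<phi>(5)[OF that]] by simp
  have "Q (\<phi> y) = Q x0 + y" if y: "y \<in> ball 0 r" for y
  proof -
    have "((\<lambda>y. Q (\<phi> y) - y) has_derivative (\<lambda>h. 0)) (at y within ball 0 r)" if "y \<in> ball 0 r" for y
    proof -
      have "((\<lambda>y. Q (\<phi> y)) has_derivative (\<lambda>h. Q (B (\<phi> y) h))) (at y)"
        using bounded_linear.has_derivative[OF _ \<phi>(5)[OF that]] Q(1) by (simp add: linear_conv_bounded_linear)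
      moreover have "\<phi> y \<in> S" using \<phi>(4) that by blast
      ultimately have "((\<lambda>y. Q (\<phi> y) - y) has_derivative (\<lambda>h. h - h)) (at y)"
        by (intro has_derivative_diff has_derivative_ident) (simp add: QB)
      then show ?thesis by (simp add: has_derivative_at_withinI)
    qed
    from has_derivative_zero_constant[OF convex_ball this]
    obtain c where c: "\<And>y. y \<in> ball 0 r \<Longrightarrow> Q (\<phi> y) - y = c" by blast
    have "0 \<in> ball 0 r" using \<phi>(1) by simp
    then show ?thesis using c[OF y] c[of 0] \<phi>(3) by (metis add.commute diff_add_cancel diff_zero)
  qed
  moreover have "inj (frechet_derivative \<phi> (at y))"
      "range (frechet_derivative \<phi> (at y)) = range (T (\<phi> y))" if "y \<in> ball 0 r" for y
    unfolding fd[OF that] using B_inj B_range \<phi>(4) that by blast+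
  moreover have "\<phi> ` ball 0 r \<subseteq> U" using \<phi>(4) S(3) by blast
  ultimately show thesis using that[OF \<phi>(1-3) _ Q(1)] by blast
qed

subsection \<open>Charts and tangent vectors\<close>

lemma scaleR_fun_apply [simp]: "(a *\<^sub>R f) x = a *\<^sub>R f x"
  by (simp add: scaleR_fun_def)

locale smooth_mfd =
  fixes M :: "'m topology" and A :: "('m, 'e::euclidean_space) chart set"
  assumes mfd: "smooth_manifold M A"
begin

lemma chart: "c \<in> A \<Longrightarrow> is_chart M c"
  and covering: "p \<in> topspace M \<Longrightarrow> \<exists>c\<in>A. p \<in> cdom c"
  and Hausdorff: "Hausdorff_space M"
  and second_countable: "second_countable M"
  using mfd unfolding smooth_manifold_def by auto

lemma cdom_openin: "c \<in> A \<Longrightarrow> openin M (cdom c)"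
  and cimage_open: "c \<in> A \<Longrightarrow> open (cimage c)"
  and chart_homeo: "c \<in> A \<Longrightarrow> homeomorphic_map (subtopology M (cdom c)) (top_of_set (cimage c)) (cmap c)"
  using chart unfolding is_chart_def by auto

lemma cdom_topspace: "c \<in> A \<Longrightarrow> p \<in> cdom c \<Longrightarrow> p \<in> topspace M"
  using cdom_openin openin_subset by blast

lemma cmap_inj: "c \<in> A \<Longrightarrow> inj_on (cmap c) (cdom c)"
  using homeomorphic_imp_injective_map[OF chart_homeo[of c]] cdom_openin[of c, THEN openin_subset]
  by (simp add: Int_absorb1)

lemma cinv_cmap [simp]: "c \<in> A \<Longrightarrow> p \<in> cdom c \<Longrightarrow> cinv c (cmap c p) = p"
  unfolding cinv_def by (rule inv_into_f_f[OF cmap_inj])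

lemma cmap_cimage [simp]: "p \<in> cdom c \<Longrightarrow> cmap c p \<in> cimage c"
  unfolding cimage_def by blast

lemma cinv_cdom [simp]: "x \<in> cimage c \<Longrightarrow> cinv c x \<in> cdom c"
  and cmap_cinv [simp]: "x \<in> cimage c \<Longrightarrow> cmap c (cinv c x) = x"
  unfolding cinv_def cimage_def by (auto intro: inv_into_into f_inv_into_f)

lemma cinv_topspace: "c \<in> A \<Longrightarrow> x \<in> cimage c \<Longrightarrow> cinv c x \<in> topspace M"
  by (rule cdom_topspace[OF _ cinv_cdom])

lemma cimage_Int: "c \<in> A \<Longrightarrow> cmap c ` (cdom c \<inter> W) = {x \<in> cimage c. cinv c x \<in> W}"
  by (auto simp: cimage_def)

lemma cmap_open_image:
  assumes "c \<in> A" "openin M W"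
  shows "open (cmap c ` (cdom c \<inter> W))"
proof -
  have "openin (subtopology M (cdom c)) (cdom c \<inter> W)"
    using assms(2) by (simp add: openin_subtopology_Int2)
  then have "openin (top_of_set (cimage c)) (cmap c ` (cdom c \<inter> W))"
    using homeomorphic_imp_open_map[OF chart_homeo[OF assms(1)]] unfolding open_map_def by blast
  then show ?thesis using cimage_open[OF assms(1)] openin_open_trans by blast
qed

lemma cmap_continuous: "c \<in> A \<Longrightarrow> continuous_map (subtopology M (cdom c)) euclidean (cmap c)"
  using homeomorphic_imp_continuous_map[OF chart_homeo] continuous_map_into_fulltopology by blast

lemma cinv_continuous:
  assumes "c \<in> A"
  shows "continuous_map (top_of_set (cimage c)) M (cinv c)"
  unfolding continuous_map_def
proof (intro conjI allI impI)
  show "cinv c \<in> topspace (top_of_set (cimage c)) \<rightarrow> topspace M" using cinv_topspace[OF assms] by auto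
  fix W assume W: "openin M W"
  have "{x \<in> cimage c. cinv c x \<in> W} = cmap c ` (cdom c \<inter> W)" using cimage_Int[OF assms] by simp
  then show "openin (top_of_set (cimage c)) {x \<in> topspace (top_of_set (cimage c)). cinv c x \<in> W}"
    using cmap_open_image[OF assms W] by (auto intro!: open_subset simp: cimage_def)
qed

definition overlap :: "('m, 'e) chart \<Rightarrow> ('m, 'e) chart \<Rightarrow> 'e set" where
  "overlap c d = {x \<in> cimage c. cinv c x \<in> cdom d}"

definition transition :: "('m, 'e) chart \<Rightarrow> ('m, 'e) chart \<Rightarrow> 'e \<Rightarrow> 'e" where
  "transition c d = cmap d \<circ> cinv c"

lemma overlap_open: "c \<in> A \<Longrightarrow> d \<in> A \<Longrightarrow> open (overlap c d)"
  using cmap_open_image[of c "cdom d"] cdom_openin by (simp add: cimage_Int overlap_def)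

lemma transition_smooth: "c \<in> A \<Longrightarrow> d \<in> A \<Longrightarrow> smooth_on (overlap c d) (transition c d)"
  unfolding overlap_def transition_def cimage_Int[symmetric]
  using mfd unfolding smooth_manifold_def by blast

lemma cmap_overlap: "c \<in> A \<Longrightarrow> p \<in> cdom c \<Longrightarrow> p \<in> cdom d \<Longrightarrow> cmap c p \<in> overlap c d"
  by (simp add: overlap_def)

lemma transition_derivative:
  assumes "c \<in> A" "d \<in> A" "p \<in> cdom c" "p \<in> cdom d"
  shows "(transition c d has_derivative jac (transition c d) (cmap c p)) (at (cmap c p))"
    "blinfun_apply (jac (transition c d) (cmap c p)) = frechet_derivative (transition c d) (at (cmap c p))"
  using jac_has_derivative[OF transition_smooth[OF assms(1,2)] cmap_overlap] assms by auto

lemma transition_chain: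
  assumes "b \<in> A" "c \<in> A" "d \<in> A" "p \<in> cdom b" "p \<in> cdom c" "p \<in> cdom d"
  shows "jac (transition c d) (cmap c p) (jac (transition b c) (cmap b p) v) = jac (transition b d) (cmap b p) v"
proof -
  have "transition b c (cmap b p) = cmap c p" using assms by (simp add: transition_def)
  then have "((\<lambda>x. transition c d (transition b c x)) has_derivative
      (\<lambda>v. jac (transition c d) (cmap c p) (jac (transition b c) (cmap b p) v))) (at (cmap b p))"
    using has_derivative_compose[OF transition_derivative(1)[of b c p]] transition_derivative(1)[of c d p] assms by simp
  then have "(transition b d has_derivative
      (\<lambda>v. jac (transition c d) (cmap c p) (jac (transition b c) (cmap b p) v))) (at (cmap b p))"
    by (rule has_derivative_transform_within_open[OF _ overlap_open[of b c]])
      (use assms in \<open>auto simp: overlap_def transition_def\<close>)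
  from fun_cong[OF has_derivative_unique[OF this transition_derivative(1)[of b d p]]] assms show ?thesis by simp
qed

lemma transition_self:
  assumes "c \<in> A" "p \<in> cdom c"
  shows "jac (transition c c) (cmap c p) v = v"
proof -
  have "(transition c c has_derivative (\<lambda>v. v)) (at (cmap c p))"
    by (rule has_derivative_transform_within_open[OF has_derivative_ident cimage_open[OF assms(1)]])
      (use assms in \<open>auto simp: transition_def\<close>)
  from has_derivative_unique[OF this transition_derivative(1)[of c c p]] assms show ?thesis by metis
qed

lemma tangent_space_iff:
  "v \<in> tangent_space A p \<longleftrightarrow> (\<forall>c. \<not> (c \<in> A \<and> p \<in> cdom c) \<longrightarrow> v c = 0) \<and>
    (\<forall>c\<in>A. \<forall>d\<in>A. p \<in> cdom c \<and> p \<in> cdom d \<longrightarrow> v d = jac (transition c d) (cmap c p) (v c))"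
  unfolding tangent_space_def using transition_derivative(2) by (auto simp: transition_def)

lemma coord_vec_eq:
  assumes "c \<in> A" "p \<in> cdom c"
  shows "coord_vec A c e p = (\<lambda>d. if d \<in> A \<and> p \<in> cdom d then jac (transition c d) (cmap c p) e else 0)"
  unfolding coord_vec_def transition_def[symmetric]
  by (rule ext) (simp add: transition_derivative(2)[OF assms(1) _ assms(2)])

lemma coord_vec_self [simp]: "c \<in> A \<Longrightarrow> p \<in> cdom c \<Longrightarrow> coord_vec A c e p c = e"
  by (simp add: coord_vec_eq transition_self)

lemma coord_vec_tangent: "c \<in> A \<Longrightarrow> p \<in> cdom c \<Longrightarrow> coord_vec A c e p \<in> tangent_space A p"
  by (auto simp: tangent_space_iff coord_vec_eq transition_chain)

text \<open>Together with \<open>coord_vec_self\<close> and \<open>coord_vec_linear\<close>, this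
  makes evaluation in one chart a linear isomorphism from the tangent space onto the model
  space.\<close>

lemma tangent_coord_vec: "c \<in> A \<Longrightarrow> p \<in> cdom c \<Longrightarrow> v \<in> tangent_space A p \<Longrightarrow> coord_vec A c (v c) p = v"
  unfolding tangent_space_iff by (rule ext) (metis coord_vec_eq)

lemma tangent_eqI:
  "c \<in> A \<Longrightarrow> p \<in> cdom c \<Longrightarrow> u \<in> tangent_space A p \<Longrightarrow> v \<in> tangent_space A p \<Longrightarrow> u c = v c \<Longrightarrow> u = v"
  by (metis tangent_coord_vec)

lemma subspace_tangent_space: "subspace (tangent_space A p)"
proof (rule subspaceI)
  show "0 \<in> tangent_space A p" unfolding tangent_space_iff by (simp add: blinfun.zero_right)
  note D = tangent_space_iff[THEN iffD1, THEN conjunct2, rule_format]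
  note D0 = tangent_space_iff[THEN iffD1, THEN conjunct1, rule_format]
  show "u + v \<in> tangent_space A p" if u: "u \<in> tangent_space A p" and v: "v \<in> tangent_space A p" for u v
    unfolding tangent_space_iff plus_fun_apply blinfun.add_right
    by (intro conjI allI ballI impI arg_cong2[where f="(+)"] D[OF u] D[OF v]) (simp_all add: D0[OF u] D0[OF v])
  show "a *\<^sub>R v \<in> tangent_space A p" if v: "v \<in> tangent_space A p" for a v
    unfolding tangent_space_iff scaleR_fun_apply blinfun.scaleR_right
    by (intro conjI allI ballI impI arg_cong[where f="scaleR a"] D[OF v]) (simp_all add: D0[OF v])
qed

lemma coord_vec_linear: "c \<in> A \<Longrightarrow> p \<in> cdom c \<Longrightarrow> linear (\<lambda>e. coord_vec A c e p)"
  by (intro linearI) (auto simp: coord_vec_eq fun_eq_iff plus_fun_def scaleR_fun_def blinfun.add_right blinfun.scaleR_right)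

subsection \<open>Vector fields and endomorphism fields in charts\<close>

text \<open>The pointwise part of \<open>tensor_field_11\<close>, separated from smoothness because
  linearity of the tensor induced on an integral manifold is known before its regularity.\<close>

definition endo :: "('m, 'e) endo_field \<Rightarrow> bool" where
  "endo T \<longleftrightarrow> (\<forall>p\<in>topspace M. \<forall>u\<in>tangent_space A p. T p u \<in> tangent_space A p \<and>
     (\<forall>v\<in>tangent_space A p. T p (u + v) = T p u + T p v) \<and> (\<forall>a. T p (a *\<^sub>R u) = a *\<^sub>R T p u))"

definition loc :: "('m, 'e) endo_field \<Rightarrow> ('m, 'e) chart \<Rightarrow> 'e \<Rightarrow> 'e \<Rightarrow>\<^sub>L 'e" where
  "loc T c x = Blinfun (\<lambda>e. T (cinv c x) (coord_vec A c e (cinv c x)) c)"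

text \<open>Brackets use first derivatives only, and this class is stable under tensors known merely
  to be differentiable in charts.\<close>

definition field :: "('m \<Rightarrow> ('m, 'e) tvec) \<Rightarrow> bool" where
  "field X \<longleftrightarrow> (\<forall>p\<in>topspace M. X p \<in> tangent_space A p) \<and>
     (\<forall>c\<in>A. \<forall>x\<in>cimage c. vec_in_chart c X differentiable (at x))"

lemma smooth_field: "smooth_vector_field M A X \<Longrightarrow> field X"
  unfolding smooth_vector_field_def field_def differentiable_def using smooth_on_has_derivative by blast

lemma endoD:
  assumes "endo T" "p \<in> topspace M" "u \<in> tangent_space A p"
  shows "T p u \<in> tangent_space A p" "v \<in> tangent_space A p \<Longrightarrow> T p (u + v) = T p u + T p v"
    "T p (a *\<^sub>R u) = a *\<^sub>R T p u"
  using assms unfolding endo_def by auto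

lemma linear_loc:
  assumes "endo T" "c \<in> A" "p \<in> cdom c"
  shows "linear (\<lambda>e. T p (coord_vec A c e p) c)"
proof -
  note p = cdom_topspace[OF assms(2,3)] and t = coord_vec_tangent[OF assms(2,3)]
  show ?thesis
    by (intro linearI)
      (simp_all only: linear_add[OF coord_vec_linear[OF assms(2,3)]] linear_scale[OF coord_vec_linear[OF assms(2,3)]]
        endoD(2)[OF assms(1) p t t] endoD(3)[OF assms(1) p t] plus_fun_apply scaleR_fun_apply)
qed

lemma loc_apply:
  assumes "endo T" "c \<in> A" "p \<in> cdom c" "v \<in> tangent_space A p"
  shows "T p v c = loc T c (cmap c p) (v c)"
  using Blinfun_linear_apply[OF linear_loc[OF assms(1-3)]] tangent_coord_vec[OF assms(2-4)] assms(2,3)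
  by (simp add: loc_def)

lemma loc_coord:
  assumes "endo T" "c \<in> A" "x \<in> cimage c"
  shows "loc T c x e = T (cinv c x) (coord_vec A c e (cinv c x)) c"
  using Blinfun_linear_apply[OF linear_loc[OF assms(1,2) cinv_cdom[OF assms(3)]]] by (simp add: loc_def)

lemma loc_compose:
  assumes "endo T" "endo R" "c \<in> A" "x \<in> cimage c"
  shows "loc (\<lambda>p v. T p (R p v)) c x = loc T c x o\<^sub>L loc R c x"
proof (rule blinfun_eqI)
  fix e
  note p = cinv_cdom[OF assms(4)]
  have "endo (\<lambda>p v. T p (R p v))"
    using assms(1,2) unfolding endo_def by auto
  moreover have "R (cinv c x) (coord_vec A c e (cinv c x)) \<in> tangent_space A (cinv c x)"
    by (intro endoD(1)[OF assms(2)] cinv_topspace coord_vec_tangent assms p)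
  ultimately show "loc (\<lambda>p v. T p (R p v)) c x e = (loc T c x o\<^sub>L loc R c x) e"
    using loc_apply[OF assms(1,3) p] assms by (simp add: loc_coord)
qed

lemma tensor_field_endo: "tensor_field_11 M A T \<Longrightarrow> endo T"
  unfolding tensor_field_11_def endo_def by blast

lemma tensor_field_loc_smooth:
  assumes "tensor_field_11 M A T" "c \<in> A"
  shows "smooth_on (cimage c) (loc T c)"
proof -
  have "smooth_on (cimage c) (\<lambda>x. T (cinv c x) (coord_vec A c e (cinv c x)) c)" for e
    using assms unfolding tensor_field_11_def vec_in_chart_def by blast
  then show ?thesis
    unfolding loc_def
    using linear_loc[OF tensor_field_endo[OF assms(1)] assms(2)]
    by (intro smooth_on_Blinfun cimage_open assms(2)) auto
qed

text \<open>The components of a field in two charts are related by the transition map, so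
  \<open>related_bracket\<close> gives the transformation rule.\<close>

lemma lie_bracket_tangent:
  assumes X: "field X" and Y: "field Y" and p: "p \<in> topspace M"
  shows "lie_bracket A X Y p \<in> tangent_space A p"
  unfolding tangent_space_iff
proof (intro conjI ballI impI allI; (elim conjE)?)
  fix c d assume c: "c \<in> A" "p \<in> cdom c" and d: "d \<in> A" "p \<in> cdom d"
  have rel: "jac (transition c d) x (vec_in_chart c Z x) = vec_in_chart d Z (transition c d x)"
    if "field Z" "x \<in> overlap c d" for Z x
  proof -
    have q: "cinv c x \<in> cdom c" "cinv c x \<in> cdom d" "cmap c (cinv c x) = x" using that by (auto simp: overlap_def)
    then have "Z (cinv c x) \<in> tangent_space A (cinv c x)"
      using that(1) cdom_topspace[OF c(1)] unfolding field_def by blast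
    then have "Z (cinv c x) d = jac (transition c d) (cmap c (cinv c x)) (Z (cinv c x) c)"
      using q(1,2) c(1) d(1) unfolding tangent_space_iff by blast
    then show ?thesis
      using q d(1) by (simp add: vec_in_chart_def transition_def)
  qed
  have der: "(vec_in_chart b Z has_derivative frechet_derivative (vec_in_chart b Z) (at (cmap b p))) (at (cmap b p))"
    if "field Z" "b \<in> A" "p \<in> cdom b" for Z b
    using that unfolding field_def by (auto simp: frechet_derivative_works)
  have t: "transition c d (cmap c p) = cmap d p" using c by (simp add: transition_def)
  have v: "vec_in_chart c Z (cmap c p) = Z p c" "vec_in_chart d Z (cmap d p) = Z p d" for Z
    using c d by (simp_all add: vec_in_chart_def)
  let ?x = "cmap c p"
  let ?D = "\<lambda>b Z. frechet_derivative (vec_in_chart b Z) (at (cmap b p))"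
  have "jac (transition c d) ?x (?D c Y (vec_in_chart c X ?x) - ?D c X (vec_in_chart c Y ?x)) =
      ?D d Y (vec_in_chart d X (transition c d ?x)) - ?D d X (vec_in_chart d Y (transition c d ?x))"
    by (rule related_bracket[OF overlap_open[OF c(1) d(1)] cmap_overlap[OF c d(2)] transition_smooth[OF c(1) d(1)]
        rel[OF X] rel[OF Y]]) (simp_all add: t der X Y c d)
  then show "lie_bracket A X Y p d = jac (transition c d) ?x (lie_bracket A X Y p c)"
    using c d by (simp add: lie_bracket_def t v)
qed (auto simp: lie_bracket_def)

definition endo_diff :: "('m, 'e) endo_field \<Rightarrow> bool" where
  "endo_diff T \<longleftrightarrow> endo T \<and> (\<forall>c\<in>A. \<forall>x\<in>cimage c. loc T c differentiable (at x))"

lemma vec_in_chart_endo: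
  assumes "endo T" "\<And>p. p \<in> topspace M \<Longrightarrow> X p \<in> tangent_space A p" "c \<in> A" "x \<in> cimage c"
  shows "vec_in_chart c (\<lambda>q. T q (X q)) x = loc T c x (vec_in_chart c X x)"
  using loc_apply[OF assms(1,3) cinv_cdom[OF assms(4)] assms(2)] cinv_topspace assms(3,4)
  by (simp add: vec_in_chart_def)

lemma field_endo:
  assumes "endo_diff T" "field X"
  shows "field (\<lambda>q. T q (X q))"
  unfolding field_def
proof (intro conjI ballI)
  have T: "endo T" and X: "\<And>p. p \<in> topspace M \<Longrightarrow> X p \<in> tangent_space A p"
    using assms by (auto simp: endo_diff_def field_def)
  show "T p (X p) \<in> tangent_space A p" if "p \<in> topspace M" for p
    by (rule endoD(1)[OF T that X[OF that]])
  fix c x assume c: "c \<in> A" and x: "x \<in> cimage c"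
  obtain T' X' where "(loc T c has_derivative T') (at x)" "(vec_in_chart c X has_derivative X') (at x)"
    using assms c x unfolding endo_diff_def field_def differentiable_def by blast
  from bounded_bilinear.FDERIV[OF bounded_bilinear_blinfun_apply this]
  have "(\<lambda>x. loc T c x (vec_in_chart c X x)) differentiable (at x)" by (auto simp: differentiable_def)
  then show "vec_in_chart c (\<lambda>q. T q (X q)) differentiable (at x)"
    by (rule differentiable_cong_open[OF cimage_open[OF c] x, rotated]) (simp add: vec_in_chart_endo[OF T X c])
qed

lemma nijenhuis_tangent:
  assumes T: "endo_diff T" and X: "field X" and Y: "field Y" and p: "p \<in> topspace M"
  shows "nijenhuis A T X Y p \<in> tangent_space A p"
proof -
  have e: "endo T" using T by (simp add: endo_diff_def)
  note s = subspace_tangent_space[of p]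
  show ?thesis
    unfolding nijenhuis_def
    by (intro subspace_add[OF s] subspace_diff[OF s] endoD(1)[OF e p] lie_bracket_tangent[OF _ _ p]
        field_endo[OF T] X Y)
qed

text \<open>Every term of the definition is read in the chart \<open>c\<close>, where applying
  \<open>T\<close> becomes applying \<open>loc T c\<close>; \<open>nij_brackets\<close> then removes
  the derivatives of the fields.\<close>

lemma nijenhuis_nij:
  assumes T: "endo_diff T" and X: "field X" and Y: "field Y" and c: "c \<in> A" "p \<in> cdom c"
  shows "nijenhuis A T X Y p c = nij (loc T c) (cmap c p) (X p c) (Y p c)"
proof -
  have p: "p \<in> topspace M" using cdom_topspace c by blast
  have e: "endo T" using T by (simp add: endo_diff_def)
  let ?x = "cmap c p"
  have x: "?x \<in> cimage c" using c by simp
  have der: "(vec_in_chart c Z has_derivative frechet_derivative (vec_in_chart c Z) (at ?x)) (at ?x)"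
    if "field Z" for Z
    using that c unfolding field_def by (auto simp: frechet_derivative_works)
  have derT: "((\<lambda>x. loc T c x (vec_in_chart c Z x)) has_derivative
      frechet_derivative (vec_in_chart c (\<lambda>q. T q (Z q))) (at ?x)) (at ?x)" if "field Z" for Z
    using that
    by (intro has_derivative_transform_within_open[OF der[OF field_endo[OF T that]] cimage_open[OF c(1)] x])
      (simp add: vec_in_chart_endo[OF e _ c(1)] field_def)
  obtain D where D: "(loc T c has_derivative D) (at ?x)"
    using T c x unfolding endo_diff_def differentiable_def by blast
  have v: "vec_in_chart c Z ?x = Z p c" for Z using c by (simp add: vec_in_chart_def)
  have loc_br: "T p (lie_bracket A Z W p) c = loc T c ?x (lie_bracket A Z W p c)" if "field Z" "field W" for Z W
    by (rule loc_apply[OF e c lie_bracket_tangent[OF that p]])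
  note loc_br = loc_br[OF field_endo[OF T X] Y] loc_br[OF X field_endo[OF T Y]]
  have loc_br2: "T p (T p (lie_bracket A X Y p)) c = loc T c ?x (loc T c ?x (lie_bracket A X Y p c))"
    using loc_apply[OF e c] endoD(1)[OF e p] lie_bracket_tangent[OF X Y p] by simp
  have lb: "lie_bracket A Z W p c = frechet_derivative (vec_in_chart c W) (at ?x) (Z p c) -
      frechet_derivative (vec_in_chart c Z) (at ?x) (W p c)" for Z W
    using c by (simp add: lie_bracket_def)
  have Xp: "X p \<in> tangent_space A p" "Y p \<in> tangent_space A p" using X Y p by (auto simp: field_def)
  show ?thesis
    using nij_brackets[OF D der[OF X] der[OF Y] derT[OF X] derT[OF Y], unfolded v]
    by (simp add: nijenhuis_def loc_br loc_br2 loc_apply[OF e c Xp(1)] loc_apply[OF e c Xp(2)] lb)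
qed

lemma nijenhuis_eq_0_iff:
  assumes "endo_diff T" "field X" "field Y" "c \<in> A" "p \<in> cdom c"
  shows "nijenhuis A T X Y p = 0 \<longleftrightarrow> nij (loc T c) (cmap c p) (X p c) (Y p c) = 0"
proof -
  have p: "p \<in> topspace M" using cdom_topspace assms(4,5) by blast
  have "nijenhuis A T X Y p = 0 \<longleftrightarrow> nijenhuis A T X Y p c = 0"
    using tangent_eqI[OF assms(4,5) nijenhuis_tangent[OF assms(1-3) p] subspace_0[OF subspace_tangent_space]]
    by auto
  then show ?thesis using nijenhuis_nij[OF assms] by simp
qed

text \<open>Chart images are open, so the derivatives see the fields over chart domains only. This
  serves to replace \<open>l_op\<close> by the real projector, with which it is identified over
  \<open>topspace M\<close>.\<close>

lemma nijenhuis_cong: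
  assumes "\<And>q. q \<in> topspace M \<Longrightarrow> X q = X' q" "\<And>q. q \<in> topspace M \<Longrightarrow> Y q = Y' q" "p \<in> topspace M"
  shows "nijenhuis A T X Y p = nijenhuis A T X' Y' p"
proof -
  have lb: "lie_bracket A X1 Y1 p = lie_bracket A X2 Y2 p"
    if X: "\<And>q. q \<in> topspace M \<Longrightarrow> X1 q = X2 q" and Y: "\<And>q. q \<in> topspace M \<Longrightarrow> Y1 q = Y2 q" for X1 X2 Y1 Y2
  proof -
    have fd: "frechet_derivative (vec_in_chart c Z1) (at (cmap c p)) = frechet_derivative (vec_in_chart c Z2) (at (cmap c p))"
      if "\<And>q. q \<in> topspace M \<Longrightarrow> Z1 q = Z2 q" "c \<in> A" "p \<in> cdom c" for c Z1 Z2
      by (rule frechet_derivative_cong_open[OF cimage_open[OF that(2)]])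
        (use that cinv_topspace in \<open>auto simp: vec_in_chart_def\<close>)
    show ?thesis
      unfolding lie_bracket_def
      by (rule ext) (simp add: fd[of X1 X2, OF X] fd[of Y1 Y2, OF Y] X[OF assms(3)] Y[OF assms(3)])
  qed
  have "lie_bracket A (\<lambda>q. T q (X q)) (\<lambda>q. T q (Y q)) p = lie_bracket A (\<lambda>q. T q (X' q)) (\<lambda>q. T q (Y' q)) p"
    "lie_bracket A (\<lambda>q. T q (X q)) Y p = lie_bracket A (\<lambda>q. T q (X' q)) Y' p"
    "lie_bracket A X (\<lambda>q. T q (Y q)) p = lie_bracket A X' (\<lambda>q. T q (Y' q)) p"
    "lie_bracket A X Y p = lie_bracket A X' Y' p"
    by (rule lb; simp add: assms)+
  then show ?thesis unfolding nijenhuis_def by simp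
qed

text \<open>A coordinate field is cut off by a bump function supported in a compact set
  \<open>K\<close> of the chart domain. \<open>K\<close> is closed since \<open>M\<close> is
  Hausdorff, so the extension by zero is smooth across the boundary of the domain.\<close>

lemma smooth_field_extension:
  assumes c: "c \<in> A" "p \<in> cdom c"
  obtains X where "smooth_vector_field M A X" "X p c = e"
proof -
  let ?x = "cmap c p"
  obtain r where r: "r > 0" "cball ?x r \<subseteq> cimage c"
    using cimage_open[OF c(1)] cmap_cimage[OF c(2)] open_contains_cball by blast
  obtain \<psi> :: "'e \<Rightarrow> real" where \<psi>: "smooth_on UNIV \<psi>" "\<psi> ?x = 1" "\<And>y. y \<notin> ball ?x r \<Longrightarrow> \<psi> y = 0"
    using smooth_bump[OF r(1)] by blast
  define K where "K = cinv c ` cball ?x r"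
  have "compactin (top_of_set (cimage c)) (cball ?x r)"
    using r(2) by (simp add: compactin_subtopology)
  then have "compactin M K"
    unfolding K_def by (rule image_compactin[OF _ cinv_continuous[OF c(1)]])
  then have K: "closedin M K" using Hausdorff by (rule compactin_imp_closedin[rotated])
  define X where "X q = (if q \<in> cdom c then \<psi> (cmap c q) *\<^sub>R coord_vec A c e q else 0)" for q
  have "smooth_vector_field M A X"
    unfolding smooth_vector_field_def
  proof (intro conjI ballI)
    show "X q \<in> tangent_space A q" for q
      unfolding X_def
      using subspace_scale[OF subspace_tangent_space coord_vec_tangent[OF c(1)]] subspace_0[OF subspace_tangent_space]
      by auto
    fix d assume d: "d \<in> A"
    show "smooth_on (cimage d) (vec_in_chart d X)"
    proof (rule smooth_on_open_cover)
      fix x assume x: "x \<in> cimage d"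
      show "\<exists>U. open U \<and> x \<in> U \<and> smooth_on U (vec_in_chart d X)"
      proof (cases "cinv d x \<in> cdom c")
        case True
        let ?U = "overlap d c"
        have U: "open ?U" "x \<in> ?U" using overlap_open[OF d c(1)] True x by (auto simp: overlap_def)
        have "smooth_on ?U (\<lambda>y. \<psi> (transition d c y) *\<^sub>R jac (transition c d) (transition d c y) e)"
        proof (rule smooth_on_bilinear[OF bounded_bilinear_scaleR U(1)])
          note t = transition_smooth[OF d c(1)]
          show "smooth_on ?U (\<lambda>y. \<psi> (transition d c y))"
            by (rule smooth_on_compose[OF U(1) \<psi>(1) t]) simp
          have "transition d c ` ?U \<subseteq> overlap c d"
            using c(1) d by (auto simp: overlap_def transition_def)
          then show "smooth_on ?U (\<lambda>y. jac (transition c d) (transition d c y) e)"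
            by (intro smooth_on_linear[OF blinfun.bounded_linear_left U(1)]
                smooth_on_compose[OF U(1) smooth_on_jac[OF overlap_open[OF c(1) d] transition_smooth[OF c(1) d]] t])
        qed
        then have "smooth_on ?U (vec_in_chart d X)"
          by (rule smooth_on_eq[OF U(1), rotated])
            (use c(1) d in \<open>auto simp: vec_in_chart_def X_def coord_vec_eq overlap_def transition_def\<close>)
        then show ?thesis using U by blast
      next
        case False
        \<comment> \<open>A point off the domain of \<open>c\<close> lies in the open complement of
          \<open>K\<close>, where the field vanishes identically.\<close>
        let ?U = "cmap d ` (cdom d \<inter> (topspace M - K))"
        have "K \<subseteq> cdom c" using r(2) by (auto simp: K_def)
        then have xU: "x \<in> ?U" unfolding cimage_Int[OF d] using False x cinv_topspace[OF d x] by auto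
        have U: "open ?U" using cmap_open_image[OF d] K by (simp add: closedin_def)
        have "vec_in_chart d X y = 0" if y: "y \<in> ?U" for y
        proof (cases "cinv d y \<in> cdom c")
          case True
          have "cinv c (cmap c (cinv d y)) = cinv d y" using c(1) True by simp
          then have "cmap c (cinv d y) \<notin> cball ?x r" using y unfolding cimage_Int[OF d] K_def by force
          then have "\<psi> (cmap c (cinv d y)) = 0" using \<psi>(3) ball_subset_cball by blast
          then show ?thesis by (simp add: vec_in_chart_def X_def)
        qed (simp add: vec_in_chart_def X_def)
        then have "smooth_on ?U (vec_in_chart d X)"
          using smooth_on_eq[OF U _ smooth_on_const[OF U, of 0]] by metis
        then show ?thesis using U xU by blast
      qed
    qed
  qed
  moreover have "X p c = e" using c \<psi>(2) by (simp add: X_def)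
  ultimately show thesis by (rule that)
qed

text \<open>Cut-off fields realise arbitrary values at a point, which turns the statement over
  global fields into a pointwise one. \<open>R\<close> will be the identity, \<open>F\<close> and
  the projector \<open>F G\<close>.\<close>

lemma nijenhuis_vanishes_iff:
  assumes T: "endo_diff T" and R: "endo_diff R"
  shows "(\<forall>X Y. smooth_vector_field M A X \<and> smooth_vector_field M A Y \<longrightarrow>
      (\<forall>p\<in>topspace M. nijenhuis A T (\<lambda>q. R q (X q)) (\<lambda>q. R q (Y q)) p = 0)) \<longleftrightarrow>
    (\<forall>c\<in>A. \<forall>x\<in>cimage c. \<forall>u v. nij (loc T c) x (loc R c x u) (loc R c x v) = 0)"
    (is "?L \<longleftrightarrow> ?R")
proof -
  have eR: "endo R" using R by (simp add: endo_diff_def)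
  have key: "nijenhuis A T (\<lambda>q. R q (X q)) (\<lambda>q. R q (Y q)) p = 0 \<longleftrightarrow>
      nij (loc T c) (cmap c p) (loc R c (cmap c p) (X p c)) (loc R c (cmap c p) (Y p c)) = 0"
    if X: "smooth_vector_field M A X" and Y: "smooth_vector_field M A Y" and c: "c \<in> A" "p \<in> cdom c" for X Y c p
  proof -
    have "X p \<in> tangent_space A p" "Y p \<in> tangent_space A p"
      using X Y cdom_topspace[OF c] unfolding smooth_vector_field_def by auto
    then show ?thesis
      using nijenhuis_eq_0_iff[OF T field_endo[OF R smooth_field[OF X]] field_endo[OF R smooth_field[OF Y]] c]
      by (simp add: loc_apply[OF eR c])
  qed
  show ?thesis
  proof
    assume L: ?L
    show ?R
    proof (intro ballI allI)
      fix c x u v assume c: "c \<in> A" and x: "x \<in> cimage c"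
      obtain X where X: "smooth_vector_field M A X" "X (cinv c x) c = u"
        using smooth_field_extension[OF c cinv_cdom[OF x]] by blast
      obtain Y where Y: "smooth_vector_field M A Y" "Y (cinv c x) c = v"
        using smooth_field_extension[OF c cinv_cdom[OF x]] by blast
      show "nij (loc T c) x (loc R c x u) (loc R c x v) = 0"
        using key[OF X(1) Y(1) c cinv_cdom[OF x]] L X Y cinv_topspace[OF c x] x by simp
    qed
  next
    assume R': ?R
    show ?L
    proof (intro allI impI ballI, elim conjE)
      fix X Y p assume X: "smooth_vector_field M A X" and Y: "smooth_vector_field M A Y" and p: "p \<in> topspace M"
      obtain c where c: "c \<in> A" "p \<in> cdom c" using covering[OF p] by blast
      show "nijenhuis A T (\<lambda>q. R q (X q)) (\<lambda>q. R q (Y q)) p = 0"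
        unfolding key[OF X Y c] using R' c by simp
    qed
  qed
qed

text \<open>Smoothness stated through operator-valued components, a form stable under composition
  and linear combination and hence convenient for polynomials in \<open>F\<close>.\<close>

definition smooth_endo :: "('m, 'e) endo_field \<Rightarrow> bool" where
  "smooth_endo T \<longleftrightarrow> endo T \<and> (\<forall>c\<in>A. smooth_on (cimage c) (loc T c))"

lemma smooth_endo_diff: "smooth_endo T \<Longrightarrow> endo_diff T"
  unfolding smooth_endo_def endo_diff_def differentiable_def using smooth_on_has_derivative by blast

lemma endo_0: "endo T \<Longrightarrow> p \<in> topspace M \<Longrightarrow> T p 0 = 0"
  using endoD(3)[OF _ _ subspace_0[OF subspace_tangent_space], of T p 0] by simp

lemma smooth_endo_id: "smooth_endo (\<lambda>p v. v)"
proof -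
  have e: "endo (\<lambda>p v. v)" by (simp add: endo_def)
  have "loc (\<lambda>p v. v) c x = id_blinfun" if "c \<in> A" "x \<in> cimage c" for c x
    by (rule blinfun_eqI) (simp add: loc_coord[OF e that] that)
  then have "smooth_on (cimage c) (loc (\<lambda>p v. v) c)" if "c \<in> A" for c
    using smooth_on_eq[OF cimage_open[OF that] _ smooth_on_const[OF cimage_open[OF that], of id_blinfun]] that
    by metis
  then show ?thesis using e by (simp add: smooth_endo_def)
qed

lemma smooth_endo_compose:
  assumes "smooth_endo T" "smooth_endo R"
  shows "smooth_endo (\<lambda>p v. T p (R p v))"
proof -
  have e: "endo T" "endo R" using assms by (auto simp: smooth_endo_def)
  have "smooth_on (cimage c) (loc (\<lambda>p v. T p (R p v)) c)" if c: "c \<in> A" for c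
  proof -
    have "smooth_on (cimage c) (\<lambda>x. loc T c x o\<^sub>L loc R c x)"
      using assms c unfolding smooth_endo_def
      by (intro smooth_on_bilinear[OF bounded_bilinear_blinfun_compose] cimage_open) auto
    then show ?thesis
      by (rule smooth_on_eq[OF cimage_open[OF c], rotated]) (simp add: loc_compose[OF e c])
  qed
  moreover have "endo (\<lambda>p v. T p (R p v))" using e unfolding endo_def by auto
  ultimately show ?thesis by (simp add: smooth_endo_def)
qed

lemma smooth_endo_funpow: "smooth_endo T \<Longrightarrow> smooth_endo (\<lambda>p. T p ^^ n)"
proof (induction n)
  case 0
  then show ?case using smooth_endo_id by (simp add: id_def)
next
  case (Suc n)
  then show ?case using smooth_endo_compose[of T "\<lambda>p. T p ^^ n"] by (simp add: comp_def)
qed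

lemma smooth_endo_combination:
  assumes "smooth_endo T" "smooth_endo R"
  shows "smooth_endo (\<lambda>p v. a *\<^sub>R T p v + b *\<^sub>R R p v)" (is "smooth_endo ?C")
proof -
  have e: "endo T" "endo R" using assms by (auto simp: smooth_endo_def)
  have C: "endo ?C"
    unfolding endo_def
    using endoD[OF e(1)] endoD[OF e(2)] subspace_add[OF subspace_tangent_space] subspace_scale[OF subspace_tangent_space]
    by (simp add: algebra_simps)
  have "smooth_on (cimage c) (loc ?C c)" if c: "c \<in> A" for c
  proof -
    have "smooth_on (cimage c) (\<lambda>x. a *\<^sub>R loc T c x + b *\<^sub>R loc R c x)"
      using assms c unfolding smooth_endo_def
      by (intro smooth_on_add smooth_on_linear[OF bounded_linear_scaleR_right] cimage_open) auto
    moreover have "a *\<^sub>R loc T c x + b *\<^sub>R loc R c x = loc ?C c x" if "x \<in> cimage c" for x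
      by (rule blinfun_eqI) (simp add: loc_coord c that e C blinfun.add_left blinfun.scaleR_left)
    ultimately show ?thesis by (rule smooth_on_eq[OF cimage_open[OF c], rotated])
  qed
  then show ?thesis using C by (simp add: smooth_endo_def)
qed

lemma integrable_tensor_iff:
  assumes "endo_diff T"
  shows "integrable_tensor M A T \<longleftrightarrow> (\<forall>c\<in>A. \<forall>x\<in>cimage c. \<forall>u v. nij (loc T c) x u v = 0)"
proof -
  have e: "endo (\<lambda>p v. v)" using smooth_endo_id by (simp add: smooth_endo_def)
  have "loc (\<lambda>p v. v) c x u = u" if "c \<in> A" "x \<in> cimage c" for c x u
    by (simp add: loc_coord[OF e that] that)
  then show ?thesis
    using nijenhuis_vanishes_iff[OF assms smooth_endo_diff[OF smooth_endo_id]]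
    unfolding integrable_tensor_def by simp
qed

end

subsection \<open>F-structures\<close>

lemma complexify_funpow: "(complexify F p ^^ n) w = ((F p ^^ n) (fst w), (F p ^^ n) (snd w))"
  by (induction n) (simp_all add: complexify_def)

locale F_mfd = smooth_mfd M A for M :: "'m topology" and A :: "('m, 'e::euclidean_space) chart set" +
  fixes F :: "('m, 'e) endo_field" and \<alpha> \<beta> :: complex and K r :: nat
  assumes K: "3 \<le> K" and F_struct: "F_structure M A F \<alpha> \<beta> K r"
begin

lemma F_smooth: "smooth_endo F"
  using F_struct tensor_field_endo tensor_field_loc_smooth unfolding F_structure_def smooth_endo_def by blast

lemma F_endo: "endo F"
  using F_smooth by (simp add: smooth_endo_def)

lemma funpow_endo: "endo (\<lambda>p. F p ^^ n)"
  using smooth_endo_funpow[OF F_smooth] by (simp add: smooth_endo_def)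

text \<open>The complex equation is tested on \<open>(v, 0)\<close>; its two components are the real
  and the imaginary part.\<close>

lemma F_equation:
  assumes "p \<in> topspace M" "v \<in> tangent_space A p"
  shows "Re \<alpha> *\<^sub>R (F p ^^ (K + 1)) v + Re \<beta> *\<^sub>R (F p ^^ K) v + F p v = 0"
    "Im \<alpha> *\<^sub>R (F p ^^ (K + 1)) v + Im \<beta> *\<^sub>R (F p ^^ K) v = 0"
proof -
  have "(v, 0) \<in> ctangent_space A p"
    using assms subspace_0[OF subspace_tangent_space] by (simp add: ctangent_space_def)
  then have "cscale \<alpha> ((complexify F p ^^ (K + 1)) (v, 0)) + cscale \<beta> ((complexify F p ^^ K) (v, 0))
      + complexify F p (v, 0) = 0"
    using F_struct assms(1) unfolding F_structure_def by blast
  moreover have "(F p ^^ n) 0 = 0" for n using endo_0[OF funpow_endo assms(1)] .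
  moreover have "F p 0 = 0" using endo_0[OF F_endo assms(1)] .
  ultimately show "Re \<alpha> *\<^sub>R (F p ^^ (K + 1)) v + Re \<beta> *\<^sub>R (F p ^^ K) v + F p v = 0"
    "Im \<alpha> *\<^sub>R (F p ^^ (K + 1)) v + Im \<beta> *\<^sub>R (F p ^^ K) v = 0"
    unfolding complexify_funpow by (simp_all add: cscale_def complexify_def zero_prod_def)
qed

text \<open>The real part of \<open>l\<close> with one factor \<open>F\<close> removed; the real
  part of the structure equation then reads \<open>F G F = F\<close>. As \<open>3 \<le> K\<close>,
  the subtractions in the exponents are not truncated.\<close>

definition G :: "('m, 'e) endo_field" where
  "G p v = (- Re \<alpha>) *\<^sub>R (F p ^^ (K - 1)) v + (- Re \<beta>) *\<^sub>R (F p ^^ (K - 2)) v"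

lemma G_smooth: "smooth_endo G"
proof -
  have G_eq: "G = (\<lambda>p v. (- Re \<alpha>) *\<^sub>R (F p ^^ (K - 1)) v + (- Re \<beta>) *\<^sub>R (F p ^^ (K - 2)) v)"
    by (simp add: G_def fun_eq_iff)
  show ?thesis
    unfolding G_eq by (rule smooth_endo_combination[OF smooth_endo_funpow[OF F_smooth] smooth_endo_funpow[OF F_smooth]])
qed

lemma G_endo: "endo G"
  using G_smooth by (simp add: smooth_endo_def)

lemma F_combination:
  assumes "p \<in> topspace M" "v \<in> tangent_space A p"
  shows "F p (a *\<^sub>R (F p ^^ m) v + b *\<^sub>R (F p ^^ n) v) = a *\<^sub>R (F p ^^ Suc m) v + b *\<^sub>R (F p ^^ Suc n) v"
proof -
  have t: "(F p ^^ k) v \<in> tangent_space A p" for k by (rule endoD(1)[OF funpow_endo assms])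
  show ?thesis
    by (subst endoD(2)[OF F_endo assms(1) subspace_scale[OF subspace_tangent_space t]
          subspace_scale[OF subspace_tangent_space t]])
      (simp only: endoD(3)[OF F_endo assms(1) t] funpow.simps comp_apply)
qed

lemma F_G:
  assumes "p \<in> topspace M" "v \<in> tangent_space A p"
  shows "F p (G p v) = (- Re \<alpha>) *\<^sub>R (F p ^^ K) v + (- Re \<beta>) *\<^sub>R (F p ^^ (K - 1)) v"
    "G p (F p v) = F p (G p v)" "F p (G p (F p v)) = F p v"
proof -
  have K': "Suc (K - 1) = K" "Suc (K - 2) = K - 1" using K by auto
  show 1: "F p (G p v) = (- Re \<alpha>) *\<^sub>R (F p ^^ K) v + (- Re \<beta>) *\<^sub>R (F p ^^ (K - 1)) v"
    unfolding G_def F_combination[OF assms] K' ..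
  have sw: "(F p ^^ n) (F p v) = (F p ^^ Suc n) v" for n by (simp add: funpow_swap1)
  show 2: "G p (F p v) = F p (G p v)"
    unfolding 1 unfolding G_def sw K' ..
  have "F p (G p (F p v)) = (- Re \<alpha>) *\<^sub>R (F p ^^ (K + 1)) v + (- Re \<beta>) *\<^sub>R (F p ^^ K) v"
    unfolding 2 1 F_combination[OF assms] K' by simp
  also have "\<dots> = F p v"
    using F_equation(1)[OF assms, folded eq_neg_iff_add_eq_0]
    by (simp only: scaleR_minus_left minus_add_distrib[symmetric] minus_minus)
  finally show "F p (G p (F p v)) = F p v" .
qed

text \<open>On \<open>Im F\<close> the map \<open>F\<close> is injective, so the imaginary part of \<open>l\<close>, which is a multiple of \<open>F\<close>
  annihilated by \<open>F\<close>, vanishes; hence \<open>l\<close> is the real projector \<open>F G\<close> onto \<open>Im F\<close>.\<close>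

lemma l_imaginary_part:
  assumes p: "p \<in> topspace M" and v: "v \<in> tangent_space A p"
  shows "Im \<alpha> *\<^sub>R (F p ^^ K) v + Im \<beta> *\<^sub>R (F p ^^ (K - 1)) v = 0"
proof -
  have K': "Suc (K - 1) = K" "Suc (K - 2) = K - 1" using K by auto
  \<comment> \<open>Up to sign, the imaginary part of \<open>l\<close> with one factor
    \<open>F\<close> removed. The imaginary equation gives \<open>F p (F p w) = 0\<close>, and
    \<open>G\<close> after \<open>F\<close> is the identity on the image of \<open>F\<close>, so
    \<open>F p w = 0\<close>.\<close>
  define w where "w = Im \<alpha> *\<^sub>R (F p ^^ (K - 1)) v + Im \<beta> *\<^sub>R (F p ^^ (K - 2)) v"
  have w: "w \<in> tangent_space A p"
    unfolding w_def using endoD(1)[OF funpow_endo p v]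
    by (intro subspace_add[OF subspace_tangent_space] subspace_scale[OF subspace_tangent_space]) auto
  have Fw: "F p w = Im \<alpha> *\<^sub>R (F p ^^ K) v + Im \<beta> *\<^sub>R (F p ^^ (K - 1)) v"
    unfolding w_def F_combination[OF p v] K' ..
  have "F p (F p w) = 0"
    unfolding Fw F_combination[OF p v] K' using F_equation(2)[OF p v] by simp
  then have "G p (F p (F p w)) = 0" using endo_0[OF G_endo p] by simp
  moreover have "G p (F p (F p w)) = F p w"
    using F_G(2,3)[OF p] w endoD(1)[OF F_endo p] by metis
  ultimately show ?thesis using Fw by simp
qed

lemma l_op_eq:
  assumes p: "p \<in> topspace M" and "u \<in> tangent_space A p" "v \<in> tangent_space A p"
  shows "l_op F \<alpha> \<beta> K p (u, v) = (F p (G p u), F p (G p v))"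
proof -
  have "Im \<alpha> *\<^sub>R (F p ^^ K) w = - (Im \<beta> *\<^sub>R (F p ^^ (K - 1)) w)" if "w \<in> tangent_space A p" for w
    using l_imaginary_part[OF p that] by (simp add: add_eq_0_iff2)
  then show ?thesis
    unfolding l_op_def complexify_funpow using assms by (simp add: cscale_def F_G(1))
qed

lemma D_l_eq:
  assumes p: "p \<in> topspace M"
  shows "D_l A F \<alpha> \<beta> K p = F p ` tangent_space A p"
proof (intro equalityI subsetI)
  fix v assume "v \<in> D_l A F \<alpha> \<beta> K p"
  then obtain u w where uw: "u \<in> tangent_space A p" "w \<in> tangent_space A p" "(v, 0) = l_op F \<alpha> \<beta> K p (u, w)"
    unfolding D_l_def ctangent_space_def by auto
  then show "v \<in> F p ` tangent_space A p"
    using endoD(1)[OF G_endo p] by (simp add: l_op_eq[OF p])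
next
  fix v assume "v \<in> F p ` tangent_space A p"
  then obtain u where u: "u \<in> tangent_space A p" "v = F p u" by blast
  have v: "v \<in> tangent_space A p" using u endoD(1)[OF F_endo p] by simp
  have 0: "0 \<in> tangent_space A p" by (rule subspace_0[OF subspace_tangent_space])
  have "l_op F \<alpha> \<beta> K p (v, 0) = (v, 0)"
    using l_op_eq[OF p v 0] F_G(3)[OF p u(1)] endo_0[OF F_endo p] endo_0[OF G_endo p] u by simp
  then show "v \<in> D_l A F \<alpha> \<beta> K p"
    unfolding D_l_def ctangent_space_def using v 0 by force
qed

text \<open>A tangent vector is determined by its component in \<open>c\<close>, so membership can
  be tested there; in this form \<open>D_l\<close> is compared with ranges of derivatives.\<close>

lemma D_l_iff:
  assumes "c \<in> A" "p \<in> cdom c"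
  shows "v \<in> D_l A F \<alpha> \<beta> K p \<longleftrightarrow> v \<in> tangent_space A p \<and> v c \<in> range (loc F c (cmap c p))"
proof -
  note p = cdom_topspace[OF assms]
  show ?thesis
  proof
    assume "v \<in> D_l A F \<alpha> \<beta> K p"
    then show "v \<in> tangent_space A p \<and> v c \<in> range (loc F c (cmap c p))"
      unfolding D_l_eq[OF p] using endoD(1)[OF F_endo p] loc_apply[OF F_endo assms] by auto
  next
    assume v: "v \<in> tangent_space A p \<and> v c \<in> range (loc F c (cmap c p))"
    then obtain e where e: "v c = loc F c (cmap c p) e" by blast
    let ?u = "coord_vec A c e p"
    have u: "?u \<in> tangent_space A p" by (rule coord_vec_tangent[OF assms])
    have "F p ?u c = v c" using loc_apply[OF F_endo assms u] e assms by simp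
    then have "v = F p ?u" using tangent_eqI[OF assms] v endoD(1)[OF F_endo p u] by metis
    then show "v \<in> D_l A F \<alpha> \<beta> K p" unfolding D_l_eq[OF p] using u by blast
  qed
qed

lemma loc_F_G:
  assumes "c \<in> A" "x \<in> cimage c"
  shows "loc F c x o\<^sub>L loc G c x = loc G c x o\<^sub>L loc F c x"
    "loc F c x o\<^sub>L (loc G c x o\<^sub>L loc F c x) = loc F c x"
proof -
  note p = cinv_topspace[OF assms] and t = coord_vec_tangent[OF assms(1) cinv_cdom[OF assms(2)]]
  have e: "endo (\<lambda>p v. G p (F p v))" "endo (\<lambda>p v. F p (G p v))" "endo (\<lambda>p v. F p (G p (F p v)))"
    using smooth_endo_compose[OF G_smooth F_smooth] smooth_endo_compose[OF F_smooth G_smooth]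
      smooth_endo_compose[OF F_smooth smooth_endo_compose[OF G_smooth F_smooth]]
    unfolding smooth_endo_def by simp_all
  show "loc F c x o\<^sub>L loc G c x = loc G c x o\<^sub>L loc F c x"
    unfolding loc_compose[OF F_endo G_endo assms, symmetric] loc_compose[OF G_endo F_endo assms, symmetric]
    by (rule blinfun_eqI) (simp add: loc_coord[OF e(1) assms] loc_coord[OF e(2) assms] F_G(2)[OF p t])
  show "loc F c x o\<^sub>L (loc G c x o\<^sub>L loc F c x) = loc F c x"
    unfolding loc_compose[OF G_endo F_endo assms, symmetric] loc_compose[OF F_endo e(1) assms, symmetric]
    by (rule blinfun_eqI) (simp add: loc_coord[OF e(3) assms] loc_coord[OF F_endo assms] F_G(3)[OF p t])
qed

lemma loc_F_rank:
  assumes "c \<in> A" "x \<in> cimage c"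
  shows "dim (range (loc F c x)) = r"
proof -
  let ?p = "cinv c x"
  note p = cinv_topspace[OF assms] and pc = cinv_cdom[OF assms(2)]
  have x: "cmap c ?p = x" using assms by simp
  let ?E = "\<lambda>e. coord_vec A c e ?p"
  have lin: "linear ?E" by (rule coord_vec_linear[OF assms(1) pc])
  have inj: "inj ?E" by (rule injI) (metis coord_vec_self assms(1) pc)
  have "F ?p ` tangent_space A ?p = ?E ` range (loc F c x)"
  proof (intro equalityI subsetI)
    fix v assume "v \<in> F ?p ` tangent_space A ?p"
    then have "v \<in> tangent_space A ?p" "v c \<in> range (loc F c x)"
      using D_l_iff[OF assms(1) pc] D_l_eq[OF p] x by auto
    then show "v \<in> ?E ` range (loc F c x)" using tangent_coord_vec[OF assms(1) pc] by (metis imageI)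
  next
    fix v assume "v \<in> ?E ` range (loc F c x)"
    then show "v \<in> F ?p ` tangent_space A ?p"
      using D_l_iff[OF assms(1) pc] D_l_eq[OF p] x coord_vec_tangent[OF assms(1) pc] assms(1) pc by auto
  qed
  moreover have "dim (F ?p ` tangent_space A ?p) = r"
    using F_struct p unfolding F_structure_def by blast
  \<comment> \<open>The image lies in a space of families indexed by charts, so invariance of the
    dimension under \<open>?E\<close> is checked on a basis.\<close>
  moreover have "dim (?E ` V) = dim V" for V :: "'e set"
  proof -
    obtain B where B: "B \<subseteq> V" "independent B" "V \<subseteq> span B" "card B = dim V"
      using basis_exists by blast
    have "independent (?E ` B)"
      by (rule linear_independent_injective_image[OF lin B(2)]) (use inj in \<open>auto intro: inj_on_subset\<close>)
    moreover have "?E ` V \<subseteq> span (?E ` B)"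
      using B(3) linear_span_image[OF lin] by blast
    moreover have "card (?E ` B) = dim V" using B(4) inj by (simp add: card_image inj_on_subset)
    ultimately show ?thesis using B(1) by (intro dim_unique[of "?E ` B"]) auto
  qed
  ultimately show ?thesis by simp
qed

definition N_image :: bool where
  "N_image \<longleftrightarrow> (\<forall>c\<in>A. \<forall>x\<in>cimage c. \<forall>u v. nij (loc F c) x (loc F c x u) (loc F c x v) = 0)"

lemma N_F_iff:
  "(\<forall>X Y. smooth_vector_field M A X \<and> smooth_vector_field M A Y \<longrightarrow>
      (\<forall>p\<in>topspace M. nijenhuis A F (\<lambda>q. F q (X q)) (\<lambda>q. F q (Y q)) p = 0)) \<longleftrightarrow> N_image"
  unfolding N_image_def
  using nijenhuis_vanishes_iff[OF smooth_endo_diff[OF F_smooth] smooth_endo_diff[OF F_smooth]] .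

text \<open>\<open>nij\<close> is linear in each argument. Since \<open>l\<close> maps real fields
  to real fields, three of the four terms of \<open>cnijenhuis\<close> are of this kind.\<close>

lemma nijenhuis_zero:
  assumes "field X" "p \<in> topspace M"
  shows "nijenhuis A F X (\<lambda>q. 0) p = 0" "nijenhuis A F (\<lambda>q. 0) X p = 0"
proof -
  have z: "field (\<lambda>q. 0)"
    unfolding field_def vec_in_chart_def using subspace_0[OF subspace_tangent_space] by simp
  obtain c where c: "c \<in> A" "p \<in> cdom c" using covering[OF assms(2)] by blast
  note F = smooth_endo_diff[OF F_smooth]
  have lin: "linear (frechet_derivative (loc F c) (at (cmap c p)))"
    using F_smooth c smooth_on_has_derivative has_derivative_linear cmap_cimage unfolding smooth_endo_def by metis
  show "nijenhuis A F X (\<lambda>q. 0) p = 0" "nijenhuis A F (\<lambda>q. 0) X p = 0"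
    unfolding nijenhuis_eq_0_iff[OF F assms(1) z c] nijenhuis_eq_0_iff[OF F z assms(1) c]
    by (simp_all add: nij_def Let_def blinfun.zero_right blinfun.zero_left linear_0[OF lin])
qed

lemma N_l_iff:
  "(\<forall>X Y. smooth_vector_field M A X \<and> smooth_vector_field M A Y \<longrightarrow>
      (\<forall>p\<in>topspace M. cnijenhuis A F (\<lambda>q. l_op F \<alpha> \<beta> K q (X q, 0)) (\<lambda>q. l_op F \<alpha> \<beta> K q (Y q, 0)) p = 0)) \<longleftrightarrow>
   N_image"
proof -
  let ?P = "\<lambda>p v. F p (G p v)"
  have P: "endo_diff ?P" by (rule smooth_endo_diff[OF smooth_endo_compose[OF F_smooth G_smooth]])
  have key: "cnijenhuis A F (\<lambda>q. l_op F \<alpha> \<beta> K q (X q, 0)) (\<lambda>q. l_op F \<alpha> \<beta> K q (Y q, 0)) p =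
      (nijenhuis A F (\<lambda>q. ?P q (X q)) (\<lambda>q. ?P q (Y q)) p, 0)"
    if X: "smooth_vector_field M A X" and Y: "smooth_vector_field M A Y" and p: "p \<in> topspace M" for X Y p
  proof -
    have l: "fst (l_op F \<alpha> \<beta> K q (Z q, 0)) = ?P q (Z q)" "snd (l_op F \<alpha> \<beta> K q (Z q, 0)) = 0"
      if "smooth_vector_field M A Z" "q \<in> topspace M" for Z q
    proof -
      have "Z q \<in> tangent_space A q" using that unfolding smooth_vector_field_def by blast
      from l_op_eq[OF that(2) this subspace_0[OF subspace_tangent_space]]
      show "fst (l_op F \<alpha> \<beta> K q (Z q, 0)) = ?P q (Z q)" "snd (l_op F \<alpha> \<beta> K q (Z q, 0)) = 0"
        using endo_0[OF F_endo that(2)] endo_0[OF G_endo that(2)] by auto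
    qed
    note PX = field_endo[OF P smooth_field[OF X]] and PY = field_endo[OF P smooth_field[OF Y]]
    have z: "field (\<lambda>q. 0)"
      unfolding field_def vec_in_chart_def using subspace_0[OF subspace_tangent_space] by simp
    have "nijenhuis A F (\<lambda>q. fst (l_op F \<alpha> \<beta> K q (X q, 0))) (\<lambda>q. fst (l_op F \<alpha> \<beta> K q (Y q, 0))) p =
        nijenhuis A F (\<lambda>q. ?P q (X q)) (\<lambda>q. ?P q (Y q)) p"
      by (rule nijenhuis_cong[OF l(1)[OF X] l(1)[OF Y] p])
    moreover have "nijenhuis A F (\<lambda>q. snd (l_op F \<alpha> \<beta> K q (X q, 0))) (\<lambda>q. snd (l_op F \<alpha> \<beta> K q (Y q, 0))) p = 0"
      using nijenhuis_cong[OF l(2)[OF X] l(2)[OF Y] p] nijenhuis_zero[OF z p] by simp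
    moreover have "nijenhuis A F (\<lambda>q. fst (l_op F \<alpha> \<beta> K q (X q, 0))) (\<lambda>q. snd (l_op F \<alpha> \<beta> K q (Y q, 0))) p = 0"
      using nijenhuis_cong[OF l(1)[OF X] l(2)[OF Y] p] nijenhuis_zero[OF PX p] by simp
    moreover have "nijenhuis A F (\<lambda>q. snd (l_op F \<alpha> \<beta> K q (X q, 0))) (\<lambda>q. fst (l_op F \<alpha> \<beta> K q (Y q, 0))) p = 0"
      using nijenhuis_cong[OF l(2)[OF X] l(1)[OF Y] p] nijenhuis_zero[OF PY p] by simp
    ultimately show ?thesis by (simp add: cnijenhuis_def)
  qed
  have "(\<forall>c\<in>A. \<forall>x\<in>cimage c. \<forall>u v. nij (loc F c) x (loc ?P c x u) (loc ?P c x v) = 0) \<longleftrightarrow> N_image"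
  proof -
    have "(\<forall>u v. nij (loc F c) x (loc ?P c x u) (loc ?P c x v) = 0) \<longleftrightarrow>
        (\<forall>u v. nij (loc F c) x (loc F c x u) (loc F c x v) = 0)" if c: "c \<in> A" "x \<in> cimage c" for c x
    proof -
      have P: "loc ?P c x w = loc F c x (loc G c x w)" for w
        by (simp add: loc_compose[OF F_endo G_endo c])
      \<comment> \<open>\<open>F G F = F\<close> makes every value of \<open>F\<close> a value of
        the projector, so both range over the same vectors.\<close>
      have F: "loc F c x w = loc ?P c x (loc F c x w)" for w
        unfolding P using arg_cong[OF loc_F_G(2)[OF c], of "\<lambda>B. B w"] by simp
      show ?thesis
      proof (intro iffI allI)
        fix u v assume "\<forall>u v. nij (loc F c) x (loc ?P c x u) (loc ?P c x v) = 0"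
        then have "nij (loc F c) x (loc ?P c x (loc F c x u)) (loc ?P c x (loc F c x v)) = 0" by blast
        then show "nij (loc F c) x (loc F c x u) (loc F c x v) = 0" by (simp only: F[symmetric])
      next
        fix u v assume "\<forall>u v. nij (loc F c) x (loc F c x u) (loc F c x v) = 0"
        then show "nij (loc F c) x (loc ?P c x u) (loc ?P c x v) = 0" unfolding P by blast
      qed
    qed
    then show ?thesis unfolding N_image_def by blast
  qed
  then show ?thesis
    unfolding nijenhuis_vanishes_iff[OF smooth_endo_diff[OF F_smooth] P, symmetric]
    using key by (simp add: zero_prod_def)
qed

end

subsection \<open>Integral manifolds\<close>

text \<open>Used to exchange the derivative of an embedding for \<open>loc F c\<close>: the two have
  different sources but the same range.\<close>

lemma all_range_cong:
  assumes "range f = range g"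
  shows "(\<forall>u v. P (f u) (f v)) \<longleftrightarrow> (\<forall>u v. P (g u) (g v))"
proof -
  have "(\<forall>u v. P (h u) (h v)) \<longleftrightarrow> (\<forall>x\<in>range h. \<forall>y\<in>range h. P x y)" for h by simp
  then show ?thesis using assms by (metis (no_types, lifting))
qed

section \<open>Immersed manifolds and the differential of the inclusion\<close>

locale immersed = smooth_mfd M A + S: smooth_mfd S B
  for M :: "'m topology" and A :: "('m, 'e::euclidean_space) chart set"
    and S :: "'m topology" and B :: "('m, 'd::euclidean_space) chart set" +
  assumes sub: "topspace S \<subseteq> topspace M" and incl_smooth: "smooth_map S B M A (\<lambda>p. p)"
begin

definition emb :: "('m, 'd) chart \<Rightarrow> ('m, 'e) chart \<Rightarrow> 'd \<Rightarrow> 'e" where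
  "emb b c y = cmap c (cinv b y)"

definition edom :: "('m, 'd) chart \<Rightarrow> ('m, 'e) chart \<Rightarrow> 'd set" where
  "edom b c = {y \<in> cimage b. cinv b y \<in> cdom c}"

abbreviation dincl :: "'m \<Rightarrow> ('m, 'd) tvec \<Rightarrow> ('m, 'e) tvec" where
  "dincl \<equiv> differential B A (\<lambda>p. p)"

lemma edom_open:
  assumes "b \<in> B" "c \<in> A"
  shows "open (edom b c)"
proof -
  have "openin S {q \<in> topspace S. q \<in> cdom c}"
    using incl_smooth cdom_openin[OF assms(2)] unfolding smooth_map_def by (intro openin_continuous_map_preimage) auto
  then have "open (cmap b ` (cdom b \<inter> {q \<in> topspace S. q \<in> cdom c}))" by (rule S.cmap_open_image[OF assms(1)])
  moreover have "cmap b ` (cdom b \<inter> {q \<in> topspace S. q \<in> cdom c}) = edom b c"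
    unfolding S.cimage_Int[OF assms(1)] edom_def using S.cinv_topspace[OF assms(1)] by auto
  ultimately show ?thesis by simp
qed

lemma emb_smooth:
  assumes "b \<in> B" "c \<in> A"
  shows "smooth_on (edom b c) (emb b c)"
proof -
  have "cmap b ` (cdom b \<inter> (\<lambda>p. p) -` cdom c) = edom b c"
    unfolding S.cimage_Int[OF assms(1)] edom_def by auto
  moreover have "cmap c \<circ> (\<lambda>p. p) \<circ> cinv b = emb b c" by (simp add: emb_def fun_eq_iff)
  ultimately show ?thesis using incl_smooth assms unfolding smooth_map_def by metis
qed

lemma emb_mem:
  assumes "c \<in> A" "y \<in> edom b c"
  shows "emb b c y \<in> cimage c" "cinv c (emb b c y) = cinv b y"
  using assms by (auto simp: edom_def emb_def)

lemma cmap_edom: "b \<in> B \<Longrightarrow> p \<in> cdom b \<Longrightarrow> p \<in> cdom c \<Longrightarrow> cmap b p \<in> edom b c"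
  by (simp add: edom_def)

lemma emb_cmap: "b \<in> B \<Longrightarrow> p \<in> cdom b \<Longrightarrow> emb b c (cmap b p) = cmap c p"
  by (simp add: emb_def)

lemma emb_derivative:
  assumes "b \<in> B" "c \<in> A" "p \<in> cdom b" "p \<in> cdom c"
  shows "(emb b c has_derivative jac (emb b c) (cmap b p)) (at (cmap b p))"
    "blinfun_apply (jac (emb b c) (cmap b p)) = frechet_derivative (emb b c) (at (cmap b p))"
  using jac_has_derivative[OF emb_smooth[OF assms(1,2)] cmap_edom[OF assms(1,3,4)]] by auto

lemma emb_chain_source:
  assumes b: "b \<in> B" "p \<in> cdom b" and b': "b' \<in> B" "p \<in> cdom b'" and c: "c \<in> A" "p \<in> cdom c"
  shows "jac (emb b' c) (cmap b' p) (jac (S.transition b b') (cmap b p) v) = jac (emb b c) (cmap b p) v"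
proof -
  have "S.transition b b' (cmap b p) = cmap b' p" using b by (simp add: S.transition_def)
  then have "((\<lambda>y. emb b' c (S.transition b b' y)) has_derivative
      (\<lambda>v. jac (emb b' c) (cmap b' p) (jac (S.transition b b') (cmap b p) v))) (at (cmap b p))"
    using has_derivative_compose[OF S.transition_derivative(1)[OF b(1) b'(1) b(2) b'(2)]]
      emb_derivative(1)[OF b'(1) c(1) b'(2) c(2)] by simp
  then have "(emb b c has_derivative
      (\<lambda>v. jac (emb b' c) (cmap b' p) (jac (S.transition b b') (cmap b p) v))) (at (cmap b p))"
    by (rule has_derivative_transform_within_open[OF _ S.overlap_open[OF b(1) b'(1)] S.cmap_overlap[OF b b'(2)]])
      (use b' in \<open>auto simp: S.overlap_def S.transition_def emb_def\<close>)
  from fun_cong[OF has_derivative_unique[OF this emb_derivative(1)[OF b(1) c(1) b(2) c(2)]]]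
  show ?thesis by simp
qed

lemma emb_chain_target:
  assumes b: "b \<in> B" "p \<in> cdom b" and c: "c \<in> A" "p \<in> cdom c" and d: "d \<in> A" "p \<in> cdom d"
  shows "jac (transition c d) (cmap c p) (jac (emb b c) (cmap b p) v) = jac (emb b d) (cmap b p) v"
proof -
  have "((\<lambda>y. transition c d (emb b c y)) has_derivative
      (\<lambda>v. jac (transition c d) (cmap c p) (jac (emb b c) (cmap b p) v))) (at (cmap b p))"
    using has_derivative_compose[OF emb_derivative(1)[OF b(1) c(1) b(2) c(2)]]
      transition_derivative(1)[OF c(1) d(1) c(2) d(2)] emb_cmap[OF b] by simp
  then have "(emb b d has_derivative
      (\<lambda>v. jac (transition c d) (cmap c p) (jac (emb b c) (cmap b p) v))) (at (cmap b p))"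
    by (rule has_derivative_transform_within_open[OF _ edom_open[OF b(1) c(1)] cmap_edom[OF b c(2)]])
      (use c in \<open>auto simp: edom_def transition_def emb_def\<close>)
  from fun_cong[OF has_derivative_unique[OF this emb_derivative(1)[OF b(1) d(1) b(2) d(2)]]]
  show ?thesis by simp
qed

text \<open>\<open>differential\<close> uses a chart picked by choice;
  \<open>emb_chain_source\<close> passes from that chart to the given \<open>b\<close>.\<close>

lemma dincl_chart:
  assumes b: "b \<in> B" "p \<in> cdom b" and c: "c \<in> A" "p \<in> cdom c" and u: "u \<in> tangent_space B p"
  shows "dincl p u c = jac (emb b c) (cmap b p) (u b)"
proof -
  define b' where "b' = (SOME b. b \<in> B \<and> p \<in> cdom b)"
  have b': "b' \<in> B" "p \<in> cdom b'"
    using someI[of "\<lambda>b. b \<in> B \<and> p \<in> cdom b" b] b unfolding b'_def by auto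
  have "cmap c \<circ> (\<lambda>p. p) \<circ> cinv b' = emb b' c" by (simp add: emb_def fun_eq_iff)
  then have "dincl p u c = jac (emb b' c) (cmap b' p) (u b')"
    using c emb_derivative(2)[OF b'(1) c(1) b'(2) c(2)]
    by (simp add: differential_def b'_def[symmetric] Let_def)
  also have "u b' = jac (S.transition b b') (cmap b p) (u b)"
    using u b b' unfolding S.tangent_space_iff by blast
  finally show ?thesis using emb_chain_source[OF b b' c] by simp
qed

lemma dincl_tangent:
  assumes "u \<in> tangent_space B p" "p \<in> topspace S"
  shows "dincl p u \<in> tangent_space A p"
proof -
  obtain b where b: "b \<in> B" "p \<in> cdom b" using S.covering[OF assms(2)] by blast
  have "dincl p u c = 0" if "\<not> (c \<in> A \<and> p \<in> cdom c)" for c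
    using that by (auto simp: differential_def Let_def)
  moreover have "dincl p u d = jac (transition c d) (cmap c p) (dincl p u c)"
    if "c \<in> A" "d \<in> A" "p \<in> cdom c" "p \<in> cdom d" for c d
    using that emb_chain_target[OF b] by (simp add: dincl_chart[OF b _ _ assms(1)])
  ultimately show ?thesis unfolding tangent_space_iff by blast
qed

lemma dincl_add:
  assumes "u \<in> tangent_space B p" "v \<in> tangent_space B p" "p \<in> topspace S"
  shows "dincl p (u + v) = dincl p u + dincl p v"
proof -
  obtain b where b: "b \<in> B" "p \<in> cdom b" using S.covering[OF assms(3)] by blast
  obtain c where c: "c \<in> A" "p \<in> cdom c" using covering assms(3) sub by blast
  note uv = subspace_add[OF S.subspace_tangent_space assms(1,2)]
  show ?thesis
    by (rule tangent_eqI[OF c dincl_tangent[OF uv assms(3)]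
          subspace_add[OF subspace_tangent_space dincl_tangent[OF assms(1,3)] dincl_tangent[OF assms(2,3)]]])
      (simp add: dincl_chart[OF b c] uv assms blinfun.add_right)
qed

lemma dincl_scale:
  assumes "u \<in> tangent_space B p" "p \<in> topspace S"
  shows "dincl p (a *\<^sub>R u) = a *\<^sub>R dincl p u"
proof -
  obtain b where b: "b \<in> B" "p \<in> cdom b" using S.covering[OF assms(2)] by blast
  obtain c where c: "c \<in> A" "p \<in> cdom c" using covering assms(2) sub by blast
  note au = subspace_scale[OF S.subspace_tangent_space assms(1)]
  show ?thesis
    by (rule tangent_eqI[OF c dincl_tangent[OF au assms(2)]
          subspace_scale[OF subspace_tangent_space dincl_tangent[OF assms]]])
      (simp add: dincl_chart[OF b c] au assms blinfun.scaleR_right)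
qed

lemma dincl_coord:
  assumes "b \<in> B" "p \<in> cdom b" "c \<in> A" "p \<in> cdom c"
  shows "dincl p (coord_vec B b e p) = coord_vec A c (jac (emb b c) (cmap b p) e) p"
  using S.coord_vec_tangent[OF assms(1,2)] S.coord_vec_self[OF assms(1,2)] coord_vec_tangent[OF assms(3,4)]
  by (intro tangent_eqI[OF assms(3,4)] dincl_tangent S.cdom_topspace[OF assms(1,2)])
    (simp_all add: dincl_chart[OF assms] assms)

end

section \<open>The structure induced on an integral manifold\<close>

locale F_integral_mfd = F_mfd M A F \<alpha> \<beta> K r + immersed M A S B
  for M :: "'m topology" and A :: "('m, 'e::euclidean_space) chart set" and F :: "('m, 'e) endo_field"
    and \<alpha> \<beta> :: complex and K r :: nat
    and S :: "'m topology" and B :: "('m, 'd::euclidean_space) chart set" +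
  assumes dincl_inj: "\<And>p. p \<in> topspace S \<Longrightarrow> inj_on (dincl p) (tangent_space B p)"
    and dincl_image: "\<And>p. p \<in> topspace S \<Longrightarrow> dincl p ` tangent_space B p = D_l A F \<alpha> \<beta> K p"
begin

abbreviation "F_ind \<equiv> induced_tensor A B F"

text \<open>\<open>F\<close> maps tangent vectors into \<open>D_l\<close>, which is the image of the
  differential of the inclusion; hence the preimage selected by \<open>inv_into\<close>
  exists.\<close>

lemma F_ind_tangent:
  assumes p: "p \<in> topspace S" and u: "u \<in> tangent_space B p"
  shows "F_ind p u \<in> tangent_space B p" "dincl p (F_ind p u) = F p (dincl p u)"
proof -
  have F: "F p (dincl p u) \<in> dincl p ` tangent_space B p"
    unfolding dincl_image[OF p] using D_l_eq p sub dincl_tangent[OF u p] by blast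
  show "F_ind p u \<in> tangent_space B p" "dincl p (F_ind p u) = F p (dincl p u)"
    unfolding induced_tensor_def using inv_into_into[OF F] f_inv_into_f[OF F] by blast+
qed

text \<open>Linearity holds after applying the differential of the inclusion, whose injectivity
  pulls it back.\<close>

lemma F_ind_endo: "S.endo F_ind"
  unfolding S.endo_def
proof (intro ballI conjI allI)
  fix p u assume p: "p \<in> topspace S" and u: "u \<in> tangent_space B p"
  have pM: "p \<in> topspace M" using p sub by blast
  note t = F_ind_tangent[OF p]
  show "F_ind p u \<in> tangent_space B p" by (rule t(1)[OF u])
  show "F_ind p (u + v) = F_ind p u + F_ind p v" if v: "v \<in> tangent_space B p" for v
  proof (rule inj_onD[OF dincl_inj[OF p]])
    note uv = subspace_add[OF S.subspace_tangent_space u v]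
    show "dincl p (F_ind p (u + v)) = dincl p (F_ind p u + F_ind p v)"
      by (simp add: t uv u v dincl_add[OF _ _ p] endoD(2)[OF F_endo pM] dincl_tangent[OF _ p])
    show "F_ind p (u + v) \<in> tangent_space B p" by (rule t(1)[OF uv])
    show "F_ind p u + F_ind p v \<in> tangent_space B p"
      by (rule subspace_add[OF S.subspace_tangent_space t(1)[OF u] t(1)[OF v]])
  qed
  show "F_ind p (a *\<^sub>R u) = a *\<^sub>R F_ind p u" for a
  proof (rule inj_onD[OF dincl_inj[OF p]])
    note au = subspace_scale[OF S.subspace_tangent_space u, of a]
    show "dincl p (F_ind p (a *\<^sub>R u)) = dincl p (a *\<^sub>R F_ind p u)"
      by (simp add: t au u dincl_scale[OF _ p] endoD(3)[OF F_endo pM] dincl_tangent[OF _ p])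
    show "F_ind p (a *\<^sub>R u) \<in> tangent_space B p" by (rule t(1)[OF au])
    show "a *\<^sub>R F_ind p u \<in> tangent_space B p"
      by (rule subspace_scale[OF S.subspace_tangent_space t(1)[OF u]])
  qed
qed

lemma jac_emb_inj:
  assumes "b \<in> B" "p \<in> cdom b" "c \<in> A" "p \<in> cdom c"
  shows "inj (jac (emb b c) (cmap b p))"
proof (rule injI)
  fix e1 e2 assume "jac (emb b c) (cmap b p) e1 = jac (emb b c) (cmap b p) e2"
  then have "dincl p (coord_vec B b e1 p) = dincl p (coord_vec B b e2 p)"
    by (simp add: dincl_coord[OF assms])
  then have "coord_vec B b e1 p = coord_vec B b e2 p"
    using inj_onD[OF dincl_inj] S.cdom_topspace[OF assms(1,2)] S.coord_vec_tangent[OF assms(1,2)] by blast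
  then show "e1 = e2" using S.coord_vec_self[OF assms(1,2)] by metis
qed

lemma jac_emb_range:
  assumes "b \<in> B" "p \<in> cdom b" "c \<in> A" "p \<in> cdom c"
  shows "range (jac (emb b c) (cmap b p)) = range (loc F c (cmap c p))"
proof (intro equalityI subsetI)
  note p = S.cdom_topspace[OF assms(1,2)]
  fix w assume "w \<in> range (jac (emb b c) (cmap b p))"
  then obtain e where e: "w = jac (emb b c) (cmap b p) e" by blast
  have "dincl p (coord_vec B b e p) \<in> D_l A F \<alpha> \<beta> K p"
    using dincl_image[OF p] S.coord_vec_tangent[OF assms(1,2)] by blast
  then show "w \<in> range (loc F c (cmap c p))"
    using D_l_iff[OF assms(3,4)] assms(3,4) by (simp add: dincl_coord[OF assms] e)
next
  note p = S.cdom_topspace[OF assms(1,2)]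
  fix w assume "w \<in> range (loc F c (cmap c p))"
  then have "coord_vec A c w p \<in> D_l A F \<alpha> \<beta> K p"
    using D_l_iff[OF assms(3,4)] coord_vec_tangent[OF assms(3,4)] assms(3,4) by simp
  then obtain u where u: "u \<in> tangent_space B p" "coord_vec A c w p = dincl p u"
    unfolding dincl_image[OF p, symmetric] by blast
  then have "w = jac (emb b c) (cmap b p) (u b)"
    using dincl_chart[OF assms u(1)] coord_vec_self[OF assms(3,4), of w] by simp
  then show "w \<in> range (jac (emb b c) (cmap b p))" by blast
qed

text \<open>The chart form of \<open>dincl p (F_ind p u) = F p (dincl p u)\<close>; it is the
  relation that \<open>nij_related\<close> asks of the embedding.\<close>

lemma F_ind_related:
  assumes b: "b \<in> B" and c: "c \<in> A" and y: "y \<in> edom b c"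
  shows "jac (emb b c) y o\<^sub>L S.loc F_ind b y = loc F c (emb b c y) o\<^sub>L jac (emb b c) y"
proof (rule blinfun_eqI)
  fix e
  let ?p = "cinv b y"
  have yb: "y \<in> cimage b" and p: "?p \<in> cdom b" "?p \<in> cdom c" and yp: "cmap b ?p = y"
    using y by (auto simp: edom_def)
  note pS = S.cdom_topspace[OF b p(1)]
  let ?u = "coord_vec B b e ?p"
  have u: "?u \<in> tangent_space B ?p" by (rule S.coord_vec_tangent[OF b p(1)])
  have "jac (emb b c) y (S.loc F_ind b y e) = dincl ?p (F_ind ?p ?u) c"
    using dincl_chart[OF b p(1) c p(2) F_ind_tangent(1)[OF pS u]] S.loc_coord[OF F_ind_endo b yb] yp by simp
  also have "\<dots> = F ?p (dincl ?p ?u) c" by (simp add: F_ind_tangent(2)[OF pS u])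
  also have "\<dots> = loc F c (emb b c y) (jac (emb b c) y e)"
    using loc_apply[OF F_endo c p(2) dincl_tangent[OF u pS]] dincl_chart[OF b p(1) c p(2) u] b p yp
    by (simp add: emb_def)
  finally show "(jac (emb b c) y o\<^sub>L S.loc F_ind b y) e = (loc F c (emb b c y) o\<^sub>L jac (emb b c) y) e" by simp
qed

lemma chart_through:
  assumes "b \<in> B" "y \<in> cimage b"
  obtains c where "c \<in> A" "y \<in> edom b c"
proof -
  have "cinv b y \<in> topspace M" using S.cinv_topspace[OF assms] sub by blast
  then obtain c where "c \<in> A" "cinv b y \<in> cdom c" using covering by blast
  then show thesis using that assms(2) by (simp add: edom_def)
qed

text \<open>In charts the induced tensor solves \<open>J R = T J\<close> with \<open>J\<close> injective, so locally
  \<open>R = (L J)\<^sup>-\<^sup>1 L T J\<close> for a left inverse \<open>L\<close> of \<open>J\<close> at a point.\<close>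

lemma F_ind_differentiable: "S.endo_diff F_ind"
  unfolding S.endo_diff_def
proof (intro conjI ballI F_ind_endo)
  fix b y assume b: "b \<in> B" and y: "y \<in> cimage b"
  obtain c where c: "c \<in> A" "y \<in> edom b c" by (rule chart_through[OF b y])
  let ?J = "jac (emb b c)" and ?T = "\<lambda>y. loc F c (emb b c y)"
  have p: "cinv b y \<in> cdom b" "cinv b y \<in> cdom c" "cmap b (cinv b y) = y" using c by (auto simp: edom_def)
  have "inj (?J y)" using jac_emb_inj[OF b p(1) c(1) p(2)] p(3) by simp
  then obtain g where g: "linear g" "\<And>v. g (?J y v) = v"
    using linear_injective_left_inverse[OF linear_blinfun_apply] by (metis comp_apply id_apply)
  let ?L = "Blinfun g"
  have L: "?L v = g v" for v by (rule Blinfun_linear_apply[OF g(1)])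
  note o = edom_open[OF b c(1)]
  have J: "smooth_on (edom b c) ?J" by (rule smooth_on_jac[OF o emb_smooth[OF b c(1)]])
  have T: "smooth_on (edom b c) ?T"
  proof (rule smooth_on_compose[OF o _ emb_smooth[OF b c(1)]])
    show "smooth_on (cimage c) (loc F c)" using F_smooth c(1) by (simp add: smooth_endo_def)
    show "emb b c ` edom b c \<subseteq> cimage c" using emb_mem(1)[OF c(1)] by blast
  qed
  define V where "V z = ?L o\<^sub>L ?J z" for z
  have V: "smooth_on (edom b c) V"
    unfolding V_def by (intro smooth_on_bilinear[OF bounded_bilinear_blinfun_compose] o smooth_on_const J)
  have "V y = id_blinfun" by (rule blinfun_eqI) (simp add: V_def L g)
  then obtain U R where U: "open U" "y \<in> U" "U \<subseteq> edom b c" and RV: "\<And>z. z \<in> U \<Longrightarrow> R z o\<^sub>L V z = id_blinfun"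
    and VR: "\<And>z. z \<in> U \<Longrightarrow> V z o\<^sub>L R z = id_blinfun" and R2: "\<And>z. z \<in> U \<Longrightarrow> norm (R z) \<le> 2"
    using blinfun_inverse_near[OF o c(2) smooth_on_continuous_on[OF V]] by metis
  have R: "smooth_on U R" by (rule smooth_on_blinfun_inverse[OF U(1) RV VR R2 smooth_on_subset[OF V U(3)]])
  have "smooth_on U (\<lambda>z. R z o\<^sub>L (?L o\<^sub>L (?T z o\<^sub>L ?J z)))"
    by (intro smooth_on_bilinear[OF bounded_bilinear_blinfun_compose] U(1) R smooth_on_const
        smooth_on_subset[OF T U(3)] smooth_on_subset[OF J U(3)])
  moreover have "R z o\<^sub>L (?L o\<^sub>L (?T z o\<^sub>L ?J z)) = S.loc F_ind b z" if z: "z \<in> U" for z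
  proof (rule blinfun_eqI)
    fix e
    have "?J z (S.loc F_ind b z e) = ?T z (?J z e)"
      using arg_cong[OF F_ind_related[OF b c(1), of z], of "\<lambda>Z. Z e"] z U(3) by auto
    then have "(R z o\<^sub>L (?L o\<^sub>L (?T z o\<^sub>L ?J z))) e = (R z o\<^sub>L V z) (S.loc F_ind b z e)"
      by (simp add: V_def)
    then show "(R z o\<^sub>L (?L o\<^sub>L (?T z o\<^sub>L ?J z))) e = S.loc F_ind b z e" by (simp add: RV[OF z])
  qed
  ultimately have "smooth_on U (S.loc F_ind b)" by (rule smooth_on_eq[OF U(1), rotated])
  then show "S.loc F_ind b differentiable (at y)"
    using smooth_on_has_derivative[OF _ U(2)] differentiable_def by blast
qed

lemma nij_F_ind:
  assumes b: "b \<in> B" and c: "c \<in> A" and y: "y \<in> edom b c"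
  shows "jac (emb b c) y (nij (S.loc F_ind b) y u v) =
    nij (loc F c) (emb b c y) (jac (emb b c) y u) (jac (emb b c) y v)"
proof -
  have "y \<in> cimage b" using y by (simp add: edom_def)
  then obtain Q' where Q': "(S.loc F_ind b has_derivative Q') (at y)"
    using F_ind_differentiable b unfolding S.endo_diff_def differentiable_def by blast
  have T: "(loc F c has_derivative frechet_derivative (loc F c) (at (emb b c y))) (at (emb b c y))"
    using F_smooth c emb_mem(1)[OF c y] smooth_on_has_derivative unfolding smooth_endo_def by blast
  show ?thesis
    by (rule nij_related[OF edom_open[OF b c] y emb_smooth[OF b c] F_ind_related[OF b c] Q' T])
qed

text \<open>The derivative of the embedding is injective, so vanishing is equivalent to vanishing of
  the Nijenhuis tensor of \<open>F\<close> on the range of that derivative, which is the range of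
  \<open>loc F c\<close>.\<close>

lemma integrable_F_ind_iff:
  "integrable_tensor S B F_ind \<longleftrightarrow> (\<forall>b\<in>B. \<forall>c\<in>A. \<forall>y\<in>edom b c. \<forall>u v.
     nij (loc F c) (emb b c y) (loc F c (emb b c y) u) (loc F c (emb b c y) v) = 0)"
    (is "_ \<longleftrightarrow> ?R")
proof -
  have "(\<forall>u v. nij (S.loc F_ind b) y u v = 0) \<longleftrightarrow>
      (\<forall>u v. nij (loc F c) (emb b c y) (loc F c (emb b c y) u) (loc F c (emb b c y) v) = 0)"
    if b: "b \<in> B" and c: "c \<in> A" and y: "y \<in> edom b c" for b c y
  proof -
    have p: "cinv b y \<in> cdom b" "cinv b y \<in> cdom c" "cmap b (cinv b y) = y" "emb b c y = cmap c (cinv b y)"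
      using y by (auto simp: edom_def emb_def)
    let ?J = "jac (emb b c) y"
    have "inj ?J" using jac_emb_inj[OF b p(1) c p(2)] p(3) by simp
    then have "nij (S.loc F_ind b) y u v = 0 \<longleftrightarrow> nij (loc F c) (emb b c y) (?J u) (?J v) = 0" for u v
      unfolding nij_F_ind[OF b c y, symmetric] by (metis blinfun.zero_right injD)
    moreover have "range ?J = range (loc F c (emb b c y))"
      using jac_emb_range[OF b p(1) c p(2)] p(3,4) by simp
    ultimately show ?thesis
      using all_range_cong[of ?J "loc F c (emb b c y)" "\<lambda>v w. nij (loc F c) (emb b c y) v w = 0"] by simp
  qed
  note iff = this
  show ?thesis
    unfolding S.integrable_tensor_iff[OF F_ind_differentiable]
  proof (intro iffI ballI)
    fix b c y assume "\<forall>b\<in>B. \<forall>y\<in>cimage b. \<forall>u v. nij (S.loc F_ind b) y u v = 0" "b \<in> B" "c \<in> A" "y \<in> edom b c"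
    moreover from this have "y \<in> cimage b" by (simp add: edom_def)
    ultimately show "\<forall>u v. nij (loc F c) (emb b c y) (loc F c (emb b c y) u) (loc F c (emb b c y) v) = 0"
      by (subst iff[symmetric]) auto
  next
    fix b y assume R: ?R and yb: "b \<in> B" "y \<in> cimage b"
    obtain c where c: "c \<in> A" "y \<in> edom b c" by (rule chart_through[OF yb])
    show "\<forall>u v. nij (S.loc F_ind b) y u v = 0"
      unfolding iff[OF yb(1) c] using R yb(1) c by blast
  qed
qed

end

section \<open>Existence of integral manifolds and the equivalence\<close>

context F_mfd
begin

text \<open>The image of the parametrisation \<open>\<phi>\<close>, carried to \<open>M\<close>, is
  covered by one chart. Its inverse parametrisation comes from the globally continuous
  \<open>Q\<close>, which makes \<open>\<iota>\<close> a homeomorphism onto its image with the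
  subspace topology.\<close>

lemma integral_manifold_through:
  assumes N: N_image and rd: "r = DIM('d::euclidean_space)" and p0: "p0 \<in> topspace M"
  obtains S and B :: "('m, 'd::euclidean_space) chart set"
  where "p0 \<in> topspace S" "integral_manifold M A (D_l A F \<alpha> \<beta> K) S B"
proof -
  obtain c where c: "c \<in> A" "p0 \<in> cdom c" using covering[OF p0] by blast
  define x0 where "x0 = cmap c p0"
  have x0: "x0 \<in> cimage c" using c by (simp add: x0_def)
  obtain \<delta> and \<phi> :: "'d \<Rightarrow> 'e" and Q :: "'e \<Rightarrow> 'd" where \<delta>: "\<delta> > 0"
    and \<phi>: "smooth_on (ball 0 \<delta>) \<phi>" "\<phi> 0 = x0" "\<phi> ` ball 0 \<delta> \<subseteq> cimage c" and Q: "linear Q"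
      "\<And>y. y \<in> ball 0 \<delta> \<Longrightarrow> Q (\<phi> y) = Q x0 + y"
    and d\<phi>: "\<And>y. y \<in> ball 0 \<delta> \<Longrightarrow> inj (frechet_derivative \<phi> (at y))"
      "\<And>y. y \<in> ball 0 \<delta> \<Longrightarrow> range (frechet_derivative \<phi> (at y)) = range (loc F c (\<phi> y))"
  proof (rule frobenius_image[OF cimage_open[OF c(1)] x0, of "loc F c" "loc G c"])
    show "smooth_on (cimage c) (loc F c)" "smooth_on (cimage c) (loc G c)"
      using F_smooth G_smooth c(1) by (auto simp: smooth_endo_def)
    show "nij (loc F c) x (loc F c x u) (loc F c x v) = 0" if "x \<in> cimage c" for x u v
      using N that c(1) unfolding N_image_def by blast
  qed (use loc_F_G c(1) loc_F_rank rd in auto)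
  let ?W = "ball (0::'d) \<delta>"
  define \<iota> where "\<iota> y = cinv c (\<phi> y)" for y
  define S where "S = subtopology M (\<iota> ` ?W)"
  \<comment> \<open>This map inverts \<open>\<iota>\<close> because
    \<open>Q (\<phi> y) - Q x0 = y\<close> on the ball.\<close>
  define b where "b = (\<iota> ` ?W, \<lambda>q. Q (cmap c q) - Q x0)"
  define B where "B = {b}"
  have \<phi>c: "\<phi> y \<in> cimage c" if "y \<in> ?W" for y using \<phi>(3) that by blast
  have \<iota>c: "\<iota> y \<in> cdom c" "cmap c (\<iota> y) = \<phi> y" if "y \<in> ?W" for y
    using \<phi>c[OF that] by (auto simp: \<iota>_def)
  have b\<iota>: "cmap b (\<iota> y) = y" if "y \<in> ?W" for y
    using \<iota>c[OF that] Q(2)[OF that] by (simp add: b_def)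
  have \<iota>inj: "inj_on \<iota> ?W" using b\<iota> by (metis inj_onI)
  have bdom: "cdom b = \<iota> ` ?W" by (simp add: b_def)
  have bimg: "cimage b = ?W" unfolding cimage_def bdom using b\<iota> by (force simp: image_iff)
  have binj: "inj_on (cmap b) (cdom b)" unfolding bdom using b\<iota> by (auto intro!: inj_onI)
  have cinvb: "cinv b y = \<iota> y" if "y \<in> ?W" for y
    unfolding cinv_def using inv_into_f_f[OF binj, of "\<iota> y"] b\<iota>[OF that] that by (simp add: bdom)
  have \<iota>M: "\<iota> ` ?W \<subseteq> topspace M" using \<iota>c cdom_topspace[OF c(1)] by blast
  then have topS: "topspace S = \<iota> ` ?W" by (auto simp: S_def)
  have \<phi>cont: "continuous_on ?W \<phi>" by (rule smooth_on_continuous_on[OF \<phi>(1)])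
  have S_mfd: "smooth_manifold S B"
  proof -
    have "homeomorphic_map (subtopology S (cdom b)) (top_of_set (cimage b)) (cmap b)"
      unfolding homeomorphic_map_maps
    proof (intro exI)
      have SS: "subtopology S (cdom b) = S"
        unfolding S_def bdom by (simp add: subtopology_subtopology)
      have "continuous_map S (subtopology M (cdom c)) (\<lambda>q. q)"
        unfolding S_def by (intro continuous_map_into_subtopology continuous_map_from_subtopology continuous_map_id[unfolded id_def])
          (use \<iota>c in auto)
      from continuous_map_compose[OF this cmap_continuous[OF c(1)]]
      have cS: "continuous_map S euclidean (cmap c)" by (simp add: comp_def)
      have "continuous_map euclidean euclidean (\<lambda>x. Q x - Q x0)"
        unfolding continuous_map_iff_continuous2
        using Q(1) by (intro continuous_on_diff continuous_on_const linear_continuous_on)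
          (simp add: linear_conv_bounded_linear)
      from continuous_map_compose[OF cS this]
      have "continuous_map S euclidean (\<lambda>q. Q (cmap c q) - Q x0)" by (simp add: comp_def)
      then have 1: "continuous_map S (top_of_set ?W) (cmap b)"
        by (intro continuous_map_into_subtopology) (use topS b\<iota> in \<open>auto simp: b_def\<close>)
      have "continuous_map (top_of_set ?W) (top_of_set (cimage c)) \<phi>"
        using \<phi>cont \<phi>(3) by auto
      from continuous_map_compose[OF this cinv_continuous[OF c(1)]]
      have 2: "continuous_map (top_of_set ?W) S \<iota>"
        unfolding S_def by (intro continuous_map_into_subtopology) (auto simp: comp_def \<iota>_def[abs_def])
      show "homeomorphic_maps (subtopology S (cdom b)) (top_of_set (cimage b)) (cmap b) \<iota>"
        unfolding SS bimg homeomorphic_maps_def using 1 2 b\<iota> topS by auto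
    qed
    moreover have "openin S (cdom b)" using topS bdom openin_topspace by metis
    ultimately have "is_chart S b" by (simp add: is_chart_def bimg)
    moreover have "smooth_on (cmap b ` (cdom b \<inter> cdom b)) (cmap b \<circ> cinv b)"
    proof -
      have "cmap b ` (cdom b \<inter> cdom b) = ?W" using bimg by (simp add: cimage_def)
      moreover have "smooth_on ?W (cmap b \<circ> cinv b)"
        by (rule smooth_on_eq[OF open_ball _ smooth_on_id[OF open_ball]]) (simp add: cinvb b\<iota>)
      ultimately show ?thesis by simp
    qed
    moreover have "Hausdorff_space S" "second_countable S"
      unfolding S_def using Hausdorff second_countable
      by (auto intro: Hausdorff_space_subtopology second_countable_subtopology)
    ultimately show ?thesis by (simp add: smooth_manifold_def B_def topS bdom)
  qed
  have incl: "smooth_map S B M A (\<lambda>p. p)"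
    unfolding smooth_map_def
  proof (intro conjI ballI)
    show "continuous_map S M (\<lambda>p. p)"
      unfolding S_def by (rule continuous_map_from_subtopology[OF continuous_map_id[unfolded id_def]])
    fix b' d assume "b' \<in> B" and d: "d \<in> A"
    then have b': "b' = b" by (simp add: B_def)
    \<comment> \<open>On \<open>V\<close> the inclusion reads as \<open>\<phi>\<close> followed by a
      transition map of \<open>M\<close>.\<close>
    define V where "V = ?W \<inter> \<phi> -` overlap c d"
    have V: "open V"
      unfolding V_def by (rule continuous_open_preimage[OF \<phi>cont open_ball overlap_open[OF c(1) d]])
    have "cmap b' ` (cdom b' \<inter> (\<lambda>p. p) -` cdom d) = V"
    proof (intro equalityI subsetI)
      fix y assume "y \<in> cmap b' ` (cdom b' \<inter> (\<lambda>p. p) -` cdom d)"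
      then obtain z where z: "z \<in> ?W" "\<iota> z \<in> cdom d" "y = cmap b (\<iota> z)" by (auto simp: b' bdom)
      then show "y \<in> V" using \<phi>c[OF z(1)] b\<iota>[OF z(1)] by (simp add: V_def overlap_def \<iota>_def)
    next
      fix y assume y: "y \<in> V"
      then have "y \<in> ?W" "\<iota> y \<in> cdom d" by (auto simp: V_def overlap_def \<iota>_def)
      then show "y \<in> cmap b' ` (cdom b' \<inter> (\<lambda>p. p) -` cdom d)"
        using b\<iota>[of y] by (auto simp: b' bdom intro!: image_eqI[of _ _ "\<iota> y"])
    qed
    moreover have "smooth_on V (\<lambda>y. transition c d (\<phi> y))"
      by (rule smooth_on_compose[OF V transition_smooth[OF c(1) d] smooth_on_subset[OF \<phi>(1)]]) (auto simp: V_def)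
    then have "smooth_on V (cmap d \<circ> (\<lambda>p. p) \<circ> cinv b')"
      by (rule smooth_on_eq[OF V, rotated]) (auto simp: V_def transition_def b' cinvb \<iota>_def)
    ultimately show "smooth_on (cmap b' ` (cdom b' \<inter> (\<lambda>p. p) -` cdom d)) (cmap d \<circ> (\<lambda>p. p) \<circ> cinv b')"
      by simp
  qed
  interpret immersed M A S B
    by unfold_locales (use S_mfd incl topS \<iota>M in auto)
  have bB: "b \<in> B" by (simp add: B_def)
  have "inj_on (dincl p) (tangent_space B p) \<and> dincl p ` tangent_space B p = D_l A F \<alpha> \<beta> K p"
    if pS: "p \<in> topspace S" for p
  proof -
    obtain y where y: "y \<in> ?W" "p = \<iota> y" using pS unfolding topS by blast
    have p: "p \<in> cdom b" "p \<in> cdom c" "cmap b p = y" "cmap c p = \<phi> y"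
      using y \<iota>c b\<iota> by (auto simp: bdom)
    \<comment> \<open>In the charts \<open>b\<close> and \<open>c\<close> the inclusion is
      \<open>\<phi>\<close> itself, so \<open>d\<phi>\<close> supplies both the injectivity and the
      image of the differential.\<close>
    have "frechet_derivative (emb b c) (at y) = frechet_derivative \<phi> (at y)"
      by (rule frechet_derivative_cong_open[OF open_ball y(1)]) (simp add: emb_def cinvb \<iota>c)
    then have J: "blinfun_apply (jac (emb b c) y) = frechet_derivative \<phi> (at y)"
      using emb_derivative(2)[OF bB c(1) p(1,2)] p(3) by simp
    have d: "dincl p u c = frechet_derivative \<phi> (at y) (u b)" if "u \<in> tangent_space B p" for u
      using dincl_chart[OF bB p(1) c(1) p(2) that] p(3) J by simp
    have "inj_on (dincl p) (tangent_space B p)"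
    proof (rule inj_onI)
      fix u v assume uv: "u \<in> tangent_space B p" "v \<in> tangent_space B p" "dincl p u = dincl p v"
      then have "u b = v b" using d d\<phi>(1)[OF y(1)] by (metis injD)
      then show "u = v" using S.tangent_eqI[OF bB p(1) uv(1,2)] by blast
    qed
    moreover have "dincl p ` tangent_space B p = D_l A F \<alpha> \<beta> K p"
    proof (intro equalityI subsetI)
      fix w assume "w \<in> dincl p ` tangent_space B p"
      then obtain u where u: "u \<in> tangent_space B p" "w = dincl p u" by blast
      then show "w \<in> D_l A F \<alpha> \<beta> K p"
        using D_l_iff[OF c(1) p(2)] dincl_tangent[OF u(1) pS] d[OF u(1)] d\<phi>(2)[OF y(1)] p(4) by auto
    next
      fix w assume "w \<in> D_l A F \<alpha> \<beta> K p"
      then have w: "w \<in> tangent_space A p" "w c \<in> range (frechet_derivative \<phi> (at y))"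
        using D_l_iff[OF c(1) p(2)] d\<phi>(2)[OF y(1)] p(4) by auto
      then obtain e where e: "w c = jac (emb b c) (cmap b p) e" using J p(3) by auto
      have "w = dincl p (coord_vec B b e p)"
        unfolding dincl_coord[OF bB p(1) c(1) p(2)] e[symmetric] using tangent_coord_vec[OF c(1) p(2) w(1)] by simp
      then show "w \<in> dincl p ` tangent_space B p" using S.coord_vec_tangent[OF bB p(1)] by blast
    qed
    ultimately show ?thesis by blast
  qed
  then have "integral_manifold M A (D_l A F \<alpha> \<beta> K) S B"
    unfolding integral_manifold_def using S_mfd incl sub by blast
  moreover have "p0 \<in> topspace S"
  proof -
    have "\<iota> 0 = p0" using c by (simp add: \<iota>_def \<phi>(2) x0_def)
    then show ?thesis unfolding topS using \<delta> by force
  qed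
  ultimately show thesis using that by blast
qed

lemma integral_manifold_locale:
  "integral_manifold M A (D_l A F \<alpha> \<beta> K) S B \<Longrightarrow> F_integral_mfd M A F \<alpha> \<beta> K r S B"
  unfolding integral_manifold_def
  by (intro F_integral_mfd.intro F_mfd_axioms immersed.intro smooth_mfd_axioms smooth_mfd.intro
      immersed_axioms.intro F_integral_mfd_axioms.intro) auto

text \<open>Forwards, integrability on the integral manifold through a given point yields the
  condition at that point. Backwards, the pointwise condition restricts to every integral manifold,
  and it also provides one through each point; \<open>r\<close> is the dimension of their model
  space.\<close>

lemma partially_integrable_iff:
  assumes "r = DIM('d::euclidean_space)"
  shows "partially_integrable TYPE('d) M A F \<alpha> \<beta> K \<longleftrightarrow> N_image"
proof
  assume PI: "partially_integrable TYPE('d) M A F \<alpha> \<beta> K"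
  show N_image
    unfolding N_image_def
  proof (intro ballI allI)
    fix c x u v assume c: "c \<in> A" and x: "x \<in> cimage c"
    let ?p = "cinv c x"
    obtain S and B :: "('m, 'd) chart set"
      where p: "?p \<in> topspace S" and S: "integral_manifold M A (D_l A F \<alpha> \<beta> K) S B"
      using PI cinv_topspace[OF c x] unfolding partially_integrable_def integrable_distribution_def by metis
    interpret F_integral_mfd M A F \<alpha> \<beta> K r S B by (rule integral_manifold_locale[OF S])
    have int: "integrable_tensor S B F_ind" using PI S unfolding partially_integrable_def by blast
    obtain b where b: "b \<in> B" "?p \<in> cdom b" using S.covering[OF p] by blast
    have "cmap b ?p \<in> edom b c" "emb b c (cmap b ?p) = x"
      using cmap_edom[OF b] emb_cmap[OF b] c x by auto
    then show "nij (loc F c) x (loc F c x u) (loc F c x v) = 0"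
      using int b(1) c unfolding integrable_F_ind_iff by metis
  qed
next
  assume N: N_image
  have "integrable_tensor S B (induced_tensor A B F)"
    if "integral_manifold M A (D_l A F \<alpha> \<beta> K) S B" for S and B :: "('m, 'd) chart set"
  proof -
    interpret F_integral_mfd M A F \<alpha> \<beta> K r S B by (rule integral_manifold_locale[OF that])
    show ?thesis unfolding integrable_F_ind_iff using N emb_mem(1) unfolding N_image_def by blast
  qed
  moreover have "integrable_distribution TYPE('d) M A (D_l A F \<alpha> \<beta> K)"
    unfolding integrable_distribution_def using integral_manifold_through[OF N assms] by metis
  ultimately show "partially_integrable TYPE('d) M A F \<alpha> \<beta> K"
    unfolding partially_integrable_def by blast
qed

end

theorem theorem6p2:
  fixes M :: "'m topology"
    and A :: "('m, 'e::euclidean_space) chart set"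
    and F :: "('m, 'e) endo_field"
    and \<alpha> \<beta> :: complex
    and K r :: nat
  assumes "smooth_manifold M A"
    and "3 \<le> K"
    and "F_structure M A F \<alpha> \<beta> K r"
    and "r = DIM('d::euclidean_space)"
  defines "PI \<equiv> partially_integrable TYPE('d) M A F \<alpha> \<beta> K"
    and "N_l \<equiv> (\<forall>X Y. smooth_vector_field M A X \<and> smooth_vector_field M A Y \<longrightarrow>
           (\<forall>p\<in>topspace M.
              cnijenhuis A F (\<lambda>q. l_op F \<alpha> \<beta> K q (X q, 0)) (\<lambda>q. l_op F \<alpha> \<beta> K q (Y q, 0)) p = 0))"
    and "N_F \<equiv> (\<forall>X Y. smooth_vector_field M A X \<and> smooth_vector_field M A Y \<longrightarrow>
           (\<forall>p\<in>topspace M. nijenhuis A F (\<lambda>q. F q (X q)) (\<lambda>q. F q (Y q)) p = 0))"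
  shows "(N_l \<longleftrightarrow> N_F) \<and> (PI \<longleftrightarrow> N_l) \<and> (PI \<longleftrightarrow> N_F)"
proof -
  interpret F_mfd M A F \<alpha> \<beta> K r
    using assms(1-3) by unfold_locales
  show ?thesis
    unfolding PI_def N_l_def N_F_def N_l_iff N_F_iff partially_integrable_iff[OF assms(4)] by blast
qed

end
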